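(* For every $\varepsilon>0$ there exists a $3$-regular bipartite graph $H$ such that $\mathrm{ex}(n,H)=O(n^{4/3+\varepsilon})$ as $n\to\infty$.
   Context: For a graph $H$ and a positive integer $n$, $\mathrm{ex}(n,H)$ denotes the maximum number of edges in an $n$-vertex graph that contains no subgraph isomorphic to $H$. *)

theory Defs
  imports Complex_Main "HOL-Library.Landau_Symbols"
begin

definition simple_graph :: "'a set \<Rightarrow> 'a set set \<Rightarrow> bool" where
  "simple_graph V E \<longleftrightarrow> finite V \<and> (\<forall>e\<in>E. e \<subseteq> V \<and> card e = 2)"

definition degree :: "'a set set \<Rightarrow> 'a \<Rightarrow> nat" where
  "degree E v = card {e\<in>E. v \<in> e}"

definition regular_graph :: "nat \<Rightarrow> 'a set \<Rightarrow> 'a set set \<Rightarrow> bool" where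
  "regular_graph d V E \<longleftrightarrow> simple_graph V E \<and> (\<forall>v\<in>V. degree E v = d)"

definition bipartite_graph :: "'a set \<Rightarrow> 'a set set \<Rightarrow> bool" where
  "bipartite_graph V E \<longleftrightarrow> simple_graph V E \<and>
     (\<exists>A B. A \<union> B = V \<and> A \<inter> B = {} \<and> (\<forall>e\<in>E. card (e \<inter> A) = 1 \<and> card (e \<inter> B) = 1))"

definition contains_copy :: "'b set \<Rightarrow> 'b set set \<Rightarrow> 'a set \<Rightarrow> 'a set set \<Rightarrow> bool" where
  "contains_copy VH EH V E \<longleftrightarrow>
     (\<exists>f. inj_on f VH \<and> f ` VH \<subseteq> V \<and> (\<forall>e\<in>EH. f ` e \<in> E))"

text \<open>Turan number ex(n,H); every n-vertex graph is isomorphic to one on {0..<n}.\<close>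
definition ex_num :: "nat \<Rightarrow> 'b set \<Rightarrow> 'b set set \<Rightarrow> nat" where
  "ex_num n VH EH = Max {card E | E. simple_graph {..<n} E \<and> \<not> contains_copy VH EH {..<n} E}"

end

theory Submission
  imports Defs "HOL-Analysis.L2_Norm" "HOL-Library.Nat_Bijection"
begin

text \<open>The graph \<open>H\<close> is a brick torus: \<open>2k\<close> layers in cyclic order, each consisting of \<open>l\<close> disjoint edges,
  such that consecutive layers span a \<open>4l\<close>-cycle whose edges belong alternately to a layer, to
  neither, to the other layer, to neither. A copy of \<open>H\<close> is therefore a closed walk of length \<open>2k\<close> in the
  auxiliary graph whose vertices are the layers in the host and whose edges are the \<open>4l\<close>-cycles,
  provided that no two layers on the walk meet.

  In a weighted graph in which only a small proportion of the neighbours of a vertex conflict with any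
  given vertex, Cauchy-Schwarz and the log-convexity of the return probabilities of the random walk
  show that closed walks with a conflict carry only a small part of the total weight. The same
  estimate, applied to the host itself, shows that most closed \<open>4l\<close>-walks are \<open>4l\<close>-cycles without pairs of
  vertices at distance two of large codegree; this codegree bound gives the conflict condition
  for the walk on layers. The host must satisfy that from any edge \<open>xy\<close> few steps \<open>yz\<close>
  lead to a large codegree of \<open>x\<close> and \<open>z\<close>.

  A dense graph contains an almost regular subgraph (choose \<open>S\<close> maximising \<open>e(S) / |S|\<^sup>\<alpha>\<close>). If few
  of its edges violate the codegree condition, delete them. Otherwise a dyadic class of codegrees, of size
  about \<open>t\<close>, carries much of the sum of squared codegrees while pairs of much larger codegree carry little of it;
  then, for a suitable vertex \<open>u\<close>, the bipartite graph between the neighbourhood of \<open>u\<close> and the vertices whose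
  codegree with \<open>u\<close> is about \<open>t\<close> is a host.\<close>

section \<open>Closed walks in weighted graphs\<close>

text \<open>The exponent 4/3 is forced by the walk on layers. Keep one layer of a nice cycle and
  prescribe a vertex of one edge of the other layer: at most \<open>T\<close> partners remain, each
  resulting cycle has weight about 1/D^3 times that of the remaining path, and the remaining paths
  have total weight about n. So a conflict costs about T n / D^3, against a total weight of at least
  1/2. With D = n^(1/3 + \<delta>) there is room for T to be a small power of n. If larger codegrees
  are typical, the link of \<open>u\<close> replaces the host: there the codegrees on one side are
  bounded by the choice of the class, and those on the other side by deleting few edges.

  The lengths come from comparing \<open>trace k\<close> with \<open>trace (Suc k)\<close>: the loss
  is at most the \<open>Suc k\<close>-th root of the number of vertices, so walks must be long in
  terms of that number. This is met once for host vertices (at most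
  \<open>(1 / \<theta>) ^ l\<close>) and once for states (twice the \<open>2 * l\<close>-th power of
  this), which leads to k = 2 l^2 + 1.\<close>

lemma weighted_Cauchy_Schwarz:
  fixes c f g :: "'a \<Rightarrow> real"
  assumes "\<And>i. i \<in> A \<Longrightarrow> c i \<ge> 0"
  shows "(\<Sum>i\<in>A. c i * f i * g i)\<^sup>2 \<le> (\<Sum>i\<in>A. c i * (f i)\<^sup>2) * (\<Sum>i\<in>A. c i * (g i)\<^sup>2)"
proof -
  let ?F = "\<lambda>i. sqrt (c i) * f i" and ?G = "\<lambda>i. sqrt (c i) * g i"
  have "\<bar>\<Sum>i\<in>A. c i * f i * g i\<bar> = \<bar>\<Sum>i\<in>A. ?F i * ?G i\<bar>"
    by (intro arg_cong[of _ _ abs] sum.cong) (simp_all add: assms mult.assoc mult.left_commute)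
  also have "\<dots> \<le> (\<Sum>i\<in>A. \<bar>?F i\<bar> * \<bar>?G i\<bar>)"
    by (rule order_trans[OF sum_abs]) (simp add: abs_mult)
  also have "\<dots> \<le> L2_set ?F A * L2_set ?G A"
    by (rule L2_set_mult_ineq)
  finally have "(\<Sum>i\<in>A. c i * f i * g i)\<^sup>2 \<le> (L2_set ?F A * L2_set ?G A)\<^sup>2"
    by (simp add: abs_le_square_iff[symmetric] L2_set_nonneg)
  also have "\<dots> = (\<Sum>i\<in>A. c i * (f i)\<^sup>2) * (\<Sum>i\<in>A. c i * (g i)\<^sup>2)"
    by (simp add: power_mult_distrib L2_set_def sum_nonneg assms)
  finally show ?thesis .
qed

definition words :: "'a set \<Rightarrow> nat \<Rightarrow> 'a list set" where
  "words X n = {xs. set xs \<subseteq> X \<and> length xs = n}"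

lemma finite_words [simp]: "finite X \<Longrightarrow> finite (words X n)"
  unfolding words_def by (rule finite_lists_length_eq)

lemma words_0 [simp]: "words X 0 = {[]}"
  by (auto simp: words_def)

lemma words_Suc: "words X (Suc n) = (\<lambda>(x, xs). x # xs) ` (X \<times> words X n)"
  by (auto simp: words_def length_Suc_conv image_iff)

lemma sum_words_Suc:
  "sum f (words X (Suc n)) = (\<Sum>x\<in>X. \<Sum>xs\<in>words X n. f (x # xs))"
proof -
  have "inj_on (\<lambda>(x, xs). x # xs) (X \<times> words X n)"
    by (auto simp: inj_on_def)
  then have "sum f (words X (Suc n)) = (\<Sum>(x, xs)\<in>X \<times> words X n. f (x # xs))"
    unfolding words_Suc by (subst sum.reindex) (auto simp: case_prod_unfold intro: sum.cong)
  then show ?thesis by (simp add: sum.cartesian_product)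
qed

lemma sum_words_add:
  "sum f (words X (m + n)) = (\<Sum>xs\<in>words X m. \<Sum>ys\<in>words X n. f (xs @ ys))"
proof (induction m arbitrary: f)
  case (Suc m)
  show ?case by (simp add: sum_words_Suc Suc.IH)
qed simp

lemma words_rotate: "rotate m xs \<in> words X n \<longleftrightarrow> xs \<in> words X n"
  by (simp add: words_def)

lemma bij_betw_rotate_words: "bij_betw (rotate m) (words X n) (words X n)"
proof (induction m)
  case (Suc m)
  have "bij_betw rotate1 (words X n) (words X n)"
  proof (rule bij_betwI')
    show "(rotate1 xs = rotate1 ys) = (xs = ys)" for xs ys :: "'a list"
      using inj_rotate1 by (metis injD)
    show "rotate1 xs \<in> words X n" if "xs \<in> words X n" for xs
      using that by (simp add: words_def)
    show "\<exists>xs\<in>words X n. ys = rotate1 xs" if "ys \<in> words X n" for ys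
    proof -
      obtain xs where "rotate1 xs = ys" using surj_rotate1 by (metis surjD)
      then show ?thesis using that by (intro bexI[of _ xs]) (auto simp: words_def)
    qed
  qed
  from bij_betw_trans[OF Suc.IH this] show ?case
    by (simp add: rotate_def funpow_Suc_right fun_eq_iff bij_betw_def o_def)
qed (simp add: bij_betw_def)

lemma sum_exists_le:
  fixes f :: "'a \<Rightarrow> real"
  assumes "finite I" "finite A" "\<And>x. f x \<ge> 0"
  shows "(\<Sum>x | x \<in> A \<and> (\<exists>i\<in>I. P i x). f x) \<le> (\<Sum>i\<in>I. \<Sum>x | x \<in> A \<and> P i x. f x)"
  using assms(1)
proof (induction I rule: finite_induct)
  case (insert i I)
  have "{x \<in> A. \<exists>i\<in>insert i I. P i x} = {x \<in> A. P i x} \<union> {x \<in> A. \<exists>i\<in>I. P i x}" by auto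
  then have "(\<Sum>x | x \<in> A \<and> (\<exists>i\<in>insert i I. P i x). f x)
      \<le> (\<Sum>x | x \<in> A \<and> P i x. f x) + (\<Sum>x | x \<in> A \<and> (\<exists>i\<in>I. P i x). f x)"
    using assms by (simp add: sum_Un sum_nonneg)
  with insert show ?case by simp
qed simp

section \<open>The reversible random walk of a weighted graph and its return probabilities\<close>

locale weighted_graph =
  fixes X :: "'a set" and w :: "'a \<Rightarrow> 'a \<Rightarrow> real"
  assumes fin: "finite X" and ne: "X \<noteq> {}"
    and sym: "w x y = w y x" and nonneg: "w x y \<ge> 0"
    and mass_pos': "x \<in> X \<Longrightarrow> (\<Sum>y\<in>X. w x y) > 0"
begin

definition mass :: "'a \<Rightarrow> real" where "mass x = (\<Sum>y\<in>X. w x y)"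

definition step :: "'a \<Rightarrow> 'a \<Rightarrow> real" where "step x y = w x y / mass x"

primrec kernel :: "nat \<Rightarrow> 'a \<Rightarrow> 'a \<Rightarrow> real" where
  "kernel 0 x z = (if x = z then 1 else 0)"
| "kernel (Suc k) x z = (\<Sum>y\<in>X. step x y * kernel k y z)"

text \<open>The first entry carries no factor, so this is a probability given the starting vertex:
  all paths of a fixed positive length together weigh \<open>card X\<close>, not 1.\<close>

fun path_prob :: "'a list \<Rightarrow> real" where
  "path_prob [] = 1"
| "path_prob [x] = 1"
| "path_prob (x # y # zs) = step x y * path_prob (y # zs)"

text \<open>The list omits the return to its head; rotations then act on closed walks, and positions
  are indices modulo the length.\<close>

definition loop_prob :: "'a list \<Rightarrow> real" where "loop_prob xs = path_prob (xs @ [hd xs])"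

text \<open>Even step numbers only: the trace of an even power is a sum of squares, to which
  Cauchy-Schwarz applies.\<close>

definition trace :: "nat \<Rightarrow> real" where "trace j = (\<Sum>z\<in>X. kernel (2 * j) z z)"

lemma mass_pos: "x \<in> X \<Longrightarrow> mass x > 0"
  using mass_pos' by (simp add: mass_def)

lemma mass_nonneg: "mass x \<ge> 0"
  unfolding mass_def by (intro sum_nonneg nonneg)

lemma step_nonneg: "step x y \<ge> 0"
  unfolding step_def by (intro divide_nonneg_nonneg nonneg mass_nonneg)

lemma kernel_nonneg: "kernel k x z \<ge> 0"
  by (induction k arbitrary: x) (auto intro!: sum_nonneg mult_nonneg_nonneg step_nonneg)

lemma path_prob_nonneg: "path_prob xs \<ge> 0"
  by (induction xs rule: path_prob.induct) (auto intro: mult_nonneg_nonneg step_nonneg)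

lemma loop_prob_nonneg: "loop_prob xs \<ge> 0"
  by (simp add: loop_prob_def path_prob_nonneg)

lemma sum_step: "x \<in> X \<Longrightarrow> (\<Sum>y\<in>X. step x y) = 1"
  using mass_pos[of x] by (simp add: step_def mass_def sum_divide_distrib[symmetric])

lemma sum_kernel: "x \<in> X \<Longrightarrow> (\<Sum>z\<in>X. kernel k x z) = 1"
proof (induction k arbitrary: x)
  case 0 then show ?case by (simp add: fin)
next
  case (Suc k)
  have "(\<Sum>z\<in>X. kernel (Suc k) x z) = (\<Sum>y\<in>X. step x y * (\<Sum>z\<in>X. kernel k y z))"
    by (simp add: sum_distrib_left) (rule sum.swap)
  with Suc show ?case by (simp add: sum_step)
qed

lemma kernel_add: "x \<in> X \<Longrightarrow> z \<in> X \<Longrightarrow> kernel (i + j) x z = (\<Sum>y\<in>X. kernel i x y * kernel j y z)"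
proof (induction i arbitrary: x)
  case 0
  have "(\<Sum>y\<in>X. kernel 0 x y * kernel j y z) = (\<Sum>y\<in>X. if x = y then kernel j y z else 0)"
    by (intro sum.cong) auto
  with 0 show ?case by (simp add: fin)
next
  case (Suc i)
  have "kernel (Suc i + j) x z = (\<Sum>u\<in>X. step x u * (\<Sum>y\<in>X. kernel i u y * kernel j y z))"
    using Suc by simp
  also have "\<dots> = (\<Sum>y\<in>X. \<Sum>u\<in>X. step x u * (kernel i u y * kernel j y z))"
    by (simp add: sum_distrib_left) (rule sum.swap)
  also have "\<dots> = (\<Sum>y\<in>X. kernel (Suc i) x y * kernel j y z)"
    by (simp add: sum_distrib_right mult.assoc)
  finally show ?case .
qed

lemma mass_step: "x \<in> X \<Longrightarrow> mass x * step x y = w x y"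
  using mass_pos[of x] by (simp add: step_def)

lemma kernel_1: "z \<in> X \<Longrightarrow> kernel (Suc 0) x z = step x z"
  by (simp add: fin if_distrib sum.delta cong: if_cong)

lemma reversible: "x \<in> X \<Longrightarrow> z \<in> X \<Longrightarrow> mass x * kernel k x z = mass z * kernel k z x"
proof (induction k arbitrary: x z)
  case (Suc k)
  have "mass x * kernel (Suc k) x z = (\<Sum>y\<in>X. (mass x * step x y) * kernel k y z)"
    by (simp add: sum_distrib_left mult.assoc)
  also have "\<dots> = (\<Sum>y\<in>X. (mass y * kernel k y z) * step y x)"
    by (intro sum.cong) (auto simp: mass_step sym[of x] mult_ac Suc.prems)
  also have "\<dots> = (\<Sum>y\<in>X. mass z * (kernel k z y * kernel (Suc 0) y x))"
    using Suc by (intro sum.cong) (auto simp: kernel_1 mult.assoc simp del: kernel.simps)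
  also have "\<dots> = mass z * kernel (k + Suc 0) z x"
    using Suc.prems by (simp only: kernel_add sum_distrib_left)
  finally show ?case by simp
qed simp

lemma trace_0: "trace 0 = card X"
  by (simp add: trace_def)

lemma trace_eq: "trace j = (\<Sum>z\<in>X. \<Sum>v\<in>X. kernel j z v * kernel j v z)"
  unfolding trace_def mult_2 by (simp add: kernel_add)

text \<open>This is the squared Hilbert-Schmidt norm of the \<open>j\<close>-th power of the walk
  operator after symmetrising it by \<open>mass\<close>.\<close>

lemma trace_eq_square:
  "trace j = (\<Sum>(z, v)\<in>X \<times> X. mass z / mass v * (kernel j z v)\<^sup>2)"
proof -
  have "mass z / mass v * (kernel j z v)\<^sup>2 = kernel j z v * kernel j v z" if "z \<in> X" "v \<in> X" for z v
    using reversible[of z v j] that mass_pos[of z] mass_pos[of v]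
    by (simp add: field_simps power2_eq_square)
  then show ?thesis
    unfolding trace_eq sum.cartesian_product by (intro sum.cong) auto
qed

text \<open>The eigenvalue 1 of the constant functions contributes 1. In place of spectral theory,
  the kernel is tested against \<open>mass v\<close> by Cauchy-Schwarz.\<close>

lemma trace_ge_1: "trace j \<ge> 1"
proof -
  let ?M = "\<Sum>z\<in>X. mass z"
  have M: "?M > 0" using fin ne by (simp add: sum_pos mass_pos)
  have "(\<Sum>(z, v)\<in>X \<times> X. mass z / mass v * kernel j z v * mass v) = (\<Sum>(z, v)\<in>X \<times> X. mass z * kernel j z v)"
    using mass_pos by (intro sum.cong) (auto simp: less_imp_neq[symmetric])
  also have "\<dots> = (\<Sum>z\<in>X. mass z * (\<Sum>v\<in>X. kernel j z v))"
    by (simp add: sum.cartesian_product[symmetric] sum_distrib_left)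
  finally have 1: "(\<Sum>(z, v)\<in>X \<times> X. mass z / mass v * kernel j z v * mass v) = ?M"
    by (simp add: sum_kernel)
  have 2: "(\<Sum>(z, v)\<in>X \<times> X. mass z / mass v * (mass v)\<^sup>2) = ?M * ?M"
    unfolding sum_product sum.cartesian_product
    using mass_pos by (intro sum.cong) (auto simp: power2_eq_square less_imp_neq[symmetric])
  have "?M\<^sup>2 \<le> trace j * (?M * ?M)"
    using weighted_Cauchy_Schwarz[of "X \<times> X" "\<lambda>(z, v). mass z / mass v" "\<lambda>(z, v). kernel j z v" "\<lambda>(z, v). mass v"]
    using 1 2 mass_nonneg by (simp add: trace_eq_square case_prod_unfold)
  with M show ?thesis by (simp add: power2_eq_square)
qed

text \<open>A return of \<open>2 * Suc j\<close> steps splits into \<open>j\<close> and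
  \<open>j + 2\<close> steps, so it is an inner product of two kernels.\<close>

lemma trace_log_convex: "(trace (Suc j))\<^sup>2 \<le> trace j * trace (Suc (Suc j))"
proof -
  have "trace (Suc j) = (\<Sum>z\<in>X. \<Sum>v\<in>X. kernel j z v * kernel (Suc (Suc j)) v z)"
  proof -
    have "2 * Suc j = j + Suc (Suc j)" by simp
    then show ?thesis unfolding trace_def using kernel_add by (metis (no_types, lifting) sum.cong)
  qed
  also have "\<dots> = (\<Sum>(z, v)\<in>X \<times> X. mass z / mass v * kernel j z v * kernel (Suc (Suc j)) z v)"
    unfolding sum.cartesian_product
  proof (intro sum.cong refl, safe)
    fix z v assume "z \<in> X" "v \<in> X"
    then show "kernel j z v * kernel (Suc (Suc j)) v z = mass z / mass v * kernel j z v * kernel (Suc (Suc j)) z v"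
      using reversible[of z v "Suc (Suc j)"] mass_pos[of z] mass_pos[of v]
      by (simp add: field_simps del: kernel.simps)
  qed
  finally show ?thesis
    using weighted_Cauchy_Schwarz[of "X \<times> X" "\<lambda>(z, v). mass z / mass v" "\<lambda>(z, v). kernel j z v" "\<lambda>(z, v). kernel (Suc (Suc j)) z v"]
      mass_nonneg by (simp add: trace_eq_square case_prod_unfold del: kernel.simps)
qed

text \<open>By log-convexity the ratios \<open>trace i / trace (Suc i)\<close> decrease in
  \<open>i\<close>, and their product over \<open>i \<le> k\<close> is
  \<open>card X / trace (Suc k)\<close>. Hence the last ratio is at most the \<open>Suc k\<close>-th
  root of that product.\<close>

lemma trace_power: "trace k ^ Suc k \<le> card X * trace (Suc k) ^ k"
proof (induction k)
  case 0 then show ?case by (simp add: trace_0)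
next
  case (Suc k)
  have pos: "trace j > 0" for j using trace_ge_1[of j] by linarith
  have "trace (Suc k) ^ k * trace (Suc k) ^ Suc (Suc k) = ((trace (Suc k))\<^sup>2) ^ Suc k"
    by (simp add: power_mult[symmetric] power_add[symmetric] mult_2)
  also have "\<dots> \<le> (trace k * trace (Suc (Suc k))) ^ Suc k"
    by (intro power_mono trace_log_convex) simp
  also have "\<dots> \<le> (card X * trace (Suc k) ^ k) * trace (Suc (Suc k)) ^ Suc k"
    unfolding power_mult_distrib using pos
    by (intro mult_right_mono Suc.IH) (simp add: less_imp_le)
  finally have "trace (Suc k) ^ k * trace (Suc k) ^ Suc (Suc k) \<le> trace (Suc k) ^ k * (card X * trace (Suc (Suc k)) ^ Suc k)"
    by (simp only: mult_ac)
  then show ?case using pos by (simp del: power_Suc)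
qed

lemma trace_ratio:
  assumes "real (card X) \<le> B ^ Suc k" "B \<ge> 0"
  shows "trace k \<le> B * trace (Suc k)"
proof (rule power_le_imp_le_base)
  have "trace k ^ Suc k \<le> card X * trace (Suc k) ^ k" by (rule trace_power)
  also have "\<dots> \<le> B ^ Suc k * trace (Suc k) ^ Suc k"
    using assms trace_ge_1[of "Suc k"] by (intro mult_mono power_increasing) auto
  finally show "trace k ^ Suc k \<le> (B * trace (Suc k)) ^ Suc k"
    by (simp only: power_mult_distrib)
  show "0 \<le> B * trace (Suc k)" using assms trace_ge_1[of "Suc k"] by simp
qed

section \<open>Weights of paths and closed walks as sums over words\<close>

lemma path_prob_append: "path_prob (xs @ y # ys) = path_prob (xs @ [y]) * path_prob (y # ys)"
  by (induction xs rule: path_prob.induct) auto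

lemma sum_path_prob_between:
  assumes "z \<in> X"
  shows "(\<Sum>R\<in>words X j. path_prob (x # R @ [z])) = kernel (Suc j) x z"
proof (induction j arbitrary: x)
  case 0 then show ?case using assms by (simp add: kernel_1 del: kernel.simps)
next
  case (Suc j)
  then show ?case by (simp add: sum_words_Suc sum_distrib_left[symmetric])
qed

lemma sum_path_prob_ends:
  "(\<Sum>L\<in>words X (Suc j). path_prob L * F (hd L) (last L)) = (\<Sum>y\<in>X. \<Sum>z\<in>X. kernel j y z * F y z)"
proof (induction j arbitrary: F)
  case 0
  then show ?case by (simp add: sum_words_Suc fin if_distrib if_distribR sum.delta cong: if_cong)
next
  case (Suc j)
  have "(\<Sum>L\<in>words X (Suc (Suc j)). path_prob L * F (hd L) (last L))
      = (\<Sum>x\<in>X. \<Sum>L\<in>words X (Suc j). path_prob L * (step x (hd L) * F x (last L)))"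
    unfolding sum_words_Suc[of _ _ "Suc j"]
  proof (intro sum.cong refl)
    fix x L assume "L \<in> words X (Suc j)"
    then obtain y M where "L = y # M" by (auto simp: words_Suc)
    then show "path_prob (x # L) * F (hd (x # L)) (last (x # L)) = path_prob L * (step x (hd L) * F x (last L))"
      by simp
  qed
  also have "\<dots> = (\<Sum>x\<in>X. \<Sum>y\<in>X. \<Sum>z\<in>X. kernel j y z * (step x y * F x z))"
    using Suc.IH[of "\<lambda>y z. step _ y * F _ z"] by simp
  also have "\<dots> = (\<Sum>x\<in>X. \<Sum>z\<in>X. \<Sum>y\<in>X. kernel j y z * (step x y * F x z))"
    by (intro sum.cong refl sum.swap)
  finally show ?case by (simp add: sum_distrib_left sum_distrib_right mult_ac)
qed

lemma loop_prob_split: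
  assumes "L \<noteq> []"
  shows "loop_prob (v # L @ R) = step v (hd L) * path_prob L * path_prob (last L # R @ [v])"
proof -
  have "path_prob (v # L) = step v (hd L) * path_prob L" using assms by (cases L) auto
  moreover have "v # L @ R @ [v] = (v # butlast L) @ last L # (R @ [v])"
    using assms by (metis append_butlast_last_id append_Cons append_Nil append_assoc)
  then have "loop_prob (v # L @ R) = path_prob ((v # butlast L) @ last L # (R @ [v]))"
    unfolding loop_prob_def by (simp only: list.sel append.simps append_assoc)
  moreover have "\<dots> = path_prob ((v # butlast L) @ [last L]) * path_prob (last L # R @ [v])"
    by (rule path_prob_append)
  ultimately show ?thesis using assms by simp
qed

lemma loop_prob_rotate1: "loop_prob (rotate1 xs) = loop_prob xs"
proof (cases xs)
  case (Cons x ys)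
  show ?thesis
  proof (cases ys)
    case (Cons y zs)
    have "path_prob ((y # zs) @ x # [y]) = path_prob ((y # zs) @ [x]) * path_prob [x, y]" by (rule path_prob_append)
    then show ?thesis using \<open>xs = x # ys\<close> Cons by (simp add: loop_prob_def mult.commute)
  qed (simp add: Cons loop_prob_def)
qed (simp add: loop_prob_def)

lemma loop_prob_rotate: "loop_prob (rotate m xs) = loop_prob xs"
  by (induction m) (simp_all add: loop_prob_rotate1 rotate_def)

lemma sum_loop_prob_rotate:
  "(\<Sum>xs | xs \<in> words X n \<and> P (rotate m xs). loop_prob xs) = (\<Sum>xs | xs \<in> words X n \<and> P xs. loop_prob xs)"
proof -
  have "bij_betw (rotate m) (words X n) (words X n)" by (rule bij_betw_rotate_words)
  then have "bij_betw (rotate m) {xs \<in> words X n. P (rotate m xs)} {xs \<in> words X n. P xs}"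
    unfolding bij_betw_def by (auto simp: inj_on_def image_iff)
  from sum.reindex_bij_betw[OF this, of loop_prob] show ?thesis by (simp add: loop_prob_rotate)
qed

lemma sum_loop_prob:
  "k > 0 \<Longrightarrow> (\<Sum>xs\<in>words X (2 * k). loop_prob xs) = trace k"
proof -
  assume "k > 0"
  then obtain i where "k = Suc i" by (auto simp: gr0_conv_Suc)
  then obtain j where j: "2 * k = Suc (Suc j)" by simp
  have "(\<Sum>xs\<in>words X (Suc (Suc j)). loop_prob xs) = (\<Sum>x\<in>X. \<Sum>R\<in>words X (Suc j). path_prob (x # R @ [x]))"
    by (simp add: sum_words_Suc[of _ _ "Suc j"] loop_prob_def)
  also have "\<dots> = trace k"
    unfolding trace_def j by (intro sum.cong refl sum_path_prob_between)
  finally show ?thesis using j by simp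
qed

text \<open>A closed walk is cut into \<open>v\<close>, a path \<open>L\<close> from y to z with
  \<open>j\<close> steps, and a return from z to \<open>v\<close> with \<open>Suc j\<close> steps.
  Cauchy-Schwarz separates the return, which gives \<open>trace (Suc j)\<close>, from the path. In
  the square of the path weight only one factor needs to remember \<open>R\<close>; averaging it
  over \<open>v\<close> gains \<sigma>, and what remains is \<open>trace j\<close>.\<close>

lemma loop_prob_bad_bound:
  assumes \<sigma>: "\<sigma> \<ge> 0"
    and bad: "\<And>L. L \<in> words X (Suc j) \<Longrightarrow> path_prob L > 0 \<Longrightarrow>
                (\<Sum>v | v \<in> X \<and> R v L. w (hd L) v) \<le> \<sigma> * mass (hd L)"
  shows "(\<Sum>xs | xs \<in> words X (2 * Suc j) \<and> R (hd xs) (take (Suc j) (tl xs)). loop_prob xs)\<^sup>2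
           \<le> \<sigma> * (trace (Suc j) * trace j)"
proof -
  let ?k = "Suc j"
  let ?S = "\<Sum>xs | xs \<in> words X (2 * ?k) \<and> R (hd xs) (take ?k (tl xs)). loop_prob xs"
  \<comment> \<open>Weight of the paths from \<open>y\<close> to \<open>z\<close> that are bad for
    \<open>v\<close>, out of the total \<open>kernel j y z\<close>.\<close>
  define hv where "hv v y z = (\<Sum>L\<in>words X ?k. if R v L \<and> hd L = y \<and> last L = z then path_prob L else 0)" for v y z
  have ends: "L \<noteq> [] \<and> hd L \<in> X \<and> last L \<in> X \<and> length L = ?k" if "L \<in> words X ?k" for L
  proof -
    have "L \<noteq> []" using that by (auto simp: words_def)
    then show ?thesis using that hd_in_set[of L] last_in_set[of L] by (auto simp: words_def)
  qed
  have pick: "(\<Sum>y\<in>X. \<Sum>z\<in>X. if a = y \<and> b = z then g y z else 0) = (g a b :: real)"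
    if "a \<in> X" "b \<in> X" for a b g
  proof -
    have "(\<Sum>y\<in>X. \<Sum>z\<in>X. if a = y \<and> b = z then g y z else 0)
        = (\<Sum>y\<in>X. if a = y then (\<Sum>z\<in>X. if b = z then g y z else 0) else 0)"
      by (intro sum.cong) auto
    then show ?thesis using that fin by simp
  qed
  have pkj: "kernel j y z = (\<Sum>L\<in>words X ?k. if hd L = y \<and> last L = z then path_prob L else 0)" if "y \<in> X" "z \<in> X" for y z
  proof -
    have "(\<Sum>L\<in>words X ?k. path_prob L * (if hd L = y \<and> last L = z then 1 else 0)) = kernel j y z"
      unfolding sum_path_prob_ends[of "\<lambda>a b. if a = y \<and> b = z then 1 else 0"]
      using pick[OF that, of "kernel j"] by (simp add: if_distrib conj_commute eq_commute cong: if_cong)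
    then show ?thesis by (simp add: if_distrib cong: if_cong)
  qed
  have hv0: "hv v y z \<ge> 0" for v y z
    unfolding hv_def by (intro sum_nonneg) (auto simp: path_prob_nonneg)
  have hv_le: "hv v y z \<le> kernel j y z" if "y \<in> X" "z \<in> X" for v y z
    unfolding hv_def pkj[OF that] by (intro sum_mono) (auto simp: path_prob_nonneg)
  have "?S = (\<Sum>xs\<in>words X (Suc (?k + j)). if R (hd xs) (take ?k (tl xs)) then loop_prob xs else 0)"
    by (simp add: sum.inter_filter fin mult_2 del: take_Suc)
  also have "\<dots> = (\<Sum>v\<in>X. \<Sum>L\<in>words X ?k. \<Sum>Q\<in>words X j.
                     if R v L then step v (hd L) * path_prob L * path_prob (last L # Q @ [v]) else 0)"
    unfolding sum_words_Suc[of _ _ "?k + j"] sum_words_add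
    by (intro sum.cong refl) (auto simp: loop_prob_split dest!: ends)
  also have "\<dots> = (\<Sum>v\<in>X. \<Sum>L\<in>words X ?k. if R v L then step v (hd L) * path_prob L * kernel ?k (last L) v else 0)"
    by (intro sum.cong refl) (simp add: sum_distrib_left[symmetric] sum_path_prob_between del: kernel.simps)
  also have "\<dots> = (\<Sum>v\<in>X. \<Sum>L\<in>words X ?k. \<Sum>y\<in>X. \<Sum>z\<in>X.
       if hd L = y \<and> last L = z then (if R v L then step v y * path_prob L * kernel ?k z v else 0) else 0)"
    by (intro sum.cong refl pick[symmetric]) (auto dest: ends)
  also have "\<dots> = (\<Sum>v\<in>X. \<Sum>y\<in>X. \<Sum>z\<in>X. \<Sum>L\<in>words X ?k.
       if hd L = y \<and> last L = z then (if R v L then step v y * path_prob L * kernel ?k z v else 0) else 0)"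
    by (subst sum.swap, subst (2) sum.swap) (rule refl)
  also have "\<dots> = (\<Sum>v\<in>X. \<Sum>y\<in>X. \<Sum>z\<in>X. (step v y * kernel ?k z v) * hv v y z)"
    unfolding hv_def sum_distrib_left by (intro sum.cong refl) (auto simp del: kernel.simps)
  \<comment> \<open>Reversing the return path leaves the weights \<open>w v y / mass z\<close>,
    which are the ones used in Cauchy-Schwarz.\<close>
  also have "\<dots> = (\<Sum>v\<in>X. \<Sum>y\<in>X. \<Sum>z\<in>X. w v y / mass z * kernel ?k v z * hv v y z)"
  proof (intro sum.cong refl)
    fix v y z assume "v \<in> X" "y \<in> X" "z \<in> X"
    then show "step v y * kernel ?k z v * hv v y z = w v y / mass z * kernel ?k v z * hv v y z"
      using reversible[of v z ?k] mass_pos[of v] mass_pos[of z]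
      by (simp add: step_def field_simps del: kernel.simps)
  qed
  finally have S: "?S = (\<Sum>(v, y, z)\<in>X \<times> X \<times> X. w v y / mass z * kernel ?k v z * hv v y z)"
    by (simp add: sum.cartesian_product case_prod_unfold)
  have 1: "(\<Sum>(v, y, z)\<in>X \<times> X \<times> X. w v y / mass z * (kernel ?k v z)\<^sup>2) = trace ?k"
  proof -
    have "(\<Sum>(v, y, z)\<in>X \<times> X \<times> X. w v y / mass z * (kernel ?k v z)\<^sup>2)
        = (\<Sum>v\<in>X. \<Sum>y\<in>X. \<Sum>z\<in>X. w v y / mass z * (kernel ?k v z)\<^sup>2)"
      by (simp add: sum.cartesian_product case_prod_unfold)
    also have "\<dots> = (\<Sum>v\<in>X. \<Sum>z\<in>X. \<Sum>y\<in>X. w v y / mass z * (kernel ?k v z)\<^sup>2)"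
      by (intro sum.cong refl sum.swap)
    also have "\<dots> = (\<Sum>v\<in>X. \<Sum>z\<in>X. mass v / mass z * (kernel ?k v z)\<^sup>2)"
      by (simp only: sum_distrib_right[symmetric] sum_divide_distrib[symmetric] mass_def[symmetric])
    finally show ?thesis by (simp add: trace_eq_square sum.cartesian_product del: kernel.simps)
  qed
  have "(\<Sum>(v, y, z)\<in>X \<times> X \<times> X. w v y / mass z * (hv v y z)\<^sup>2)
      \<le> (\<Sum>(v, y, z)\<in>X \<times> X \<times> X. w v y / mass z * (hv v y z * kernel j y z))"
    unfolding power2_eq_square case_prod_unfold
    by (intro sum_mono mult_left_mono hv_le hv0 divide_nonneg_nonneg nonneg mass_nonneg) auto
  also have "\<dots> = (\<Sum>v\<in>X. \<Sum>y\<in>X. \<Sum>z\<in>X. w v y / mass z * (hv v y z * kernel j y z))"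
    by (simp add: sum.cartesian_product case_prod_unfold)
  also have "\<dots> = (\<Sum>y\<in>X. \<Sum>z\<in>X. \<Sum>v\<in>X. w v y / mass z * (hv v y z * kernel j y z))"
    by (subst sum.swap, intro sum.cong refl sum.swap)
  also have "\<dots> = (\<Sum>y\<in>X. \<Sum>z\<in>X. kernel j y z / mass z * (\<Sum>v\<in>X. w v y * hv v y z))"
    by (simp add: sum_distrib_left sum_divide_distrib mult_ac)
  also have "\<dots> \<le> (\<Sum>y\<in>X. \<Sum>z\<in>X. kernel j y z / mass z * (\<sigma> * mass y * kernel j y z))"
  proof (intro sum_mono mult_left_mono divide_nonneg_nonneg kernel_nonneg mass_nonneg)
    fix y z assume yz: "y \<in> X" "z \<in> X"
    have "(\<Sum>v\<in>X. w v y * hv v y z)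
        = (\<Sum>v\<in>X. \<Sum>L\<in>words X ?k. if hd L = y \<and> last L = z then path_prob L * (if R v L then w (hd L) v else 0) else 0)"
      unfolding hv_def sum_distrib_left by (intro sum.cong refl) (auto simp: sym)
    also have "\<dots> = (\<Sum>L\<in>words X ?k. \<Sum>v\<in>X. if hd L = y \<and> last L = z then path_prob L * (if R v L then w (hd L) v else 0) else 0)"
      by (rule sum.swap)
    also have "\<dots> = (\<Sum>L\<in>words X ?k. if hd L = y \<and> last L = z then path_prob L * (\<Sum>v | v \<in> X \<and> R v L. w (hd L) v) else 0)"
    proof (intro sum.cong refl)
      fix L
      show "(\<Sum>v\<in>X. if hd L = y \<and> last L = z then path_prob L * (if R v L then w (hd L) v else 0) else 0)
          = (if hd L = y \<and> last L = z then path_prob L * (\<Sum>v | v \<in> X \<and> R v L. w (hd L) v) else 0)"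
        by (cases "hd L = y"; cases "last L = z") (auto simp: sum_distrib_left[symmetric] sum.inter_filter fin)
    qed
    also have "\<dots> \<le> (\<Sum>L\<in>words X ?k. if hd L = y \<and> last L = z then path_prob L * (\<sigma> * mass y) else 0)"
    proof (rule sum_mono)
      fix L assume L: "L \<in> words X ?k"
      have "path_prob L * (\<Sum>v | v \<in> X \<and> R v L. w (hd L) v) \<le> path_prob L * (\<sigma> * mass (hd L))"
      proof (cases "path_prob L > 0")
        case True then show ?thesis by (intro mult_left_mono bad L) auto
      next
        case False then show ?thesis using path_prob_nonneg[of L] by simp
      qed
      then show "(if hd L = y \<and> last L = z then path_prob L * (\<Sum>v | v \<in> X \<and> R v L. w (hd L) v) else 0)
            \<le> (if hd L = y \<and> last L = z then path_prob L * (\<sigma> * mass y) else 0)" by auto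
    qed
    also have "\<dots> = \<sigma> * mass y * kernel j y z"
      unfolding pkj[OF yz] sum_distrib_left by (intro sum.cong) auto
    finally show "(\<Sum>v\<in>X. w v y * hv v y z) \<le> \<sigma> * mass y * kernel j y z" .
  qed
  also have "\<dots> = \<sigma> * trace j"
    unfolding trace_eq_square sum_distrib_left sum.cartesian_product
    by (intro sum.cong) (auto simp: power2_eq_square)
  finally have 2: "(\<Sum>(v, y, z)\<in>X \<times> X \<times> X. w v y / mass z * (hv v y z)\<^sup>2) \<le> \<sigma> * trace j" .
  have "?S\<^sup>2 \<le> trace ?k * (\<Sum>(v, y, z)\<in>X \<times> X \<times> X. w v y / mass z * (hv v y z)\<^sup>2)"
    using weighted_Cauchy_Schwarz[of "X \<times> X \<times> X" "\<lambda>(v, y, z). w v y / mass z" "\<lambda>(v, y, z). kernel ?k v z" "\<lambda>(v, y, z). hv v y z"]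
      mass_nonneg nonneg 1 S by (simp add: case_prod_unfold del: kernel.simps)
  also have "\<dots> \<le> trace ?k * (\<sigma> * trace j)"
    using trace_ge_1[of ?k] by (intro mult_left_mono 2) auto
  finally show ?thesis by (simp only: mult_ac)
qed

text \<open>Rotation brings position \<open>i\<close> to the front, and position \<open>r\<close>
  becomes entry \<open>r - 1\<close> of \<open>L\<close>. Since \<open>bad\<close> is only asked for
  paths of positive weight, an application may use that consecutive entries of \<open>L\<close> are
  adjacent.\<close>

lemma loop_prob_shift_bound:
  assumes \<sigma>: "\<sigma> \<ge> 0" and B: "B \<ge> 0" "real (card X) \<le> B ^ Suc j"
    and r: "1 \<le> r" "r \<le> Suc j" and i: "i < 2 * Suc j"
    and bad: "\<And>L. L \<in> words X (Suc j) \<Longrightarrow> path_prob L > 0 \<Longrightarrow>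
                (\<Sum>v | v \<in> X \<and> C v (L ! (r - 1)). w (hd L) v) \<le> \<sigma> * mass (hd L)"
  shows "(\<Sum>xs | xs \<in> words X (2 * Suc j) \<and> C (xs ! i) (xs ! ((i + r) mod (2 * Suc j))). loop_prob xs)
           \<le> sqrt (\<sigma> * B) * trace (Suc j)"
proof -
  let ?n = "2 * Suc j"
  let ?S = "\<Sum>xs | xs \<in> words X ?n \<and> C (xs ! i) (xs ! ((i + r) mod ?n)). loop_prob xs"
  let ?P = "\<lambda>xs. C (hd xs) (take (Suc j) (tl xs) ! (r - 1))"
  have "{xs \<in> words X ?n. C (xs ! i) (xs ! ((i + r) mod ?n))} = {xs \<in> words X ?n. ?P (rotate i xs)}"
  proof (intro Collect_cong conj_cong refl)
    fix xs assume "xs \<in> words X ?n"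
    then have len: "length xs = ?n" by (simp add: words_def)
    let ?ys = "rotate i xs"
    have ne: "?ys \<noteq> []" using len by auto
    have "hd ?ys = xs ! i"
      using len i ne nth_rotate[of 0 xs i] by (simp add: hd_conv_nth)
    moreover have "take (Suc j) (tl ?ys) ! (r - 1) = ?ys ! r"
      using r len by (simp add: nth_tl del: take_Suc)
    moreover have "?ys ! r = xs ! ((i + r) mod ?n)"
      using r len nth_rotate[of r xs i] by simp
    ultimately show "C (xs ! i) (xs ! ((i + r) mod ?n)) = ?P ?ys" by simp
  qed
  then have "?S = (\<Sum>xs | xs \<in> words X ?n \<and> ?P (rotate i xs). loop_prob xs)" by simp
  also have "\<dots> = (\<Sum>xs | xs \<in> words X ?n \<and> ?P xs. loop_prob xs)"
    by (rule sum_loop_prob_rotate[of ?n ?P])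
  also have "\<dots> ^ 2 \<le> \<sigma> * (trace (Suc j) * trace j)"
    by (rule loop_prob_bad_bound[OF \<sigma>, where R = "\<lambda>v L. C v (L ! (r - 1))"]) (rule bad)
  also have "\<dots> \<le> \<sigma> * (trace (Suc j) * (B * trace (Suc j)))"
    using \<sigma> B trace_ge_1[of "Suc j"] by (intro mult_left_mono trace_ratio) auto
  also have "\<dots> = (sqrt (\<sigma> * B) * trace (Suc j))\<^sup>2"
    using \<sigma> B by (simp add: power2_eq_square mult_ac)
  finally show ?thesis
    by (rule power2_le_imp_le) (use \<sigma> B trace_ge_1[of "Suc j"] in auto)
qed

text \<open>One of the two arcs between the positions has at most \<open>Suc j\<close> steps, and
  the symmetry of \<open>C\<close> allows either end to come first.\<close>

lemma loop_prob_pair_bound: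
  assumes \<sigma>: "\<sigma> \<ge> 0" and B: "B \<ge> 0" "real (card X) \<le> B ^ Suc j"
    and ij: "i < 2 * Suc j" "i' < 2 * Suc j" "i \<noteq> i'"
    and C: "\<And>x y. C x y \<Longrightarrow> C y x"
    and bad: "\<And>x u. x \<in> X \<Longrightarrow> u \<in> X \<Longrightarrow> (\<Sum>v | v \<in> X \<and> C v u. w x v) \<le> \<sigma> * mass x"
  shows "(\<Sum>xs | xs \<in> words X (2 * Suc j) \<and> C (xs ! i) (xs ! i'). loop_prob xs) \<le> sqrt (\<sigma> * B) * trace (Suc j)"
proof -
  let ?n = "2 * Suc j"
  have main: "(\<Sum>xs | xs \<in> words X ?n \<and> C (xs ! a) (xs ! ((a + r) mod ?n)). loop_prob xs) \<le> sqrt (\<sigma> * B) * trace (Suc j)"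
    if "1 \<le> r" "r \<le> Suc j" "a < ?n" for a r
  proof (rule loop_prob_shift_bound[OF \<sigma> B that])
    fix L assume L: "L \<in> words X (Suc j)"
    then have "L \<noteq> []" "L ! (r - 1) \<in> X"
      using that nth_mem[of "r - 1" L] by (auto simp: words_def)
    moreover from this(1) have "hd L \<in> X" using L hd_in_set[of L] by (auto simp: words_def)
    ultimately show "(\<Sum>v | v \<in> X \<and> C v (L ! (r - 1)). w (hd L) v) \<le> \<sigma> * mass (hd L)"
      using bad by blast
  qed
  have *: "(\<Sum>xs | xs \<in> words X ?n \<and> C (xs ! a) (xs ! b). loop_prob xs) \<le> sqrt (\<sigma> * B) * trace (Suc j)"
    if "a < b" "b < ?n" for a b
  proof (cases "b - a \<le> Suc j")
    case True
    then show ?thesis using main[of "b - a" a] that by simp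
  next
    case False
    \<comment> \<open>The complementary arc starts at \<open>b\<close> and passes the end of the
      list.\<close>
    have "b + (?n - (b - a)) = a + ?n" using that by simp
    then have "(b + (?n - (b - a))) mod ?n = (a + ?n) mod ?n" by (rule arg_cong)
    also have "\<dots> = a" using that by (subst mod_add_self2) simp
    finally have "(\<Sum>xs | xs \<in> words X ?n \<and> C (xs ! b) (xs ! a). loop_prob xs) \<le> sqrt (\<sigma> * B) * trace (Suc j)"
      using main[of "?n - (b - a)" b] that False by simp
    moreover have "C (xs ! b) (xs ! a) = C (xs ! a) (xs ! b)" for xs using C by blast
    ultimately show ?thesis by simp
  qed
  show ?thesis
  proof (cases "i < i'")
    case True then show ?thesis using * ij by blast
  next
    case False
    moreover have "C (xs ! i) (xs ! i') = C (xs ! i') (xs ! i)" for xs using C by blast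
    ultimately show ?thesis using *[of i' i] ij by simp
  qed
qed

text \<open>A union bound: each of at most \<open>(2 * Suc j)\<^sup>2\<close> pairs of positions
  spoils a proportion \<open>sqrt (\<sigma> * B)\<close> of the total weight.\<close>

lemma conflict_free_closed_walk:
  assumes \<sigma>: "\<sigma> \<ge> 0" and B: "B \<ge> 0" "real (card X) \<le> B ^ Suc j"
    and C: "\<And>x y. C x y \<Longrightarrow> C y x"
    and bad: "\<And>x u. x \<in> X \<Longrightarrow> u \<in> X \<Longrightarrow> (\<Sum>v | v \<in> X \<and> C v u. w x v) \<le> \<sigma> * mass x"
    and small: "(2 * real (Suc j))\<^sup>2 * sqrt (\<sigma> * B) < 1"
  obtains xs where "xs \<in> words X (2 * Suc j)" "loop_prob xs > 0"
    "\<And>i i'. i < 2 * Suc j \<Longrightarrow> i' < 2 * Suc j \<Longrightarrow> i \<noteq> i' \<Longrightarrow> \<not> C (xs ! i) (xs ! i')"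
proof -
  let ?n = "2 * Suc j"
  define I where "I = {(i, i'). i < ?n \<and> i' < ?n \<and> i \<noteq> i'}"
  have I_sub: "I \<subseteq> {..<?n} \<times> {..<?n}" by (auto simp: I_def)
  then have finI: "finite I" by (rule finite_subset) auto
  have "card I \<le> ?n * ?n" using card_mono[OF _ I_sub] by simp
  then have cI: "real (card I) \<le> (2 * real (Suc j))\<^sup>2"
    unfolding power2_eq_square by (metis of_nat_le_iff of_nat_mult of_nat_numeral)
  let ?bad = "\<lambda>xs. \<exists>p\<in>I. C (xs ! fst p) (xs ! snd p)"
  have "(\<Sum>xs | xs \<in> words X ?n \<and> ?bad xs. loop_prob xs)
      \<le> (\<Sum>p\<in>I. \<Sum>xs | xs \<in> words X ?n \<and> C (xs ! fst p) (xs ! snd p). loop_prob xs)"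
    by (rule sum_exists_le) (simp_all add: finI fin loop_prob_nonneg)
  also have "\<dots> \<le> (\<Sum>p\<in>I. sqrt (\<sigma> * B) * trace (Suc j))"
    by (intro sum_mono loop_prob_pair_bound[OF \<sigma> B _ _ _ C bad]) (auto simp: I_def)
  also have "\<dots> \<le> (2 * real (Suc j))\<^sup>2 * (sqrt (\<sigma> * B) * trace (Suc j))"
    using cI \<sigma> B trace_ge_1[of "Suc j"] by (simp add: mult_right_mono)
  also have "\<dots> < trace (Suc j)"
    using mult_strict_right_mono[OF small, of "trace (Suc j)"] trace_ge_1[of "Suc j"] by (simp add: mult.assoc)
  also have "\<dots> = (\<Sum>xs\<in>words X ?n. loop_prob xs)" by (rule sum_loop_prob[symmetric]) simp
  finally have less: "(\<Sum>xs | xs \<in> words X ?n \<and> ?bad xs. loop_prob xs) < (\<Sum>xs\<in>words X ?n. loop_prob xs)" .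
  have "\<exists>xs\<in>words X ?n. loop_prob xs > 0 \<and> \<not> ?bad xs"
  proof (rule ccontr)
    assume "\<not> ?thesis"
    then have "loop_prob xs = 0" if "xs \<in> words X ?n" "\<not> ?bad xs" for xs
      using that loop_prob_nonneg[of xs] by force
    then have "(\<Sum>xs | xs \<in> words X ?n \<and> ?bad xs. loop_prob xs) = (\<Sum>xs\<in>words X ?n. loop_prob xs)"
      by (intro sum.mono_neutral_left) (auto simp: fin)
    with less show False by simp
  qed
  then show thesis using that by (force simp: I_def)
qed

end

section \<open>Closed walks through pairwise disjoint sets\<close>

context weighted_graph
begin

lemma step_pos_iff: "x \<in> X \<Longrightarrow> step x y > 0 \<longleftrightarrow> w x y > 0"
  using mass_pos[of x] by (simp add: step_def zero_less_divide_iff)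

lemma path_prob_pos_step: "path_prob xs > 0 \<Longrightarrow> Suc i < length xs \<Longrightarrow> step (xs ! i) (xs ! Suc i) > 0"
proof (induction xs arbitrary: i rule: path_prob.induct)
  case (3 x y zs)
  then have "step x y > 0" "path_prob (y # zs) > 0"
    using step_nonneg[of x y] path_prob_nonneg[of "y # zs"] by (auto simp: zero_less_mult_iff)
  with 3 show ?case by (cases i) auto
qed auto

lemma loop_prob_pos_edge:
  assumes "loop_prob xs > 0" "i < length xs" "set xs \<subseteq> X"
  shows "w (xs ! i) (xs ! (Suc i mod length xs)) > 0"
proof -
  have "step ((xs @ [hd xs]) ! i) ((xs @ [hd xs]) ! Suc i) > 0"
    using assms by (intro path_prob_pos_step) (auto simp: loop_prob_def)
  moreover have "(xs @ [hd xs]) ! Suc i = xs ! (Suc i mod length xs)"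
  proof (cases "Suc i = length xs")
    case True
    then show ?thesis using assms(2) by (cases xs) (auto simp: nth_append)
  next
    case False
    then show ?thesis using assms(2) by (simp add: nth_append)
  qed
  moreover have "xs ! i \<in> X" using assms by auto
  ultimately show ?thesis using assms(2) step_pos_iff by (simp add: nth_append)
qed

end

text \<open>Turns the spread condition, known only on average, into a pointwise one on an induced
  subgraph. \<open>Y\<close> maximises \<kappa> times its inner weight minus twice the sum of
  \<open>c\<close>. Removing \<open>x\<close> loses at most 2 \<kappa> times the weight at
  \<open>x\<close> and regains \<open>2 * c x\<close>, so at a maximiser the weight dominates
  \<open>c x\<close>.\<close>

lemma spread_subset:
  fixes w :: "'a \<Rightarrow> 'a \<Rightarrow> real" and S :: "'a \<Rightarrow> 'b set"
  assumes fin: "finite X" and sym: "\<And>x y. w x y = w y x" and nonneg: "\<And>x y. w x y \<ge> 0"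
    and \<kappa>: "\<kappa> > 0"
    and c: "\<And>x a. x \<in> X \<Longrightarrow> (\<Sum>y | y \<in> X \<and> a \<in> S y. w x y) \<le> c x"
    and total: "2 * (\<Sum>x\<in>X. c x) < \<kappa> * (\<Sum>x\<in>X. \<Sum>y\<in>X. w x y)"
  obtains Y where "Y \<subseteq> X" "Y \<noteq> {}" "\<And>x. x \<in> Y \<Longrightarrow> (\<Sum>y\<in>Y. w x y) > 0"
    "\<And>x a. x \<in> Y \<Longrightarrow> (\<Sum>y | y \<in> Y \<and> a \<in> S y. w x y) \<le> \<kappa> * (\<Sum>y\<in>Y. w x y)"
proof -
  define \<Phi> where "\<Phi> Y = \<kappa> * (\<Sum>x\<in>Y. \<Sum>y\<in>Y. w x y) - 2 * (\<Sum>x\<in>Y. c x)" for Y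
  define M where "M = Max (\<Phi> ` Pow X)"
  have M: "\<Phi> Y \<le> M" if "Y \<subseteq> X" for Y
    unfolding M_def using that fin by (intro Max_ge) auto
  have "M \<in> \<Phi> ` Pow X" unfolding M_def using fin by (intro Max_in) auto
  then obtain Y0 where "Y0 \<subseteq> X \<and> \<Phi> Y0 = M" by auto
  \<comment> \<open>Among the maximisers a smallest one is taken: removing a vertex then strictly
    lowers the value, and this strictness gives positive masses.\<close>
  from ex_has_least_nat[of "\<lambda>Y. Y \<subseteq> X \<and> \<Phi> Y = M", OF this, of card]
  obtain Y where Y: "Y \<subseteq> X" "\<Phi> Y = M" and least: "\<And>Z. Z \<subseteq> X \<Longrightarrow> \<Phi> Z = M \<Longrightarrow> card Y \<le> card Z"
    by blast
  have finY: "finite Y" using Y fin finite_subset by blast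
  have removed: "\<Phi> (Y - {x}) \<ge> \<Phi> Y - 2 * \<kappa> * (\<Sum>y\<in>Y. w x y) + 2 * c x" if x: "x \<in> Y" for x
  proof -
    let ?Z = "Y - {x}"
    have split: "sum f Y = f x + sum f ?Z" for f :: "'a \<Rightarrow> real"
      using x finY by (simp add: sum.remove)
    have "(\<Sum>u\<in>Y. \<Sum>y\<in>Y. w u y) = (\<Sum>y\<in>Y. w x y) + (\<Sum>u\<in>?Z. w u x + (\<Sum>y\<in>?Z. w u y))"
      by (subst split) (simp add: split[of "w _"])
    also have "\<dots> = (\<Sum>y\<in>Y. w x y) + (\<Sum>u\<in>?Z. w x u) + (\<Sum>u\<in>?Z. \<Sum>y\<in>?Z. w u y)"
      by (simp add: sum.distrib sym[of _ x])
    also have "(\<Sum>u\<in>?Z. w x u) \<le> (\<Sum>y\<in>Y. w x y)"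
      using split[of "w x"] nonneg by simp
    finally have "(\<Sum>u\<in>Y. \<Sum>y\<in>Y. w u y) \<le> 2 * (\<Sum>y\<in>Y. w x y) + (\<Sum>u\<in>?Z. \<Sum>y\<in>?Z. w u y)"
      by simp
    then have "\<kappa> * (\<Sum>u\<in>Y. \<Sum>y\<in>Y. w u y) \<le> \<kappa> * (2 * (\<Sum>y\<in>Y. w x y) + (\<Sum>u\<in>?Z. \<Sum>y\<in>?Z. w u y))"
      using \<kappa> by (intro mult_left_mono) auto
    then show ?thesis unfolding \<Phi>_def by (simp add: split[of c] algebra_simps)
  qed
  have keep: "\<kappa> * (\<Sum>y\<in>Y. w x y) > c x" if x: "x \<in> Y" for x
  proof (rule ccontr)
    assume "\<not> ?thesis"
    then have "\<Phi> (Y - {x}) \<ge> M" using removed[OF x] Y by simp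
    with M[of "Y - {x}"] Y have "\<Phi> (Y - {x}) = M" by auto
    with least[of "Y - {x}"] Y have "card Y \<le> card (Y - {x})" by auto
    then show False using x finY by (metis card_Diff1_less leD)
  qed
  have sub: "(\<Sum>y | y \<in> Y \<and> a \<in> S y. w x y) \<le> c x" if "x \<in> Y" for x a
  proof -
    have "(\<Sum>y | y \<in> Y \<and> a \<in> S y. w x y) \<le> (\<Sum>y | y \<in> X \<and> a \<in> S y. w x y)"
      using Y fin nonneg by (intro sum_mono2) auto
    also have "\<dots> \<le> c x" using c that Y by auto
    finally show ?thesis .
  qed
  show thesis
  proof (rule that[OF Y(1)])
    have "\<Phi> X > 0" using total by (simp add: \<Phi>_def)
    then have "\<Phi> Y > 0" using M[of X] Y by simp
    then show "Y \<noteq> {}" by (auto simp: \<Phi>_def)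
    fix x assume x: "x \<in> Y"
    have "c x \<ge> 0"
    proof -
      have "0 \<le> (\<Sum>y | y \<in> Y \<and> undefined \<in> S y. w x y)" by (intro sum_nonneg nonneg)
      then show ?thesis using sub[OF x] order_trans by blast
    qed
    with keep[OF x] have "\<kappa> * (\<Sum>y\<in>Y. w x y) > 0" by linarith
    then show "(\<Sum>y\<in>Y. w x y) > 0" using \<kappa> by (simp add: zero_less_mult_iff)
    show "(\<Sum>y | y \<in> Y \<and> a \<in> S y. w x y) \<le> \<kappa> * (\<Sum>y\<in>Y. w x y)" for a
      using sub[OF x, of a] keep[OF x] by linarith
  qed
qed

text \<open>A neighbour in \<open>Y\<close> meets \<open>S u\<close> with probability at most
  \<open>s * \<kappa>\<close>, namely \<kappa> for each element of \<open>S u\<close>.\<close>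

lemma disjoint_closed_walk:
  fixes w :: "'a \<Rightarrow> 'a \<Rightarrow> real" and S :: "'a \<Rightarrow> 'b set"
  assumes fin: "finite X" and sym: "\<And>x y. w x y = w y x" and nonneg: "\<And>x y. w x y \<ge> 0"
    and \<kappa>: "\<kappa> > 0"
    and c: "\<And>x a. x \<in> X \<Longrightarrow> (\<Sum>y | y \<in> X \<and> a \<in> S y. w x y) \<le> c x"
    and total: "2 * (\<Sum>x\<in>X. c x) < \<kappa> * (\<Sum>x\<in>X. \<Sum>y\<in>X. w x y)"
    and S: "\<And>x. x \<in> X \<Longrightarrow> finite (S x)" "\<And>x. x \<in> X \<Longrightarrow> card (S x) \<le> s"
    and B: "B \<ge> 0" "real (card X) \<le> B ^ Suc j"
    and small: "(2 * real (Suc j))\<^sup>2 * sqrt (s * \<kappa> * B) < 1"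
  obtains xs where "set xs \<subseteq> X" "length xs = 2 * Suc j"
    "\<And>i. i < 2 * Suc j \<Longrightarrow> w (xs ! i) (xs ! (Suc i mod (2 * Suc j))) > 0"
    "\<And>i i'. i < 2 * Suc j \<Longrightarrow> i' < 2 * Suc j \<Longrightarrow> i \<noteq> i' \<Longrightarrow> S (xs ! i) \<inter> S (xs ! i') = {}"
proof -
  obtain Y where Y: "Y \<subseteq> X" "Y \<noteq> {}" and pos: "\<And>x. x \<in> Y \<Longrightarrow> (\<Sum>y\<in>Y. w x y) > 0"
    and spread: "\<And>x a. x \<in> Y \<Longrightarrow> (\<Sum>y | y \<in> Y \<and> a \<in> S y. w x y) \<le> \<kappa> * (\<Sum>y\<in>Y. w x y)"
    using spread_subset[OF fin sym nonneg \<kappa> c total] by metis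
  have finY: "finite Y" using Y fin finite_subset by blast
  have cardY: "real (card Y) \<le> B ^ Suc j"
    using card_mono[OF fin Y(1)] B by linarith
  interpret weighted_graph Y w
    by standard (use finY Y sym nonneg pos in auto)
  let ?C = "\<lambda>x y. S x \<inter> S y \<noteq> {}"
  have conf: "(\<Sum>v | v \<in> Y \<and> ?C v u. w x v) \<le> s * \<kappa> * mass x" if "x \<in> Y" "u \<in> Y" for x u
  proof -
    have u: "finite (S u)" "card (S u) \<le> s" using S that Y by auto
    have "{v. v \<in> Y \<and> ?C v u} = {v \<in> Y. \<exists>a\<in>S u. a \<in> S v}" by auto
    then have "(\<Sum>v | v \<in> Y \<and> ?C v u. w x v) \<le> (\<Sum>a\<in>S u. \<Sum>v | v \<in> Y \<and> a \<in> S v. w x v)"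
      using sum_exists_le[OF u(1) finY, of "w x" "\<lambda>a v. a \<in> S v"] nonneg by simp
    also have "\<dots> \<le> (\<Sum>a\<in>S u. \<kappa> * mass x)"
      using spread that by (intro sum_mono) (simp add: mass_def)
    also have "\<dots> \<le> s * (\<kappa> * mass x)"
      using u \<kappa> mass_nonneg[of x] by (simp add: mult_right_mono)
    finally show ?thesis by (simp add: mult.assoc)
  qed
  show thesis
  proof (rule conflict_free_closed_walk[of "s * \<kappa>" B j ?C, OF _ B(1) cardY _ conf small])
    fix xs assume xs: "xs \<in> words Y (2 * Suc j)" "loop_prob xs > 0"
      and dis: "\<And>i i'. i < 2 * Suc j \<Longrightarrow> i' < 2 * Suc j \<Longrightarrow> i \<noteq> i' \<Longrightarrow> \<not> ?C (xs ! i) (xs ! i')"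
    have len: "length xs = 2 * Suc j" and set: "set xs \<subseteq> Y" using xs(1) by (simp_all add: words_def)
    have "w (xs ! i) (xs ! (Suc i mod (2 * Suc j))) > 0" if "i < 2 * Suc j" for i
      using loop_prob_pos_edge[OF xs(2), of i] that set by (simp only: len)
    moreover have "set xs \<subseteq> X" using set Y by blast
    ultimately show thesis using that len dis by blast
  qed (use \<kappa> in auto)
qed

section \<open>The brick torus\<close>

text \<open>Hosts are symmetric sets of ordered pairs, so that neighbourhoods are relational images
  and edge counts are counts of ordered pairs.\<close>

definition codeg :: "('a \<times> 'a) set \<Rightarrow> 'a \<Rightarrow> 'a \<Rightarrow> nat" where
  "codeg E x y = card (E `` {x} \<inter> E `` {y})"

definition deg :: "('a \<times> 'a) set \<Rightarrow> 'a \<Rightarrow> nat" where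
  "deg E x = card (E `` {x})"

lemma codeg_commute: "codeg E x y = codeg E y x"
  by (simp add: codeg_def Int_commute)

definition brick_V :: "nat \<Rightarrow> nat \<Rightarrow> (nat \<times> nat) set" where
  "brick_V l k = {..<2 * k} \<times> {..<2 * l}"

text \<open>The index drops by one from an even layer to either adjacent odd layer. In the cycle
  through both, entry 2i+1 of the even layer is followed by entry 2i of the odd one, and entry 2i+1
  of the odd layer by entry 2i+2 of the even one.\<close>

definition brick_E :: "nat \<Rightarrow> nat \<Rightarrow> (nat \<times> nat) set set" where
  "brick_E l k =
     {{(t, 2 * i), (t, Suc (2 * i))} | t i. t < 2 * k \<and> i < l} \<union>
     {{(t, j), (t', (j + 2 * l - 1) mod (2 * l))} | t t' j. even t \<and> t < 2 * k \<and> j < 2 * l \<and>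
        (t' = Suc t mod (2 * k) \<or> t' = (t + 2 * k - 1) mod (2 * k))}"

definition embeds :: "nat \<Rightarrow> nat \<Rightarrow> ('a \<times> 'a) set \<Rightarrow> bool" where
  "embeds l k E \<longleftrightarrow> (\<exists>f. inj_on f (brick_V l k) \<and> f ` brick_V l k \<subseteq> Domain E \<and>
     (\<forall>e\<in>brick_E l k. \<exists>x y. f ` e = {x, y} \<and> (x, y) \<in> E))"

text \<open>The \<open>4l\<close>-cycle \<open>x\<^sub>0 x\<^sub>1 x\<^sub>2 \<dots>\<close> joins two consecutive layers of the brick torus: the positions
  congruent to \<open>0, 1\<close> modulo \<open>4\<close> form one layer (\<open>r = 0\<close>), the others the next one (\<open>r = 2\<close>).\<close>

definition layer :: "nat \<Rightarrow> nat \<Rightarrow> 'a list \<Rightarrow> 'a list" where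
  "layer l r xs = map (\<lambda>j. xs ! (4 * (j div 2) + r + j mod 2)) [0..<2 * l]"

lemma length_layer [simp]: "length (layer l r xs) = 2 * l"
  by (simp add: layer_def)

lemma layer_index:
  fixes j l r :: nat
  assumes "j < 2 * l" "r \<le> 2"
  shows "4 * (j div 2) + r + j mod 2 < 4 * l"
proof -
  have "j div 2 < l" "j mod 2 < 2" using assms by auto
  then show ?thesis using assms(2) by linarith
qed

lemma nth_layer: "j < 2 * l \<Longrightarrow> layer l r xs ! j = xs ! (4 * (j div 2) + r + j mod 2)"
  by (simp add: layer_def)

lemma layer_in_words: "xs \<in> words X (4 * l) \<Longrightarrow> r \<le> 2 \<Longrightarrow> layer l r xs \<in> words X (2 * l)"
  using layer_index[of _ l r] by (fastforce simp: words_def layer_def)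

lemma layer_index_inj:
  fixes j j' r :: nat
  assumes "4 * (j div 2) + r + j mod 2 = 4 * (j' div 2) + r + j' mod 2"
  shows "j = j'"
proof -
  have "j mod 2 < 2" "j' mod 2 < 2" by auto
  then have "j div 2 = j' div 2" using assms by linarith
  moreover from this have "j mod 2 = j' mod 2" using assms by simp
  ultimately show ?thesis by (metis div_mult_mod_eq)
qed

lemma distinct_layer:
  assumes "distinct xs" "length xs = 4 * l" "r \<le> 2"
  shows "distinct (layer l r xs)"
proof (unfold distinct_conv_nth, intro allI impI)
  fix j j' assume j: "j < length (layer l r xs)" "j' < length (layer l r xs)" "j \<noteq> j'"
  then have "4 * (j div 2) + r + j mod 2 < length xs" "4 * (j' div 2) + r + j' mod 2 < length xs"
    using assms layer_index[of _ l r] by auto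
  then show "layer l r xs ! j \<noteq> layer l r xs ! j'"
    using j layer_index_inj[of j r j'] nth_eq_iff_index_eq[OF assms(1)] nth_layer length_layer by metis
qed

text \<open>Rotating two adjacent positions to the front, overwriting them and rotating back alters
  nothing else. Thus anything that ignores the two positions is a function of the remaining
  entries.\<close>

lemma nth_patch:
  assumes "length xs = n" "Suc i < n" "p < n" "p \<noteq> i" "p \<noteq> Suc i"
  shows "rotate (n - i) (c # c # drop 2 (rotate i xs)) ! p = xs ! p"
proof -
  let ?ys = "c # c # drop 2 (rotate i xs)"
  have len: "length ?ys = n" using assms by simp
  define q where "q = (p + (n - i)) mod n"
  have q: "q = (if i \<le> p then p - i else p + n - i)"
    using assms by (auto simp: q_def mod_if)
  have "q \<ge> 2" "q < n" "(q + i) mod n = p" using assms unfolding q by (auto simp: mod_if)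
  moreover have "rotate (n - i) ?ys ! p = ?ys ! q"
    using len assms by (subst nth_rotate) (auto simp: q_def add.commute)
  moreover have "?ys ! q = rotate i xs ! q"
    using \<open>q \<ge> 2\<close> \<open>q < n\<close> assms by (simp add: nth_Cons' numeral_2_eq_2 Suc_diff_Suc)
  moreover have "rotate i xs ! q = xs ! ((q + i) mod n)"
    using \<open>q < n\<close> assms by (subst nth_rotate) (auto simp: add.commute)
  ultimately show ?thesis by simp
qed

text \<open>The overwritten positions form an edge of the layer \<open>r'\<close>, so the layer
  \<open>r\<close> does not read them.\<close>

lemma layer_patch:
  assumes "length xs = 4 * l" "j < 2 * l" "r \<le> 2" "r' \<le> 2" "even r" "even r'" "r \<noteq> r'"
  shows "layer l r (rotate (4 * l - (4 * (j div 2) + r')) (c # c # drop 2 (rotate (4 * (j div 2) + r') xs))) = layer l r xs"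
proof -
  let ?i = "4 * (j div 2) + r'"
  have i: "Suc ?i < 4 * l"
  proof -
    have "j div 2 < l" using assms by auto
    then show ?thesis using assms(4) by linarith
  qed
  show ?thesis
    unfolding layer_def
  proof (intro map_cong refl)
    fix j' assume "j' \<in> set [0..<2 * l]"
    then have j': "j' < 2 * l" by simp
    have "4 * (j' div 2) + r + j' mod 2 \<noteq> ?i" "4 * (j' div 2) + r + j' mod 2 \<noteq> Suc ?i"
    proof -
      have "r = 0 \<and> r' = 2 \<or> r = 2 \<and> r' = 0"
        using assms(3-7) by (auto elim!: evenE)
      moreover have "4 * a + c \<noteq> 4 * b + 2" "4 * a + c \<noteq> Suc (4 * b + 2)" "4 * a + 2 + c \<noteq> 4 * b"
        "4 * a + 2 + c \<noteq> Suc (4 * b)" if "c < 2" for a b c :: nat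
        using that by presburger+
      moreover have "j' mod 2 < 2" by simp
      ultimately show "4 * (j' div 2) + r + j' mod 2 \<noteq> ?i" "4 * (j' div 2) + r + j' mod 2 \<noteq> Suc ?i"
        by fastforce+
    qed
    then show "rotate (4 * l - ?i) (c # c # drop 2 (rotate ?i xs)) ! (4 * (j' div 2) + r + j' mod 2)
        = xs ! (4 * (j' div 2) + r + j' mod 2)"
      using nth_patch[OF assms(1) i layer_index[OF j' assms(3)]] by blast
  qed
qed

lemma sum_fibres:
  fixes G :: "'b \<Rightarrow> 'c \<Rightarrow> 'a \<Rightarrow> real"
  assumes "finite A" "finite B" "\<And>x. x \<in> N \<Longrightarrow> p x \<in> A" "\<And>x. x \<in> N \<Longrightarrow> q x \<in> B"
  shows "(\<Sum>u\<in>A. \<Sum>v\<in>B. \<Sum>x\<in>N. if p x = u \<and> q x = v then G u v x else 0) = (\<Sum>x\<in>N. G (p x) (q x) x)"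
proof -
  have "(\<Sum>u\<in>A. \<Sum>v\<in>B. \<Sum>x\<in>N. if p x = u \<and> q x = v then G u v x else 0)
      = (\<Sum>x\<in>N. \<Sum>u\<in>A. \<Sum>v\<in>B. if p x = u \<and> q x = v then G u v x else 0)"
    by (subst (2) sum.swap, subst sum.swap) (rule refl)
  also have "\<dots> = (\<Sum>x\<in>N. \<Sum>u\<in>A. if p x = u then (\<Sum>v\<in>B. if q x = v then G u v x else 0) else 0)"
    by (intro sum.cong) auto
  also have "\<dots> = (\<Sum>x\<in>N. G (p x) (q x) x)"
    using assms by (intro sum.cong) simp_all
  finally show ?thesis .
qed

section \<open>Hosts with bounded codegrees\<close>

text \<open>\<open>few_bad\<close> counts \<open>z = x\<close> as bad and thereby also forces all
  degrees to be at least \<open>1 / \<theta> ^ 4\<close>. \<open>TQ\<close> and \<open>TP\<close>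
  compare \<open>T\<close> times the size of one side with the product of the degrees of three
  consecutive vertices of a walk; they are what makes conflicts between layers rare.\<close>

locale brick_host =
  fixes E :: "('a \<times> 'a) set" and P Q :: "'a set" and \<theta> a b T :: real and l :: nat
  assumes finE: "finite E" and symE: "sym E" and neE: "E \<noteq> {}"
    and bip: "E \<subseteq> P \<times> Q \<union> Q \<times> P" "P \<inter> Q = {}"
    and \<theta>: "0 < \<theta>" and l: "l \<ge> 2" and \<theta>l: "40 * (real l)\<^sup>2 * \<theta> \<le> 1"
    and size: "real (card (Domain E)) \<le> (1 / \<theta>) ^ l"
    and few_bad: "\<And>x y. (x, y) \<in> E \<Longrightarrow>
        real (card {z \<in> E `` {y}. z = x \<or> real (codeg E x z) > T}) \<le> \<theta> ^ 4 * deg E y"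
    and ab: "a > 0" "b > 0" and T: "T \<ge> 0"
    and degP: "\<And>x. x \<in> P \<inter> Domain E \<Longrightarrow> a \<le> deg E x"
    and degQ: "\<And>x. x \<in> Q \<inter> Domain E \<Longrightarrow> b \<le> deg E x"
    and TQ: "T * card (Q \<inter> Domain E) \<le> \<theta> ^ 4 * a\<^sup>2 * b"
    and TP: "T * card (P \<inter> Domain E) \<le> \<theta> ^ 4 * a * b\<^sup>2"
begin

abbreviation "V \<equiv> Domain E"
abbreviation "adj \<equiv> \<lambda>x y. of_bool ((x, y) \<in> E) :: real"

lemma E_sym: "(x, y) \<in> E \<Longrightarrow> (y, x) \<in> E"
  using symE by (auto dest: symD)

lemma E_V: "(x, y) \<in> E \<Longrightarrow> x \<in> V \<and> y \<in> V"
  using E_sym by blast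

lemma finV: "finite V"
  by (simp add: finE finite_Domain)

lemma finN: "finite (E `` {x})"
  by (rule finite_subset[OF _ finV]) (auto dest: E_V)

lemma sum_adj: "(\<Sum>v | v \<in> V \<and> R v. adj x v) = card {v \<in> E `` {x}. R v}"
proof -
  have "(\<Sum>v | v \<in> V \<and> R v. adj x v) = real (card ({v. v \<in> V \<and> R v} \<inter> {v. (x, v) \<in> E}))"
    using finV by (simp add: of_bool_def sum.If_cases)
  also have "{v. v \<in> V \<and> R v} \<inter> {v. (x, v) \<in> E} = {v \<in> E `` {x}. R v}"
    by (auto dest: E_V)
  finally show ?thesis .
qed

lemma sum_adj_all: "(\<Sum>v\<in>V. adj x v) = card (E `` {x})"
proof -
  have "{v. (x, v) \<in> E} = E `` {x}" by auto
  then show ?thesis using sum_adj[of x "\<lambda>_. True"] by simp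
qed

sublocale weighted_graph V adj
proof
  show "finite V" by (rule finV)
  show "V \<noteq> {}" using neE by auto
  show "adj x y = adj y x" for x y using E_sym by auto
  show "adj x y \<ge> 0" for x y by simp
  fix x assume "x \<in> V"
  then have "E `` {x} \<noteq> {}" by auto
  then show "(\<Sum>y\<in>V. adj x y) > 0"
    unfolding sum_adj_all using finN[of x] by (simp add: card_gt_0_iff)
qed

lemma mass_eq: "mass x = deg E x"
  by (simp only: mass_def deg_def sum_adj_all)

lemma step_eq: "step x y = adj x y / deg E x"
  by (simp add: step_def mass_eq)

lemma step_pos_edge: "step x y > 0 \<Longrightarrow> (x, y) \<in> E"
  by (cases "(x, y) \<in> E") (auto simp: step_eq)

lemma deg_ge: "x \<in> V \<Longrightarrow> 1 \<le> \<theta> ^ 4 * deg E x"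
proof -
  assume "x \<in> V"
  then obtain y where y: "(x, y) \<in> E" by blast
  let ?S = "{z \<in> E `` {x}. z = y \<or> real (codeg E y z) > T}"
  have "finite ?S" "y \<in> ?S" using y by (auto intro: finite_subset[OF _ finN[of x]])
  then have "1 \<le> card ?S" by (metis One_nat_def Suc_leI card_gt_0_iff empty_iff)
  then have "1 \<le> real (card ?S)" by simp
  then show ?thesis using few_bad[OF E_sym[OF y]] by linarith
qed

text \<open>The codegree condition at distance two serves the layers: it bounds the number of ways
  to complete an edge of a layer once one of its vertices is prescribed.\<close>

definition nice :: "'a list set" where
  "nice = {xs \<in> words V (4 * l). loop_prob xs > 0 \<and> distinct xs \<and>
            (\<forall>i<4 * l. real (codeg E (xs ! i) (xs ! ((i + 2) mod (4 * l)))) \<le> T)}"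

lemma fin_nice: "finite nice"
  unfolding nice_def by (simp add: finV)

lemma theta_le_1: "\<theta> \<le> 1"
proof -
  have "1 \<le> (real l)\<^sup>2" using l by (intro one_le_power) simp
  then have "1 * \<theta> \<le> 40 * (real l)\<^sup>2 * \<theta>"
    using \<theta> by (intro mult_right_mono) linarith+
  then show ?thesis using \<theta>l by simp
qed

text \<open>Weaker than \<open>size\<close>, but with the conflict probability
  \<open>\<theta> ^ 4\<close> this value of \<open>B\<close> makes the spoilt proportion equal to
  \<theta>.\<close>

lemma card_V_le: "real (card V) \<le> (1 / \<theta>\<^sup>2) ^ (2 * l)"
proof -
  have "(1 / \<theta>) ^ l \<le> (1 / \<theta>) ^ (2 * (2 * l))"
    using \<theta> theta_le_1 by (intro power_increasing) auto
  also have "\<dots> = ((1 / \<theta>)\<^sup>2) ^ (2 * l)" by (rule power_mult)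
  also have "\<dots> = (1 / \<theta>\<^sup>2) ^ (2 * l)" by (simp only: power_one_over)
  finally show ?thesis using size by linarith
qed

lemma sqrt_theta: "sqrt (\<theta> ^ 4 * (1 / \<theta>\<^sup>2)) = \<theta>"
proof -
  have "\<theta> ^ 4 = \<theta>\<^sup>2 * \<theta>\<^sup>2" by (simp add: power_add[symmetric])
  then have "\<theta> ^ 4 * (1 / \<theta>\<^sup>2) = \<theta>\<^sup>2 * \<theta>\<^sup>2 * (1 / \<theta>\<^sup>2)" by (rule arg_cong)
  also have "\<dots> = \<theta>\<^sup>2"
    unfolding times_divide_eq_right mult_1_right
    by (rule nonzero_mult_div_cancel_right) (use \<theta> in simp)
  finally have "\<theta> ^ 4 * (1 / \<theta>\<^sup>2) = \<theta>\<^sup>2" .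
  then show ?thesis using \<theta> by simp
qed

lemma repeated_vertex_weight:
  assumes "i < 4 * l" "i' < 4 * l" "i \<noteq> i'"
  shows "(\<Sum>xs | xs \<in> words V (4 * l) \<and> xs ! i = xs ! i'. loop_prob xs) \<le> \<theta> * trace (2 * l)"
proof -
  obtain j where j: "2 * l = Suc j" using l by (cases "2 * l") auto
  have n: "4 * l = 2 * Suc j" using j by simp
  have main: "(\<Sum>v | v \<in> V \<and> v = u. adj x v) \<le> \<theta> ^ 4 * mass x" if "x \<in> V" for x u
  proof -
    have "{v \<in> E `` {x}. v = u} \<subseteq> {u}" by auto
    from card_mono[OF _ this] have "real (card {v \<in> E `` {x}. v = u}) \<le> 1" by simp
    then show ?thesis using deg_ge[OF that] unfolding sum_adj mass_eq by linarith
  qed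
  have "(\<Sum>xs | xs \<in> words V (2 * Suc j) \<and> xs ! i = xs ! i'. loop_prob xs) \<le> sqrt (\<theta> ^ 4 * (1 / \<theta>\<^sup>2)) * trace (Suc j)"
    by (rule loop_prob_pair_bound[OF _ _ card_V_le[unfolded j] assms[unfolded n], of _ "(=)"], simp, simp, simp, rule main)
  then show ?thesis unfolding n j sqrt_theta .
qed

text \<open>\<open>few_bad\<close> bounds codegrees with \<open>L ! 1\<close> only because
  \<open>L ! 1\<close> is adjacent to \<open>hd L\<close>. Hence the shift bound with
  \<open>r = 2\<close> is applied, and not the pair bound, which quantifies over all pairs of
  vertices.\<close>

lemma heavy_pair_weight:
  assumes "i < 4 * l"
  shows "(\<Sum>xs | xs \<in> words V (4 * l) \<and> real (codeg E (xs ! i) (xs ! ((i + 2) mod (4 * l)))) > T. loop_prob xs) \<le> \<theta> * trace (2 * l)"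
proof -
  obtain j where j: "2 * l = Suc j" using l by (cases "2 * l") auto
  have n: "4 * l = 2 * Suc j" using j by simp
  have main: "(\<Sum>v | v \<in> V \<and> real (codeg E v (L ! (2 - 1))) > T. adj (hd L) v) \<le> \<theta> ^ 4 * mass (hd L)"
    if L: "L \<in> words V (Suc j)" "path_prob L > 0" for L
  proof -
    have len: "length L = Suc j" "j \<ge> 1" using L j l by (auto simp: words_def)
    then have "step (L ! 0) (L ! Suc 0) > 0" using L by (intro path_prob_pos_step) auto
    then have "(L ! Suc 0, L ! 0) \<in> E" by (rule E_sym[OF step_pos_edge])
    moreover have "hd L = L ! 0" using len by (intro hd_conv_nth) auto
    ultimately have e: "(L ! 1, hd L) \<in> E" by simp
    have "{v \<in> E `` {hd L}. real (codeg E v (L ! 1)) > T}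
        \<subseteq> {z \<in> E `` {hd L}. z = L ! 1 \<or> real (codeg E (L ! 1) z) > T}"
      by (auto simp: codeg_commute)
    then have "card {v \<in> E `` {hd L}. real (codeg E v (L ! 1)) > T}
        \<le> card {z \<in> E `` {hd L}. z = L ! 1 \<or> real (codeg E (L ! 1) z) > T}"
      by (rule card_mono[rotated]) (rule finite_subset[OF _ finN[of "hd L"]], blast)
    then show ?thesis using few_bad[OF e] unfolding sum_adj mass_eq by simp
  qed
  have *: "(1::nat) \<le> 2" "2 \<le> Suc j" "i < 2 * Suc j"
  proof -
    show "(1::nat) \<le> 2" by simp
    show "2 \<le> Suc j" using l unfolding j[symmetric] by presburger
    show "i < 2 * Suc j" using assms unfolding n .
  qed
  have "(\<Sum>xs | xs \<in> words V (2 * Suc j) \<and> real (codeg E (xs ! i) (xs ! ((i + 2) mod (2 * Suc j)))) > T. loop_prob xs)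
      \<le> sqrt (\<theta> ^ 4 * (1 / \<theta>\<^sup>2)) * trace (Suc j)"
    by (rule loop_prob_shift_bound[OF _ _ card_V_le[unfolded j] *, of _ "\<lambda>x y. real (codeg E x y) > T"], simp, simp, rule main)
  then show ?thesis unfolding n j sqrt_theta .
qed

text \<open>At most \<open>16 * l\<^sup>2\<close> pairs can coincide and \<open>4 * l\<close> pairs
  can be heavy, each for a proportion \<theta> of the weight. By \<open>\<theta>l\<close> this
  spoils at most half of the total, which is at least 1.\<close>

lemma nice_weight: "(\<Sum>xs\<in>nice. loop_prob xs) \<ge> 1 / 2"
proof -
  let ?W = "words V (4 * l)"
  define I where "I = {(i, i'). i < 4 * l \<and> i' < 4 * l \<and> i \<noteq> i'}"
  let ?eq = "\<lambda>xs. \<exists>p\<in>I. xs ! fst p = xs ! snd p"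
  let ?hv = "\<lambda>xs. \<exists>i\<in>{..<4 * l}. real (codeg E (xs ! i) (xs ! ((i + 2) mod (4 * l)))) > T"
  have I_sub: "I \<subseteq> {..<4 * l} \<times> {..<4 * l}" by (auto simp: I_def)
  then have finI: "finite I" by (rule finite_subset) auto
  have "card I \<le> (4 * l) * (4 * l)" using card_mono[OF _ I_sub] by simp
  then have "real (card I) \<le> real ((4 * l) * (4 * l))" by (simp only: of_nat_le_iff)
  then have cI: "real (card I) \<le> 16 * (real l)\<^sup>2" by (simp add: power2_eq_square)
  have eq: "(\<Sum>xs | xs \<in> ?W \<and> xs ! fst p = xs ! snd p. loop_prob xs) \<le> \<theta> * trace (2 * l)" if "p \<in> I" for p
  proof -
    obtain i i' where p: "p = (i, i')" by (cases p)
    then have "i < 4 * l" "i' < 4 * l" "i \<noteq> i'" using that by (simp_all add: I_def)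
    from repeated_vertex_weight[OF this] show ?thesis by (simp only: p fst_conv snd_conv)
  qed
  have t0: "trace (2 * l) \<ge> 1" by (rule trace_ge_1)
  have split3: "c \<le> (if A1 then c else 0) + ((if A2 then c else 0) + (if A3 then c else 0))"
    if "c = 0 \<or> A1 \<or> A2 \<or> A3" "c \<ge> 0" for c :: real and A1 A2 A3
    using that by auto
  have "2 * (2 * l) = 4 * l" "0 < 2 * l" using l by presburger+
  then have "trace (2 * l) = (\<Sum>xs\<in>?W. loop_prob xs)"
    using sum_loop_prob[of "2 * l"] by (simp only:)
  also have "\<dots> \<le> (\<Sum>xs\<in>?W. (if xs \<in> nice then loop_prob xs else 0) + ((if ?eq xs then loop_prob xs else 0) + (if ?hv xs then loop_prob xs else 0)))"
  proof (rule sum_mono)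
    fix xs assume W: "xs \<in> ?W"
    have "loop_prob xs = 0 \<or> xs \<in> nice \<or> ?eq xs \<or> ?hv xs"
    proof (cases "?hv xs \<or> ?eq xs \<or> xs \<in> nice")
      case False
      then have hv: "\<not> ?hv xs" and eq: "\<not> ?eq xs" and nn: "xs \<notin> nice" by blast+
      have len: "length xs = 4 * l" using W by (simp add: words_def)
      have "distinct xs"
        unfolding distinct_conv_nth len
      proof (intro allI impI notI)
        fix i i' assume "i < 4 * l" "i' < 4 * l" "i \<noteq> i'" "xs ! i = xs ! i'"
        then have "(i, i') \<in> I" "xs ! fst (i, i') = xs ! snd (i, i')" by (auto simp: I_def)
        with eq show False by blast
      qed
      moreover have "\<forall>i<4 * l. real (codeg E (xs ! i) (xs ! ((i + 2) mod (4 * l)))) \<le> T"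
      proof (intro allI impI)
        fix i assume "i < 4 * l"
        then have "\<not> real (codeg E (xs ! i) (xs ! ((i + 2) mod (4 * l)))) > T" using hv by blast
        then show "real (codeg E (xs ! i) (xs ! ((i + 2) mod (4 * l)))) \<le> T" by linarith
      qed
      ultimately have "\<not> loop_prob xs > 0" using nn W unfolding nice_def by blast
      then have "loop_prob xs = 0" using loop_prob_nonneg[of xs] by linarith
      then show ?thesis by blast
    qed blast
    then show "loop_prob xs \<le> (if xs \<in> nice then loop_prob xs else 0) + ((if ?eq xs then loop_prob xs else 0) + (if ?hv xs then loop_prob xs else 0))"
      using loop_prob_nonneg[of xs] by (rule split3)
  qed
  also have "\<dots> = (\<Sum>xs\<in>nice. loop_prob xs) + ((\<Sum>xs | xs \<in> ?W \<and> ?eq xs. loop_prob xs) + (\<Sum>xs | xs \<in> ?W \<and> ?hv xs. loop_prob xs))"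
  proof -
    have "{xs \<in> ?W. xs \<in> nice} = nice" by (auto simp: nice_def)
    moreover have "(\<Sum>xs\<in>?W. if R xs then loop_prob xs else 0) = sum loop_prob {xs \<in> ?W. R xs}" for R
      by (rule sum.inter_filter[symmetric]) (simp add: finV)
    ultimately show ?thesis by (simp only: sum.distrib)
  qed
  also have "(\<Sum>xs | xs \<in> ?W \<and> ?eq xs. loop_prob xs) \<le> (\<Sum>p\<in>I. \<theta> * trace (2 * l))"
  proof -
    have "(\<Sum>xs | xs \<in> ?W \<and> ?eq xs. loop_prob xs)
        \<le> (\<Sum>p\<in>I. \<Sum>xs | xs \<in> ?W \<and> xs ! fst p = xs ! snd p. loop_prob xs)"
      by (rule sum_exists_le) (simp_all add: finI finV loop_prob_nonneg)
    also have "\<dots> \<le> (\<Sum>p\<in>I. \<theta> * trace (2 * l))"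
      by (rule sum_mono) (rule eq)
    finally show ?thesis .
  qed
  also have "(\<Sum>xs | xs \<in> ?W \<and> ?hv xs. loop_prob xs) \<le> (\<Sum>i<4 * l. \<theta> * trace (2 * l))"
  proof -
    have "(\<Sum>xs | xs \<in> ?W \<and> ?hv xs. loop_prob xs)
        \<le> (\<Sum>i<4 * l. \<Sum>xs | xs \<in> ?W \<and> real (codeg E (xs ! i) (xs ! ((i + 2) mod (4 * l)))) > T. loop_prob xs)"
      by (rule sum_exists_le) (simp_all add: finV loop_prob_nonneg)
    also have "\<dots> \<le> (\<Sum>i<4 * l. \<theta> * trace (2 * l))"
      by (rule sum_mono, rule heavy_pair_weight) simp
    finally show ?thesis .
  qed
  also have "(\<Sum>p\<in>I. \<theta> * trace (2 * l)) \<le> 16 * (real l)\<^sup>2 * (\<theta> * trace (2 * l))"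
    using cI \<theta> t0 by (simp add: mult_right_mono)
  also have "(\<Sum>i<4 * l. \<theta> * trace (2 * l)) \<le> 4 * (real l)\<^sup>2 * (\<theta> * trace (2 * l))"
  proof -
    have "real l \<le> (real l)\<^sup>2" using l by (simp add: power2_eq_square)
    then have "4 * real l * (\<theta> * trace (2 * l)) \<le> 4 * (real l)\<^sup>2 * (\<theta> * trace (2 * l))"
      using \<theta> t0 by (intro mult_right_mono) auto
    then show ?thesis by simp
  qed
  finally have "trace (2 * l) \<le> (\<Sum>xs\<in>nice. loop_prob xs) + 20 * (real l)\<^sup>2 * \<theta> * trace (2 * l)"
    by (simp add: algebra_simps)
  also have "20 * (real l)\<^sup>2 * \<theta> * trace (2 * l) \<le> 1 / 2 * trace (2 * l)"
    using \<theta>l t0 by (intro mult_right_mono) auto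
  finally show ?thesis using t0 by linarith
qed

section \<open>Nice cycles in which one vertex is prescribed by the others\<close>

lemma nice_rotate: "rotate i xs \<in> nice \<longleftrightarrow> xs \<in> nice"
proof -
  have imp: "rotate i xs \<in> nice" if "xs \<in> nice" for i xs
  proof -
    have len: "length xs = 4 * l" using that by (simp add: nice_def words_def)
    have "real (codeg E (rotate i xs ! p) (rotate i xs ! ((p + 2) mod (4 * l)))) \<le> T" if "p < 4 * l" for p
    proof -
      have "(p + 2) mod (4 * l) < 4 * l" using that by simp
      then have "rotate i xs ! ((p + 2) mod (4 * l)) = xs ! (((p + i) mod (4 * l) + 2) mod (4 * l))"
        using len by (simp add: nth_rotate mod_simps add.commute add.left_commute)
      then show ?thesis using \<open>xs \<in> nice\<close> len that by (simp add: nth_rotate nice_def add.commute)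
    qed
    then show ?thesis using that by (simp add: nice_def words_rotate loop_prob_rotate)
  qed
  have "rotate (length xs - i mod length xs) (rotate i xs) = xs" if "xs \<noteq> []"
  proof -
    have "rotate (length xs - i mod length xs) (rotate i xs) = rotate (length xs - i mod length xs + i mod length xs) xs"
      by (metis rotate_rotate rotate_conv_mod)
    also have "length xs - i mod length xs + i mod length xs = length xs" using that by simp
    finally show ?thesis by (simp add: rotate_id)
  qed
  then show ?thesis using imp by (metis rotate_is_Nil_conv)
qed

text \<open>Bounds the reciprocal of the degrees of \<open>u\<close>, \<open>y\<close> and the last
  vertex in a closed walk \<open>u # y # R\<close>. Sides alternate, so the two ends of
  \<open>R\<close> determine the sides of all three.\<close>

definition end_weight :: "'a \<Rightarrow> 'a \<Rightarrow> real" where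
  "end_weight y z = (if y \<in> P \<and> z \<in> Q then 1 / (a * b\<^sup>2) else if y \<in> Q \<and> z \<in> P then 1 / (a\<^sup>2 * b) else 0)"

lemma end_weight_nonneg: "end_weight y z \<ge> 0"
  using ab by (simp add: end_weight_def)

lemma loop_prob_front:
  assumes "R \<noteq> []"
  shows "loop_prob (u # y # R) = step u y * step y (hd R) * path_prob R * step (last R) u"
  using loop_prob_split[of "y # R" u "[]"] assms by (cases R) (auto simp: mult.assoc)

lemma loop_prob_front_le:
  assumes "R \<noteq> []"
  shows "loop_prob (u # y # R) \<le> path_prob R * end_weight (hd R) (last R)"
proof (cases "(u, y) \<in> E \<and> (y, hd R) \<in> E \<and> (last R, u) \<in> E")
  case False
  then have "loop_prob (u # y # R) = 0" using assms by (auto simp: loop_prob_front step_eq)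
  then show ?thesis using path_prob_nonneg end_weight_nonneg by simp
next
  case True
  let ?du = "real (deg E u)" and ?dy = "real (deg E y)" and ?dz = "real (deg E (last R))"
  have V: "u \<in> V" "y \<in> V" "last R \<in> V" using True E_V by blast+
  have inv: "1 / (d1 * d2 * d3) \<le> 1 / (c1 * c2 * c3)"
    if "0 < c1" "0 < c2" "0 < c3" "c1 \<le> d1" "c2 \<le> d2" "c3 \<le> d3" for c1 c2 c3 d1 d2 d3 :: real
    using that by (intro divide_left_mono mult_mono mult_pos_pos) auto
  have "1 / (?du * ?dy * ?dz) \<le> end_weight (hd R) (last R)"
  proof (cases "u \<in> P")
    case True': True
    then have "y \<in> Q" "hd R \<in> P" "last R \<in> Q" using True bip by blast+
    then show ?thesis using inv[of a b b ?du ?dy ?dz] degP[of u] degQ[of y] degQ[of "last R"] V True' ab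
      by (simp add: end_weight_def power2_eq_square mult.assoc)
  next
    case False
    then have "u \<in> Q" "y \<in> P" "hd R \<in> Q" "last R \<in> P" using True bip by blast+
    moreover have "hd R \<notin> P" using \<open>hd R \<in> Q\<close> bip by blast
    ultimately show ?thesis using inv[of b a a ?du ?dy ?dz] degQ[of u] degP[of y] degP[of "last R"] V ab
      by (simp add: end_weight_def power2_eq_square mult_ac)
  qed
  then have "path_prob R * (1 / (?du * ?dy * ?dz)) \<le> path_prob R * end_weight (hd R) (last R)"
    by (intro mult_left_mono path_prob_nonneg)
  moreover have "loop_prob (u # y # R) = path_prob R * (1 / (?du * ?dy * ?dz))"
    using True assms by (simp add: loop_prob_front step_eq)
  ultimately show ?thesis by simp
qed

text \<open>Given its first vertex, the path has total probability one; only the number of first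
  vertices on each side counts.\<close>

lemma sum_end_weight:
  "T * (\<Sum>R\<in>words V (Suc m). path_prob R * end_weight (hd R) (last R)) \<le> 2 * \<theta> ^ 4"
proof -
  have "(\<Sum>R\<in>words V (Suc m). path_prob R * end_weight (hd R) (last R)) = (\<Sum>y\<in>V. \<Sum>z\<in>V. kernel m y z * end_weight y z)"
    by (rule sum_path_prob_ends)
  also have "\<dots> \<le> (\<Sum>y\<in>V. (if y \<in> P then 1 / (a * b\<^sup>2) else 0) + (if y \<in> Q then 1 / (a\<^sup>2 * b) else 0))"
  proof (rule sum_mono)
    fix y assume y: "y \<in> V"
    let ?c = "(if y \<in> P then 1 / (a * b\<^sup>2) else 0) + (if y \<in> Q then 1 / (a\<^sup>2 * b) else 0)"
    have "(\<Sum>z\<in>V. kernel m y z * end_weight y z) \<le> (\<Sum>z\<in>V. kernel m y z * ?c)"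
      using ab bip by (intro sum_mono mult_left_mono kernel_nonneg) (auto simp: end_weight_def)
    also have "\<dots> = ?c" using y by (simp only: sum_distrib_right[symmetric] sum_kernel mult_1_left)
    finally show "(\<Sum>z\<in>V. kernel m y z * end_weight y z) \<le> ?c" .
  qed
  also have "\<dots> = card (P \<inter> V) / (a * b\<^sup>2) + card (Q \<inter> V) / (a\<^sup>2 * b)"
    using finV by (simp add: sum.distrib sum.If_cases Int_commute del: sum_of_bool_eq)
  finally have "T * (\<Sum>R\<in>words V (Suc m). path_prob R * end_weight (hd R) (last R))
      \<le> T * (card (P \<inter> V) / (a * b\<^sup>2) + card (Q \<inter> V) / (a\<^sup>2 * b))"
    using T by (intro mult_left_mono)
  also have "\<dots> = T * card (P \<inter> V) / (a * b\<^sup>2) + T * card (Q \<inter> V) / (a\<^sup>2 * b)"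
    by (simp add: distrib_left)
  also have "\<dots> \<le> \<theta> ^ 4 + \<theta> ^ 4"
    using TP TQ ab by (intro add_mono) (simp_all add: divide_le_eq mult.assoc)
  finally show ?thesis by simp
qed

text \<open>Fix the rest \<open>R\<close> and one of the two front vertices. The other one is a
  common neighbour of two vertices at distance two on a nice cycle, so at most \<open>T\<close>
  cycles remain, each of weight at most
  \<open>path_prob R * end_weight (hd R) (last R)\<close>.\<close>

lemma nice_front_fixed:
  assumes e: "e < 2"
  shows "(\<Sum>xs | xs \<in> words V (4 * l) \<and> xs \<in> nice \<and> xs ! e = g (drop 2 xs). loop_prob xs) \<le> 2 * \<theta> ^ 4"
proof -
  have "4 * l = Suc (Suc (Suc (4 * l - 3)))" using l by simp
  then obtain m where m: "4 * l = Suc (Suc (Suc m))" by blast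
  let ?c = "\<lambda>u y R. if u # y # R \<in> nice \<and> (u # y # R) ! e = g R then loop_prob (u # y # R) else 0"
  have "(\<Sum>xs | xs \<in> words V (4 * l) \<and> xs \<in> nice \<and> xs ! e = g (drop 2 xs). loop_prob xs)
      = (\<Sum>xs\<in>words V (Suc (Suc (Suc m))). if xs \<in> nice \<and> xs ! e = g (drop 2 xs) then loop_prob xs else 0)"
    unfolding m by (simp add: sum.inter_filter finV)
  also have "\<dots> = (\<Sum>u\<in>V. \<Sum>y\<in>V. \<Sum>R\<in>words V (Suc m). ?c u y R)"
    unfolding sum_words_Suc[of _ _ "Suc (Suc m)"] sum_words_Suc[of _ _ "Suc m"] by simp
  also have "\<dots> = (\<Sum>R\<in>words V (Suc m). \<Sum>u\<in>V. \<Sum>y\<in>V. ?c u y R)"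
    by (subst (2) sum.swap, subst sum.swap) (rule refl)
  also have "\<dots> \<le> (\<Sum>R\<in>words V (Suc m). T * (path_prob R * end_weight (hd R) (last R)))"
  proof (rule sum_mono)
    fix R assume R: "R \<in> words V (Suc m)"
    then have ne: "R \<noteq> []" and len: "length R = Suc m" by (auto simp: words_def)
    define K where "K = {p \<in> V \<times> V. fst p # snd p # R \<in> nice \<and> (fst p # snd p # R) ! e = g R}"
    have K_edges: "(u, y) \<in> E \<and> (y, hd R) \<in> E \<and> (last R, u) \<in> E \<and> codeg E u (hd R) \<le> T \<and> codeg E (last R) y \<le> T"
      if "(u, y) \<in> K" for u y
    proof -
      have nice: "u # y # R \<in> nice" using that by (simp add: K_def)
      then have "loop_prob (u # y # R) > 0" by (simp add: nice_def)
      then have "step u y \<noteq> 0" "step y (hd R) \<noteq> 0" "step (last R) u \<noteq> 0" using ne by (auto simp: loop_prob_front)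
      then have edges: "(u, y) \<in> E" "(y, hd R) \<in> E" "(last R, u) \<in> E" by (auto simp: step_eq)
      have cod: "real (codeg E ((u # y # R) ! i) ((u # y # R) ! ((i + 2) mod (4 * l)))) \<le> T" if "i < 4 * l" for i
        using nice that by (simp add: nice_def)
      have 1: "codeg E u (hd R) \<le> T" using cod[of 0] m ne by (simp add: hd_conv_nth)
      have "(u # y # R) ! (Suc (Suc m)) = last R" using ne len by (simp add: last_conv_nth)
      moreover have "(Suc (Suc m) + 2) mod (4 * l) = Suc 0"
      proof -
        have "Suc (Suc m) + 2 = Suc 0 + 4 * l" using m by simp
        then have "(Suc (Suc m) + 2) mod (4 * l) = (Suc 0 + 4 * l) mod (4 * l)" by (rule arg_cong)
        also have "\<dots> = Suc 0 mod (4 * l)" by (rule mod_add_self2)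
        finally show ?thesis using l by simp
      qed
      ultimately have "codeg E (last R) y \<le> T" using cod[of "Suc (Suc m)"] m by simp
      with edges 1 show ?thesis by blast
    qed
    have finK: "finite K" unfolding K_def using finV by simp
    have "real (card K) \<le> T"
    proof (cases "K = {}")
      case True then show ?thesis using T by simp
    next
      case False
      \<comment> \<open>A single completion supplies the codegree bound by which all of them are
        counted.\<close>
      then obtain u0 y0 where K0: "(u0, y0) \<in> K" by auto
      show ?thesis
      proof (cases "e = 0")
        case True
        have "K \<subseteq> Pair (g R) ` (E `` {u0} \<inter> E `` {hd R})"
        proof (intro subsetI)
          fix p assume p: "p \<in> K"
          obtain u y where [simp]: "p = (u, y)" by (cases p)
          have "u = g R" "u0 = g R" using p K0 True by (simp_all add: K_def)
          then show "p \<in> Pair (g R) ` (E `` {u0} \<inter> E `` {hd R})"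
            using K_edges[of u y] p E_sym by auto
        qed
        then have "card K \<le> codeg E u0 (hd R)" unfolding codeg_def
          by (rule order_trans[OF card_mono card_image_le, rotated]) (simp_all add: finN)
        then show ?thesis using K_edges[OF K0] by linarith
      next
        case False
        then have e1: "e = 1" using e by simp
        have "K \<subseteq> (\<lambda>u. (u, g R)) ` (E `` {last R} \<inter> E `` {y0})"
        proof (intro subsetI)
          fix p assume p: "p \<in> K"
          obtain u y where [simp]: "p = (u, y)" by (cases p)
          have "y = g R" "y0 = g R" using p K0 e1 by (simp_all add: K_def)
          then show "p \<in> (\<lambda>u. (u, g R)) ` (E `` {last R} \<inter> E `` {y0})"
            using K_edges[of u y] p E_sym by auto
        qed
        then have "card K \<le> codeg E (last R) y0" unfolding codeg_def
          by (rule order_trans[OF card_mono card_image_le, rotated]) (simp_all add: finN)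
        then show ?thesis using K_edges[OF K0] by linarith
      qed
    qed
    have "(\<Sum>u\<in>V. \<Sum>y\<in>V. ?c u y R) = (\<Sum>p\<in>K. loop_prob (fst p # snd p # R))"
      unfolding K_def sum.cartesian_product using finV by (simp add: sum.inter_filter case_prod_unfold)
    also have "\<dots> \<le> (\<Sum>p\<in>K. path_prob R * end_weight (hd R) (last R))"
      by (intro sum_mono loop_prob_front_le ne)
    also have "\<dots> \<le> T * (path_prob R * end_weight (hd R) (last R))"
      using \<open>real (card K) \<le> T\<close> path_prob_nonneg[of R] end_weight_nonneg by (simp add: mult_right_mono)
    finally show "(\<Sum>u\<in>V. \<Sum>y\<in>V. ?c u y R) \<le> T * (path_prob R * end_weight (hd R) (last R))" .
  qed
  also have "\<dots> \<le> 2 * \<theta> ^ 4"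
    unfolding sum_distrib_left[symmetric] by (rule sum_end_weight)
  finally show ?thesis .
qed

end

text \<open>The elements range over a whole type, but only finitely many partial sums occur. This
  provides a worst vertex for every state.\<close>

lemma ex_max_subset_sum:
  fixes f :: "'a \<Rightarrow> real" and S :: "'a \<Rightarrow> 'b set"
  assumes "finite X"
  shows "\<exists>a. \<forall>b. (\<Sum>y | y \<in> X \<and> b \<in> S y. f y) \<le> (\<Sum>y | y \<in> X \<and> a \<in> S y. f y)"
proof -
  let ?F = "range (\<lambda>b. \<Sum>y | y \<in> X \<and> b \<in> S y. f y)"
  have "?F \<subseteq> sum f ` Pow X" by auto
  then have fin: "finite ?F" using assms finite_subset by blast
  then have "Max ?F \<in> ?F" by (intro Max_in) auto
  then obtain a where "Max ?F = (\<Sum>y | y \<in> X \<and> a \<in> S y. f y)" by blast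
  show ?thesis
  proof (intro exI allI)
    fix b
    have "(\<Sum>y | y \<in> X \<and> b \<in> S y. f y) \<in> ?F" by (rule rangeI)
    from Max_ge[OF fin this] show "(\<Sum>y | y \<in> X \<and> b \<in> S y. f y) \<le> (\<Sum>y | y \<in> X \<and> a \<in> S y. f y)"
      unfolding \<open>Max ?F = _\<close> .
  qed
qed

context brick_host
begin

lemma nice_length: "ys \<in> nice \<Longrightarrow> length ys = 4 * l"
  by (simp add: nice_def words_def)

lemma nice_words: "ys \<in> nice \<Longrightarrow> ys \<in> words V (4 * l)"
  by (simp add: nice_def)

text \<open>Rotate the edge of the layer \<open>r'\<close> that contains position \<open>j\<close>
  to the front. The layer \<open>r\<close> is read from the remaining entries alone, so
  \<open>nice_front_fixed\<close> applies.\<close>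

lemma layer_position_weight:
  assumes j: "j < 2 * l" and r: "r \<le> 2" "r' \<le> 2" "even r" "even r'" "r \<noteq> r'"
  shows "(\<Sum>xs | xs \<in> nice \<and> layer l r' xs ! j = A (layer l r xs). loop_prob xs) \<le> 2 * \<theta> ^ 4"
proof -
  define i where "i = 4 * (j div 2) + r'"
  \<comment> \<open>\<open>undefined\<close> fills two positions that \<open>layer l r\<close>
    skips.\<close>
  define g where "g R = A (layer l r (rotate (4 * l - i) (undefined # undefined # R)))" for R
  let ?P = "\<lambda>ys. ys \<in> nice \<and> ys ! (j mod 2) = g (drop 2 ys)"
  have "{xs. xs \<in> nice \<and> layer l r' xs ! j = A (layer l r xs)} = {xs \<in> words V (4 * l). ?P (rotate i xs)}"
  proof (intro Collect_cong)
    fix xs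
    have "layer l r' xs ! j = rotate i xs ! (j mod 2)" "A (layer l r xs) = g (drop 2 (rotate i xs))"
      if "xs \<in> nice"
    proof -
      have lt: "i + j mod 2 < 4 * l" using layer_index[OF j r(2)] by (simp add: i_def)
      have len: "length xs = 4 * l" by (rule nice_length[OF that])
      have "j mod 2 < length xs" using len lt by linarith
      from nth_rotate[OF this, of i] have "rotate i xs ! (j mod 2) = xs ! (i + j mod 2)"
        using lt by (simp only: len add.commute mod_less)
      also have "\<dots> = layer l r' xs ! j" unfolding nth_layer[OF j] i_def ..
      finally show "layer l r' xs ! j = rotate i xs ! (j mod 2)" ..
      show "A (layer l r xs) = g (drop 2 (rotate i xs))"
        unfolding g_def i_def layer_patch[OF len j r] ..
    qed
    then show "(xs \<in> nice \<and> layer l r' xs ! j = A (layer l r xs)) = (xs \<in> words V (4 * l) \<and> ?P (rotate i xs))"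
      unfolding nice_rotate using nice_words by metis
  qed
  then have "(\<Sum>xs | xs \<in> nice \<and> layer l r' xs ! j = A (layer l r xs). loop_prob xs)
      = (\<Sum>xs | xs \<in> words V (4 * l) \<and> ?P (rotate i xs). loop_prob xs)" by (rule arg_cong)
  also have "\<dots> = (\<Sum>xs | xs \<in> words V (4 * l) \<and> ?P xs. loop_prob xs)"
    by (rule sum_loop_prob_rotate[of "4 * l" ?P])
  also have "\<dots> \<le> 2 * \<theta> ^ 4"
    by (rule nice_front_fixed) simp
  finally show ?thesis .
qed

lemma layer_hit_weight:
  assumes r: "r \<le> 2" "r' \<le> 2" "even r" "even r'" "r \<noteq> r'"
  shows "(\<Sum>xs\<in>nice. if A (layer l r xs) \<in> set (layer l r' xs) then loop_prob xs else 0) \<le> 4 * real l * \<theta> ^ 4"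
proof -
  have "(\<Sum>xs\<in>nice. if A (layer l r xs) \<in> set (layer l r' xs) then loop_prob xs else 0)
      = (\<Sum>xs | xs \<in> nice \<and> (\<exists>j\<in>{..<2 * l}. layer l r' xs ! j = A (layer l r xs)). loop_prob xs)"
    unfolding sum.inter_filter[OF fin_nice] by (intro sum.cong refl) (auto simp: in_set_conv_nth)
  also have "\<dots> \<le> (\<Sum>j<2 * l. \<Sum>xs | xs \<in> nice \<and> layer l r' xs ! j = A (layer l r xs). loop_prob xs)"
    by (rule sum_exists_le) (simp_all add: fin_nice loop_prob_nonneg)
  also have "\<dots> \<le> (\<Sum>j<2 * l. 2 * \<theta> ^ 4)"
    by (rule sum_mono, rule layer_position_weight) (simp_all add: r)
  finally show ?thesis by simp
qed

definition off :: "bool \<Rightarrow> nat" where "off c = (if c then 0 else 2)"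

lemma off_simps [simp]: "off c \<le> 2" "even (off c)" "off True = 0" "off False = 2"
  by (auto simp: off_def)

text \<open>The tag of a state is the parity of the position of the layer in the cyclic order.\<close>

definition states :: "(bool \<times> 'a list) set" where
  "states = UNIV \<times> words V (2 * l)"

text \<open>Only opposite tags are joined, and the tag decides which half of the cycle is read.
  Walks therefore alternate between the offsets 0 and 2, as the asymmetry of even and odd layers in
  \<open>brick_E\<close> demands.\<close>

definition layer_prob :: "bool \<times> 'a list \<Rightarrow> bool \<times> 'a list \<Rightarrow> real" where
  "layer_prob x y = (if fst x = fst y then 0 else
     (\<Sum>xs\<in>nice. if layer l (off (fst x)) xs = snd x \<and> layer l (off (fst y)) xs = snd y then loop_prob xs else 0))"

lemma layer_prob_sym: "layer_prob x y = layer_prob y x"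
  by (auto simp: layer_prob_def conj_commute)

lemma layer_prob_nonneg: "layer_prob x y \<ge> 0"
  by (simp add: layer_prob_def sum_nonneg loop_prob_nonneg)

lemma layer_prob_pos:
  assumes "layer_prob x y > 0"
  obtains ys where "ys \<in> nice" "fst x \<noteq> fst y" "layer l (off (fst x)) ys = snd x" "layer l (off (fst y)) ys = snd y"
proof -
  have ne: "fst x \<noteq> fst y"
  proof
    assume "fst x = fst y"
    then have "layer_prob x y = 0" by (simp add: layer_prob_def)
    with assms show False by simp
  qed
  have "\<exists>ys\<in>nice. layer l (off (fst x)) ys = snd x \<and> layer l (off (fst y)) ys = snd y"
  proof (rule ccontr)
    assume "\<not> ?thesis"
    then have "(\<Sum>xs\<in>nice. if layer l (off (fst x)) xs = snd x \<and> layer l (off (fst y)) xs = snd y then loop_prob xs else 0) = 0"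
      by (intro sum.neutral) auto
    then have "layer_prob x y = 0" by (simp only: layer_prob_def ne if_False)
    with assms show False by simp
  qed
  with ne that show thesis by blast
qed

lemma fin_states: "finite states"
  by (simp add: states_def finV)

text \<open>Every nice cycle is counted twice, once for each tag of the first state.\<close>

lemma sum_states_layer_prob:
  "(\<Sum>x\<in>states. \<Sum>y\<in>states. G x y * layer_prob x y)
     = (\<Sum>b\<in>UNIV. \<Sum>xs\<in>nice. G (b, layer l (off b) xs) (\<not> b, layer l (off (\<not> b)) xs) * loop_prob xs)"
proof -
  let ?W = "words V (2 * l)"
  have split: "(\<Sum>x\<in>states. H x) = (\<Sum>b\<in>UNIV. \<Sum>v\<in>?W. H (b, v))" for H :: "_ \<Rightarrow> real"
    by (simp add: states_def sum.cartesian_product case_prod_unfold)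
  have inner: "(\<Sum>y\<in>states. G (b, v) y * layer_prob (b, v) y)
      = (\<Sum>v'\<in>?W. \<Sum>xs\<in>nice. if layer l (off b) xs = v \<and> layer l (off (\<not> b)) xs = v'
            then G (b, v) (\<not> b, v') * loop_prob xs else 0)" for b v
  proof -
    have "(\<Sum>y\<in>states. G (b, v) y * layer_prob (b, v) y) = (\<Sum>b'\<in>UNIV. \<Sum>v'\<in>?W. G (b, v) (b', v') * layer_prob (b, v) (b', v'))"
      by (rule split)
    also have "\<dots> = (\<Sum>v'\<in>?W. G (b, v) (\<not> b, v') * layer_prob (b, v) (\<not> b, v'))"
      by (cases b) (simp_all add: UNIV_bool layer_prob_def)
    finally show ?thesis
      by (simp add: layer_prob_def sum_distrib_left if_distrib cong: if_cong)
  qed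
  have "(\<Sum>x\<in>states. \<Sum>y\<in>states. G x y * layer_prob x y) = (\<Sum>b\<in>UNIV. \<Sum>v\<in>?W. \<Sum>y\<in>states. G (b, v) y * layer_prob (b, v) y)"
    by (rule split)
  also have "\<dots> = (\<Sum>b\<in>UNIV. \<Sum>v\<in>?W. \<Sum>v'\<in>?W. \<Sum>xs\<in>nice.
        if layer l (off b) xs = v \<and> layer l (off (\<not> b)) xs = v' then G (b, v) (\<not> b, v') * loop_prob xs else 0)"
    by (simp only: inner)
  also have "\<dots> = (\<Sum>b\<in>UNIV. \<Sum>xs\<in>nice. G (b, layer l (off b) xs) (\<not> b, layer l (off (\<not> b)) xs) * loop_prob xs)"
    by (intro sum.cong refl sum_fibres[where G = "\<lambda>v v' xs. G (_, v) (\<not> _, v') * loop_prob xs"])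
       (auto simp: finV nice_def off_def intro!: layer_in_words)
  finally show ?thesis .
qed

text \<open>The vertex \<open>A x\<close> may depend on the whole layer; this is why the earlier
  bounds prescribe a vertex as a function of the other layer.\<close>

lemma hit_weight:
  "(\<Sum>x\<in>states. \<Sum>y | y \<in> states \<and> A x \<in> set (snd y). layer_prob x y) \<le> 8 * real l * \<theta> ^ 4"
proof -
  have "(\<Sum>x\<in>states. \<Sum>y | y \<in> states \<and> A x \<in> set (snd y). layer_prob x y)
      = (\<Sum>x\<in>states. \<Sum>y\<in>states. of_bool (A x \<in> set (snd y)) * layer_prob x y)"
  proof (rule sum.cong[OF refl])
    fix x
    show "(\<Sum>y | y \<in> states \<and> A x \<in> set (snd y). layer_prob x y) = (\<Sum>y\<in>states. of_bool (A x \<in> set (snd y)) * layer_prob x y)"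
      unfolding sum.inter_filter[OF fin_states] by (intro sum.cong refl) simp
  qed
  also have "\<dots> = (\<Sum>b\<in>UNIV. \<Sum>xs\<in>nice. of_bool (A (b, layer l (off b) xs) \<in> set (layer l (off (\<not> b)) xs)) * loop_prob xs)"
    unfolding sum_states_layer_prob snd_conv ..
  also have "\<dots> = (\<Sum>b\<in>UNIV. \<Sum>xs\<in>nice. if A (b, layer l (off b) xs) \<in> set (layer l (off (\<not> b)) xs) then loop_prob xs else 0)"
    by (intro sum.cong refl) simp
  also have "\<dots> \<le> (\<Sum>b\<in>(UNIV :: bool set). 4 * real l * \<theta> ^ 4)"
  proof (rule sum_mono)
    fix c :: bool
    show "(\<Sum>xs\<in>nice. if A (c, layer l (off c) xs) \<in> set (layer l (off (\<not> c)) xs) then loop_prob xs else 0) \<le> 4 * real l * \<theta> ^ 4"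
      by (rule layer_hit_weight[of _ _ "\<lambda>v. A (c, v)"]) (simp_all add: off_def)
  qed
  also have "\<dots> = 8 * real l * \<theta> ^ 4" by (simp add: UNIV_bool)
  finally show ?thesis .
qed

text \<open>This exponent is the origin of the half-length \<open>2 * l * l + 1\<close> of the
  torus: with it, \<open>B = 1 / \<theta>\<close> is admissible for the walk on layers.\<close>

lemma card_states: "real (card states) \<le> (1 / \<theta>) ^ Suc (2 * l * l)" if "\<theta> \<le> 1 / 2"
proof -
  have "card (words V (2 * l)) = card V ^ (2 * l)"
    unfolding words_def by (rule card_lists_length_eq[OF finV])
  then have "card states = 2 * card V ^ (2 * l)"
    by (simp add: states_def card_cartesian_product)
  then have "real (card states) = 2 * real (card V) ^ (2 * l)" by simp
  also have "\<dots> \<le> (1 / \<theta>) * ((1 / \<theta>) ^ l) ^ (2 * l)"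
  proof (intro mult_mono power_mono size)
    show "2 \<le> 1 / \<theta>" using \<theta> that by (simp add: le_divide_eq)
  qed (use \<theta> in auto)
  also have "\<dots> = (1 / \<theta>) ^ Suc (2 * l * l)"
    unfolding power_mult[symmetric] power_Suc by (simp only: mult_ac)
  finally show ?thesis .
qed

text \<open>The cost of a state is the largest weight of its neighbours through one vertex, attained
  at \<open>A x\<close>. The costs add up to at most \<open>8 * l * \<theta> ^ 4\<close> against a
  total weight of at least 1, which allows the spread \<theta>^2. With \<open>2 * l\<close> vertices
  per layer and \<open>B = 1 / \<theta>\<close>, the conflict parameter becomes
  \<open>2 * l * \<theta>\<close>.\<close>

lemma disjoint_layers:
  assumes small: "(2 * (2 * real l * real l + 1))\<^sup>2 * sqrt (2 * real l * \<theta>) < 1"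
  obtains xs where "set xs \<subseteq> states" "length xs = 2 * (2 * l * l + 1)"
    "\<And>i. i < length xs \<Longrightarrow> layer_prob (xs ! i) (xs ! (Suc i mod length xs)) > 0"
    "\<And>i i'. i < length xs \<Longrightarrow> i' < length xs \<Longrightarrow> i \<noteq> i' \<Longrightarrow> set (snd (xs ! i)) \<inter> set (snd (xs ! i')) = {}"
proof -
  let ?S = "\<lambda>x. set (snd x)"
  have "\<forall>x. \<exists>a. \<forall>b. (\<Sum>y | y \<in> states \<and> b \<in> ?S y. layer_prob x y) \<le> (\<Sum>y | y \<in> states \<and> a \<in> ?S y. layer_prob x y)"
    by (intro allI ex_max_subset_sum fin_states)
  from choice[OF this] obtain A where
    A: "\<And>x b. (\<Sum>y | y \<in> states \<and> b \<in> ?S y. layer_prob x y) \<le> (\<Sum>y | y \<in> states \<and> A x \<in> ?S y. layer_prob x y)"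
    by blast
  note c = hit_weight[of A]
  have "(\<Sum>x\<in>states. \<Sum>y\<in>states. layer_prob x y) = (\<Sum>b\<in>(UNIV :: bool set). \<Sum>xs\<in>nice. loop_prob xs)"
    using sum_states_layer_prob[of "\<lambda>_ _. 1"] by simp
  then have tot: "(\<Sum>x\<in>states. \<Sum>y\<in>states. layer_prob x y) \<ge> 1"
    using nice_weight by (simp add: UNIV_bool)
  have \<theta>2: "\<theta> \<le> 1 / 2"
  proof -
    have "4 \<le> (real l)\<^sup>2" using l power_mono[of 2 "real l" 2] by simp
    then have "40 * 4 * \<theta> \<le> 40 * (real l)\<^sup>2 * \<theta>" using \<theta> by (intro mult_right_mono) auto
    then show ?thesis using \<theta>l \<theta> by linarith
  qed
  have "real l * 1 \<le> real l * real l" using l by (intro mult_left_mono) auto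
  then have "16 * real l * \<theta> \<le> 40 * (real l)\<^sup>2 * \<theta>"
    using \<theta> by (intro mult_right_mono) (auto simp: power2_eq_square)
  then have "16 * real l * \<theta> \<le> 1" using \<theta>l by linarith
  then have "16 * real l * \<theta> * \<theta> \<le> 1 * (1 / 2)"
    using \<theta>2 \<theta> by (intro mult_mono) auto
  then have "16 * real l * \<theta> * \<theta> < 1" by simp
  then have "\<theta>\<^sup>2 * (16 * real l * \<theta> * \<theta>) < \<theta>\<^sup>2 * 1"
    using \<theta> by (intro mult_strict_left_mono) auto
  also have "\<dots> \<le> \<theta>\<^sup>2 * (\<Sum>x\<in>states. \<Sum>y\<in>states. layer_prob x y)"
    using tot by (intro mult_left_mono) auto
  finally have lt: "\<theta>\<^sup>2 * (16 * real l * \<theta> * \<theta>) < \<theta>\<^sup>2 * (\<Sum>x\<in>states. \<Sum>y\<in>states. layer_prob x y)" .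
  have "\<theta>\<^sup>2 * (16 * real l * \<theta> * \<theta>) = 2 * (8 * real l * \<theta> ^ 4)"
    by (simp add: power2_eq_square power4_eq_xxxx mult_ac)
  then have total: "2 * (\<Sum>x\<in>states. \<Sum>y | y \<in> states \<and> A x \<in> ?S y. layer_prob x y)
      < \<theta>\<^sup>2 * (\<Sum>x\<in>states. \<Sum>y\<in>states. layer_prob x y)"
    using c lt by linarith
  note cs = card_states[OF \<theta>2]
  have "real (2 * l) * \<theta>\<^sup>2 * (1 / \<theta>) = 2 * real l * \<theta>"
    using \<theta> by (simp add: power2_eq_square)
  then have sm: "(2 * real (Suc (2 * l * l)))\<^sup>2 * sqrt (real (2 * l) * \<theta>\<^sup>2 * (1 / \<theta>)) < 1"
  proof -
    have "real (Suc (2 * l * l)) = 2 * real l * real l + 1" by simp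
    then show ?thesis using small \<open>_ = 2 * real l * \<theta>\<close> by (simp only:)
  qed
  have \<theta>sq: "\<theta>\<^sup>2 > 0" and inv: "1 / \<theta> \<ge> 0" using \<theta> by auto
  have cardS: "card (?S x) \<le> 2 * l" if "x \<in> states" for x
    using that card_length[of "snd x"] by (auto simp: states_def words_def)
  show thesis
  proof (rule disjoint_closed_walk[OF fin_states layer_prob_sym layer_prob_nonneg \<theta>sq A total _ cardS inv cs sm])
    fix xs assume "set xs \<subseteq> states" and len: "length xs = 2 * Suc (2 * l * l)"
      and step: "\<And>i. i < 2 * Suc (2 * l * l) \<Longrightarrow> layer_prob (xs ! i) (xs ! (Suc i mod (2 * Suc (2 * l * l)))) > 0"
      and dis: "\<And>i i'. i < 2 * Suc (2 * l * l) \<Longrightarrow> i' < 2 * Suc (2 * l * l) \<Longrightarrow> i \<noteq> i' \<Longrightarrow> ?S (xs ! i) \<inter> ?S (xs ! i') = {}"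
    then show thesis
      by (intro that[of xs]) (simp_all only: len Suc_eq_plus1)
  qed (rule finite_set)
qed

section \<open>Reading an embedding of the torus off a walk on layers\<close>

lemma nice_edge: "ys \<in> nice \<Longrightarrow> p < 4 * l \<Longrightarrow> (ys ! p, ys ! (Suc p mod (4 * l))) \<in> E"
  using loop_prob_pos_edge[of ys p] by (auto simp: nice_def words_def split: if_splits)

lemma nth_layer_pair:
  assumes "i < l"
  shows "layer l r ys ! (2 * i) = ys ! (4 * i + r)" "layer l r ys ! Suc (2 * i) = ys ! Suc (4 * i + r)"
  using nth_layer[of "2 * i" l r ys] nth_layer[of "Suc (2 * i)" l r ys] assms by simp_all

lemma in_layer_edge:
  assumes "ys \<in> nice" "i < l" "r \<le> 2"
  shows "(layer l r ys ! (2 * i), layer l r ys ! Suc (2 * i)) \<in> E"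
proof -
  have "Suc (4 * i + r) < 4 * l" using assms by presburger
  then show ?thesis using nice_edge[OF assms(1), of "4 * i + r"] by (simp add: nth_layer_pair[OF assms(2)])
qed

lemma cross_layer_edge:
  assumes ys: "ys \<in> nice" and j: "j < 2 * l"
  shows "(layer l 0 ys ! j, layer l 2 ys ! ((j + 2 * l - 1) mod (2 * l))) \<in> E"
proof (cases "even j")
  case False
  then obtain i where i: "j = Suc (2 * i)" by (auto elim: oddE)
  then have il: "i < l" using j by simp
  have "(j + 2 * l - 1) mod (2 * l) = 2 * i" using i il by simp
  moreover have "Suc (4 * i) < 4 * l" "Suc (Suc (4 * i)) < 4 * l" using il by presburger+
  ultimately show ?thesis
    using nice_edge[OF ys, of "Suc (4 * i)"] by (simp add: i nth_layer_pair[OF il])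
next
  case True
  then obtain i where i: "j = 2 * i" by (auto elim: evenE)
  then have il: "i < l" using j by simp
  \<comment> \<open>The vertex before position 4i is the last one of the preceding block of four;
    for \<open>i = 0\<close> this is block \<open>l - 1\<close>.\<close>
  have "\<exists>i'<l. (j + 2 * l - 1) mod (2 * l) = Suc (2 * i') \<and> Suc (Suc (4 * i' + 2)) mod (4 * l) = 4 * i \<and> Suc (4 * i' + 2) < 4 * l"
  proof (cases i)
    case 0
    have q: "j + 2 * l - 1 = Suc (2 * (l - 1))" using l i 0 by simp
    have "Suc (Suc (4 * (l - 1) + 2)) = 4 * l" using l by simp
    moreover have "Suc (2 * (l - 1)) < 2 * l" using l by simp
    ultimately show ?thesis using l 0 unfolding q by (intro exI[of _ "l - 1"]) simp
  next
    case (Suc i')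
    have "j + 2 * l - 1 = Suc (2 * i') + 2 * l" using i Suc by simp
    then have "(j + 2 * l - 1) mod (2 * l) = (Suc (2 * i') + 2 * l) mod (2 * l)" by (rule arg_cong)
    also have "\<dots> = Suc (2 * i')" unfolding mod_add_self2 using il Suc by simp
    finally have "(j + 2 * l - 1) mod (2 * l) = Suc (2 * i')" .
    moreover have "Suc (Suc (4 * i' + 2)) = 4 * i" "4 * i < 4 * l" "Suc (4 * i' + 2) < 4 * l" "i' < l"
      using Suc il by simp_all
    ultimately show ?thesis by (metis mod_less)
  qed
  then obtain i' where i': "i' < l" "(j + 2 * l - 1) mod (2 * l) = Suc (2 * i')"
      "Suc (Suc (4 * i' + 2)) mod (4 * l) = 4 * i" "Suc (4 * i' + 2) < 4 * l" by blast
  have "(ys ! Suc (4 * i' + 2), ys ! (4 * i)) \<in> E"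
    using nice_edge[OF ys i'(4)] unfolding i'(3) .
  then have "(ys ! (4 * i), ys ! Suc (4 * i' + 2)) \<in> E" by (rule E_sym)
  moreover have "layer l 0 ys ! j = ys ! (4 * i)" by (simp add: i nth_layer_pair[OF il])
  ultimately show ?thesis unfolding i'(2) nth_layer_pair(2)[OF i'(1)] by simp
qed

lemma brick_embeds:
  assumes small: "(2 * (2 * real l * real l + 1))\<^sup>2 * sqrt (2 * real l * \<theta>) < 1"
  shows "embeds l (2 * l * l + 1) E"
proof -
  define k where "k = 2 * l * l + 1"
  define n where "n = 2 * k"
  have n0: "n > 0" "even n" by (simp_all add: n_def k_def)
  obtain xs where sub: "set xs \<subseteq> states" and len: "length xs = n"
    and step: "\<And>i. i < n \<Longrightarrow> layer_prob (xs ! i) (xs ! (Suc i mod n)) > 0"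
    and dis: "\<And>i i'. i < n \<Longrightarrow> i' < n \<Longrightarrow> i \<noteq> i' \<Longrightarrow> set (snd (xs ! i)) \<inter> set (snd (xs ! i')) = {}"
    using disjoint_layers[OF small] unfolding n_def k_def by metis
  \<comment> \<open>A shift by at most one makes the tags agree with the parity of the layer number,
    so that even layers have offset 0.\<close>
  define s :: nat where "s = (if fst (xs ! 0) then 0 else 1)"
  define u where "u t = xs ! ((t + s) mod n)" for t
  have u_step: "layer_prob (u t) (u (Suc t)) > 0" for t
  proof -
    have "Suc ((t + s) mod n) mod n = (Suc t + s) mod n" by (simp add: mod_Suc_eq)
    then show ?thesis using step[of "(t + s) mod n"] n0 unfolding u_def by simp
  qed
  have alt: "fst (u (Suc t)) = (\<not> fst (u t))" for t
    by (rule layer_prob_pos[OF u_step[of t]]) blast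
  have "fst (u 0)"
  proof (cases "fst (xs ! 0)")
    case True then show ?thesis by (simp add: u_def s_def)
  next
    case False
    have "fst (xs ! 0) \<noteq> fst (xs ! (Suc 0 mod n))"
      by (rule layer_prob_pos[OF step[OF n0(1)]]) blast
    then show ?thesis using False by (simp add: u_def s_def)
  qed
  then have tag: "fst (u t) = even t" for t
    by (induction t) (simp_all add: alt)
  have link: "\<exists>ys\<in>nice. layer l (off (even t)) ys = snd (u t) \<and> layer l (off (odd t)) ys = snd (u (Suc t))" for t
    by (rule layer_prob_pos[OF u_step[of t]]) (auto simp: tag)
  have u_mod: "u (t mod n) = u t" for t
    by (simp only: u_def mod_add_left_eq)
  have u_props: "u t \<in> states" "length (snd (u t)) = 2 * l" "distinct (snd (u t))" for t
  proof -
    show "u t \<in> states" unfolding u_def by (rule subsetD[OF sub], rule nth_mem) (simp add: len n0)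
    obtain ys where ys: "ys \<in> nice" "layer l (off (even t)) ys = snd (u t)" using link by blast
    have "distinct ys" using ys(1) by (simp add: nice_def)
    from distinct_layer[OF this nice_length[OF ys(1)], of "off (even t)"]
    show "distinct (snd (u t))" unfolding ys(2) by simp
    show "length (snd (u t)) = 2 * l" unfolding ys(2)[symmetric] by simp
  qed
  define f where "f p = snd (u (fst p)) ! snd p" for p
  have shift_inj: "t = t'" if "(t + s) mod n = (t' + s) mod n" "t < n" "t' < n" for t t'
    using that by (cases "fst (xs ! 0)") (auto simp: s_def mod_Suc split: if_splits)
  have inj: "inj_on f (brick_V l k)"
  proof (rule inj_onI)
    fix p p' assume p: "p \<in> brick_V l k" "p' \<in> brick_V l k" "f p = f p'"
    obtain t j t' j' where pt: "p = (t, j)" "p' = (t', j')" by (cases p; cases p')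
    have t: "t < n" "t' < n" "j < 2 * l" "j' < 2 * l" using p pt by (auto simp: brick_V_def n_def)
    have "f p \<in> set (snd (u t))" "f p' \<in> set (snd (u t'))"
      unfolding f_def pt using t u_props by simp_all
    then have "set (snd (xs ! ((t + s) mod n))) \<inter> set (snd (xs ! ((t' + s) mod n))) \<noteq> {}"
      using p(3) unfolding u_def by auto
    then have "(t + s) mod n = (t' + s) mod n"
      using dis[of "(t + s) mod n" "(t' + s) mod n"] n0 by fastforce
    then have tt: "t = t'" using shift_inj t by blast
    then have "j = j'" using p(3) t u_props[of t] unfolding f_def pt by (simp add: nth_eq_iff_index_eq)
    with tt pt show "p = p'" by simp
  qed
  have img: "f ` brick_V l k \<subseteq> V"
  proof
    fix a assume "a \<in> f ` brick_V l k"
    then obtain t j where a: "a = snd (u t) ! j" "j < 2 * l" by (auto simp: brick_V_def f_def)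
    have "set (snd (u t)) \<subseteq> V" using u_props(1)[of t] by (auto simp: states_def words_def)
    moreover have "a \<in> set (snd (u t))" using a u_props(2)[of t] by simp
    ultimately show "a \<in> V" by blast
  qed
  have edges: "\<exists>x y. f ` e = {x, y} \<and> (x, y) \<in> E" if e: "e \<in> brick_E l k" for e
  proof -
    consider (inner) t i where "e = {(t, 2 * i), (t, Suc (2 * i))}" "i < l"
      | (cross) t t' j where "e = {(t, j), (t', (j + 2 * l - 1) mod (2 * l))}" "even t" "j < 2 * l"
          "t' = Suc t mod n \<or> t' = (t + n - 1) mod n"
      using e unfolding brick_E_def n_def by blast
    then show ?thesis
    proof cases
      case inner
      obtain ys where ys: "ys \<in> nice" "layer l (off (even t)) ys = snd (u t)" using link by blast
      have "(snd (u t) ! (2 * i), snd (u t) ! Suc (2 * i)) \<in> E"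
        using in_layer_edge[OF ys(1) inner(2) off_simps(1)[of "even t"]] unfolding ys(2) .
      moreover have "f ` e = {snd (u t) ! (2 * i), snd (u t) ! Suc (2 * i)}" by (simp add: inner(1) f_def)
      ultimately show ?thesis by blast
    next
      case cross
      have "\<exists>ys\<in>nice. layer l 0 ys = snd (u t) \<and> layer l 2 ys = snd (u t')"
        using cross(4)
      proof
        assume "t' = Suc t mod n"
        then have "u t' = u (Suc t)" by (simp only: u_mod)
        then show ?thesis using link[of t] cross(2) by simp
      next
        assume "t' = (t + n - 1) mod n"
        then have ut': "u t' = u (t + n - 1)" by (simp only: u_mod)
        \<comment> \<open>The link is taken from the odd layer before \<open>t\<close>. Writing it
          as \<open>t + n - 1\<close> avoids truncation at \<open>t = 0\<close>.\<close>
        have S: "Suc (t + n - 1) = t + n" and o: "odd (t + n - 1)" using cross(2) n0 by auto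
        have "u (t + n) = u t" using u_mod[of "t + n"] u_mod[of t] by (simp only: mod_add_self2)
        then show ?thesis using link[of "t + n - 1"] o unfolding ut' S by auto
      qed
      then obtain ys where ys: "ys \<in> nice" "layer l 0 ys = snd (u t)" "layer l 2 ys = snd (u t')" by blast
      have "(snd (u t) ! j, snd (u t') ! ((j + 2 * l - 1) mod (2 * l))) \<in> E"
        using cross_layer_edge[OF ys(1) cross(3)] unfolding ys .
      moreover have "f ` e = {snd (u t) ! j, snd (u t') ! ((j + 2 * l - 1) mod (2 * l))}"
        by (simp add: cross(1) f_def)
      ultimately show ?thesis by blast
    qed
  qed
  show ?thesis unfolding embeds_def k_def[symmetric] using inj img edges by blast
qed

end

section \<open>Almost regular hosts\<close>

lemma embeds_mono: "embeds l k E \<Longrightarrow> E \<subseteq> F \<Longrightarrow> embeds l k F"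
  unfolding embeds_def by (meson Domain_mono subset_iff order_trans)

lemma card_restrict_remove:
  fixes E :: "('a \<times> 'a) set"
  assumes "finite E" "sym E"
  shows "card (E \<inter> S \<times> S) \<le> card (E \<inter> (S - {v}) \<times> (S - {v})) + 2 * card ((E \<inter> S \<times> S) `` {v})"
proof -
  let ?N = "(E \<inter> S \<times> S) `` {v}"
  have fN: "finite ?N"
    by (rule finite_subset[of _ "Range E"]) (auto simp: assms finite_Range)
  have "E \<inter> S \<times> S \<subseteq> E \<inter> (S - {v}) \<times> (S - {v}) \<union> (Pair v ` ?N \<union> (\<lambda>x. (x, v)) ` ?N)"
    using assms(2) by (auto simp: sym_def image_iff)
  then have "card (E \<inter> S \<times> S) \<le> card (E \<inter> (S - {v}) \<times> (S - {v}) \<union> (Pair v ` ?N \<union> (\<lambda>x. (x, v)) ` ?N))"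
    using assms fN by (intro card_mono) auto
  also have "\<dots> \<le> card (E \<inter> (S - {v}) \<times> (S - {v})) + (card (Pair v ` ?N) + card ((\<lambda>x. (x, v)) ` ?N))"
    by (intro order_trans[OF card_Un_le] add_left_mono card_Un_le)
  also have "\<dots> \<le> card (E \<inter> (S - {v}) \<times> (S - {v})) + (card ?N + card ?N)"
    using fN by (intro add_mono card_image_le order_refl)
  finally show ?thesis by simp
qed

text \<open>\<open>S\<close> maximises the number of ordered pairs minus twice the sum of
  \<open>a\<close>: removing \<open>v\<close> loses at most two pairs for each neighbour and saves
  \<open>2 * a v\<close>.\<close>

lemma min_degree_subgraph:
  fixes E :: "('a \<times> 'a) set" and a :: "'a \<Rightarrow> real"
  assumes E: "finite E" "sym E" and V: "finite V" "E \<subseteq> V \<times> V"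
    and a: "\<And>v. v \<in> V \<Longrightarrow> a v \<ge> 0" and sum: "2 * (\<Sum>v\<in>V. a v) < card E"
  obtains S where "S \<subseteq> V" "E \<inter> S \<times> S \<noteq> {}" "\<And>v. v \<in> S \<Longrightarrow> a v \<le> deg (E \<inter> S \<times> S) v"
proof -
  define f where "f S = real (card (E \<inter> S \<times> S)) - 2 * (\<Sum>v\<in>S. a v)" for S
  define M where "M = Max (f ` Pow V)"
  have M: "f S \<le> M" if "S \<subseteq> V" for S
    unfolding M_def using that V by (intro Max_ge) auto
  have "M \<in> f ` Pow V" unfolding M_def using V by (intro Max_in) auto
  then obtain S where S: "S \<subseteq> V" "f S = M" by auto
  have finS: "finite S" using S V finite_subset by blast
  show thesis
  proof (rule that[OF S(1)])
    have "E \<inter> V \<times> V = E" using V by blast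
    then have "0 < f V" using sum by (simp add: f_def)
    then have "0 < f S" using M[of V] S by simp
    moreover have "(\<Sum>v\<in>S. a v) \<ge> 0" using a S by (intro sum_nonneg) auto
    ultimately show "E \<inter> S \<times> S \<noteq> {}" by (auto simp: f_def)
    fix v assume v: "v \<in> S"
    have "f (S - {v}) \<le> f S" using M[of "S - {v}"] S by auto
    moreover have "(\<Sum>v\<in>S. a v) = a v + (\<Sum>v\<in>S - {v}. a v)" using v finS by (simp add: sum.remove)
    moreover have "real (card (E \<inter> S \<times> S)) \<le> real (card (E \<inter> (S - {v}) \<times> (S - {v}))) + 2 * real (deg (E \<inter> S \<times> S) v)"
      using card_restrict_remove[OF E, of S v] unfolding deg_def by linarith
    ultimately show "a v \<le> deg (E \<inter> S \<times> S) v" unfolding f_def by linarith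
  qed
qed

text \<open>The second inequality is the smallness hypothesis of \<open>disjoint_closed_walk\<close>
  for closed walks of length \<open>2 * (2 * l * l + 1)\<close> with conflict parameter
  \<open>2 * l * \<theta>\<close>.\<close>

lemma theta_threshold:
  fixes l :: nat
  assumes "l \<ge> 2"
  obtains \<theta>0 where "\<theta>0 > 0" "\<And>\<theta>. 0 < \<theta> \<Longrightarrow> \<theta> \<le> \<theta>0 \<Longrightarrow>
    40 * (real l)\<^sup>2 * \<theta> \<le> 1 \<and> (2 * (2 * real l * real l + 1))\<^sup>2 * sqrt (2 * real l * \<theta>) < 1"
proof -
  define K where "K = (2 * (2 * real l * real l + 1))\<^sup>2"
  have K: "K > 0" unfolding K_def by (intro zero_less_power mult_pos_pos add_nonneg_pos) auto
  have l0: "real l > 0" using assms by simp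
  define \<theta>0 where "\<theta>0 = min (1 / (40 * (real l)\<^sup>2)) (1 / (8 * real l * K\<^sup>2))"
  show thesis
  proof (rule that[of \<theta>0])
    show "\<theta>0 > 0" using K l0 by (simp add: \<theta>0_def)
    fix \<theta> :: real assume \<theta>: "0 < \<theta>" "\<theta> \<le> \<theta>0"
    have "\<theta> \<le> 1 / (40 * (real l)\<^sup>2)" "\<theta> \<le> 1 / (8 * real l * K\<^sup>2)" using \<theta> by (simp_all add: \<theta>0_def)
    then have 1: "40 * (real l)\<^sup>2 * \<theta> \<le> 1" and 2: "8 * real l * K\<^sup>2 * \<theta> \<le> 1"
      using l0 K by (simp_all add: field_simps)
    have "2 * real l * \<theta> \<le> (1 / (2 * K))\<^sup>2"
      using 2 K by (simp add: field_simps power2_eq_square)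
    then have "sqrt (2 * real l * \<theta>) \<le> 1 / (2 * K)"
      using K by (intro real_le_lsqrt) auto
    then have "K * sqrt (2 * real l * \<theta>) \<le> K * (1 / (2 * K))"
      using K by (intro mult_left_mono) auto
    also have "\<dots> < 1" using K by simp
    finally show "40 * (real l)\<^sup>2 * \<theta> \<le> 1 \<and> (2 * (2 * real l * real l + 1))\<^sup>2 * sqrt (2 * real l * \<theta>) < 1"
      using 1 by (simp add: K_def)
  qed
qed

lemma brick_host_embeds:
  fixes a b t \<theta> :: real
  assumes "finite F" "sym F" "F \<noteq> {}" "F \<subseteq> A \<times> B \<union> B \<times> A" "A \<inter> B = {}"
    and "0 < \<theta>" "l \<ge> 2" "40 * (real l)\<^sup>2 * \<theta> \<le> 1" "real (card (Domain F)) \<le> (1 / \<theta>) ^ l"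
    and "\<And>x y. (x, y) \<in> F \<Longrightarrow> real (card {z \<in> F `` {y}. z = x \<or> real (codeg F x z) > t}) \<le> \<theta> ^ 4 * deg F y"
    and "a > 0" "b > 0" "t \<ge> 0"
    and "\<And>x. x \<in> A \<inter> Domain F \<Longrightarrow> a \<le> deg F x" "\<And>x. x \<in> B \<inter> Domain F \<Longrightarrow> b \<le> deg F x"
    and "t * card (B \<inter> Domain F) \<le> \<theta> ^ 4 * a\<^sup>2 * b" "t * card (A \<inter> Domain F) \<le> \<theta> ^ 4 * a * b\<^sup>2"
    and small: "(2 * (2 * real l * real l + 1))\<^sup>2 * sqrt (2 * real l * \<theta>) < 1"
  shows "embeds l (2 * l * l + 1) F"
proof -
  interpret brick_host F A B \<theta> a b t l
    using assms by unfold_locales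
  show ?thesis by (rule brick_embeds[OF small])
qed

text \<open>The exponents \<open>512\<close> and \<open>768\<close> are only chosen large enough to absorb all numerical constants and all
  small powers of \<open>1 / \<theta>\<close>. In the application \<open>m\<close> is the number of vertices and \<open>\<theta>\<close> is defined from it.\<close>

locale regular_host =
  fixes E :: "('a \<times> 'a) set" and P Q :: "'a set" and \<theta> D m :: real and r :: nat
  assumes finE: "finite E" and symE: "sym E"
    and bip: "E \<subseteq> P \<times> Q \<union> Q \<times> P" "P \<inter> Q = {}"
    and r: "r \<ge> 1" and \<theta>: "0 < \<theta>" "\<theta> \<le> 1 / 2"
    and \<theta>1: "40 * (real (512 * r\<^sup>2))\<^sup>2 * \<theta> \<le> 1"
    and \<theta>2: "(2 * (2 * real (512 * r\<^sup>2) * real (512 * r\<^sup>2) + 1))\<^sup>2 * sqrt (2 * real (512 * r\<^sup>2) * \<theta>) < 1"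
    and m: "m = (1 / \<theta>) ^ (512 * r\<^sup>2)"
    and size: "real (card (Domain E)) \<le> m"
    and D: "D > 0" "D ^ 3 \<ge> m * (1 / \<theta>) ^ (768 * r)"
    and edges: "real (card E) \<ge> D * m / 2"
    and maxdeg: "\<And>x. real (deg E x) \<le> D * (1 / \<theta>) ^ 3"
begin

abbreviation "\<kappa> \<equiv> \<theta> ^ 4"
abbreviation "V \<equiv> Domain E"
text \<open>In terms of \<open>m\<close> this is m^(1/r), which is below the surplus of at least
  m^(3/(2r)) that \<open>D ^ 3\<close> has over \<open>m\<close>.\<close>

abbreviation "T \<equiv> (1 / \<theta>) ^ (512 * r)"

lemma E_sym: "(x, y) \<in> E \<Longrightarrow> (y, x) \<in> E"
  using symE by (auto dest: symD)

lemma finV: "finite V"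
  by (simp add: finE finite_Domain)

lemma E_V: "(x, y) \<in> E \<Longrightarrow> x \<in> V \<and> y \<in> V"
  using E_sym by blast

lemma E_VV: "E \<subseteq> V \<times> V"
  using E_V by auto

lemma finN: "finite (E `` {x})"
  by (rule finite_subset[OF _ finV]) (auto dest: E_V)

lemma m_pos: "m > 0"
  using \<theta> by (simp add: m)

lemma inv_theta: "1 / \<theta> \<ge> 2"
  using \<theta> by (simp add: le_divide_eq)

lemma T_ge: "T \<ge> 1"
  using inv_theta by (intro one_le_power) auto

lemma codeg_mono: "F \<subseteq> E \<Longrightarrow> codeg F x y \<le> codeg E x y"
  unfolding codeg_def by (intro card_mono finite_Int) (auto simp: finN)

lemma embeds_subgraph:
  fixes a b t :: real
  assumes "F \<subseteq> E" "sym F" "F \<noteq> {}" "F \<subseteq> A \<times> B \<union> B \<times> A" "A \<inter> B = {}"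
    and "\<And>x y. (x, y) \<in> F \<Longrightarrow> real (card {z \<in> F `` {y}. z = x \<or> real (codeg F x z) > t}) \<le> \<kappa> * deg F y"
    and "a > 0" "b > 0" "t \<ge> 0"
    and "\<And>x. x \<in> A \<inter> Domain F \<Longrightarrow> a \<le> deg F x" "\<And>x. x \<in> B \<inter> Domain F \<Longrightarrow> b \<le> deg F x"
    and "t * card (B \<inter> Domain F) \<le> \<kappa> * a\<^sup>2 * b" "t * card (A \<inter> Domain F) \<le> \<kappa> * a * b\<^sup>2"
  shows "embeds (512 * r\<^sup>2) (2 * (512 * r\<^sup>2) * (512 * r\<^sup>2) + 1) E"
proof -
  have "card (Domain F) \<le> card V" using finV assms(1) by (intro card_mono Domain_mono)
  then have "real (card (Domain F)) \<le> (1 / \<theta>) ^ (512 * r\<^sup>2)" using size m by linarith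
  moreover have "2 \<le> 512 * r\<^sup>2" using r one_le_power[of r 2] by linarith
  ultimately have "embeds (512 * r\<^sup>2) (2 * (512 * r\<^sup>2) * (512 * r\<^sup>2) + 1) F"
    using assms \<theta> \<theta>1 \<theta>2 finite_subset[OF assms(1) finE]
    by (intro brick_host_embeds[where A = A and B = B and a = a and b = b and t = t])
  then show ?thesis using embeds_mono assms(1) by blast
qed

text \<open>After cleaning, degrees are at least \<open>D / 16\<close>. The threshold is half of
  \<kappa> times that, leaving room for the extra bad vertex \<open>z = x\<close>.\<close>

definition heavy :: "'a \<Rightarrow> 'a \<Rightarrow> bool" where
  "heavy x y \<longleftrightarrow> real (card {z \<in> E `` {y}. z \<noteq> x \<and> real (codeg E x z) > T}) \<ge> \<kappa> * D / 32"

lemma theta_cancel: "\<theta> ^ n * (1 / \<theta>) ^ (n + k) = (1 / \<theta>) ^ k"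
proof -
  have "\<theta> ^ n * (1 / \<theta>) ^ n = 1" using \<theta> by (simp add: power_mult_distrib[symmetric])
  then show ?thesis by (simp only: power_add mult.assoc[symmetric] mult_1_left)
qed

lemma inv_theta_power: "k \<le> n \<Longrightarrow> (1 / \<theta>) ^ k \<le> (1 / \<theta>) ^ n"
  using inv_theta by (intro power_increasing) auto

lemma two_power_le: "2 ^ n \<le> (1 / \<theta>) ^ n"
  using inv_theta by (intro power_mono) auto

lemma m_ge_1: "m \<ge> 1"
  unfolding m using inv_theta by (intro one_le_power) linarith

lemma D_large: "\<kappa> * D \<ge> 1024"
proof (rule power_le_imp_le_base[of _ 2])
  have "(1024 :: real) ^ Suc 2 = 2 ^ 30" by simp
  also have "\<dots> \<le> (1 / \<theta>) ^ 30" by (rule two_power_le)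
  also have "\<dots> = \<theta> ^ 12 * (1 / \<theta>) ^ (12 + 30)" by (rule theta_cancel[symmetric])
  also have "\<dots> \<le> \<theta> ^ 12 * (m * (1 / \<theta>) ^ (768 * r))"
  proof (rule mult_left_mono)
    have "1 * (1 / \<theta>) ^ (12 + 30) \<le> m * (1 / \<theta>) ^ (768 * r)"
      using r \<theta> m_ge_1 by (intro mult_mono inv_theta_power) auto
    then show "(1 / \<theta>) ^ (12 + 30) \<le> m * (1 / \<theta>) ^ (768 * r)" by simp
  qed (use \<theta> in simp)
  also have "\<dots> \<le> \<theta> ^ 12 * D ^ 3" using D \<theta> by (intro mult_left_mono) auto
  also have "\<dots> = (\<kappa> * D) ^ Suc 2" by (simp add: power_mult_distrib power_mult[symmetric] eval_nat_numeral)
  finally show "(1024 :: real) ^ Suc 2 \<le> (\<kappa> * D) ^ Suc 2" .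
  show "0 \<le> \<kappa> * D" using \<theta> D by simp
qed

text \<open>These are the conditions \<open>TP\<close> and \<open>TQ\<close> for
  \<open>a = b = D / 16\<close>, with both sides bounded by \<open>m\<close>.\<close>

lemma T_m_le: "T * m \<le> \<kappa> * (D / 16) ^ 3"
proof -
  have "4096 * (T * m) \<le> (1 / \<theta>) ^ 12 * (T * m)"
    using two_power_le[of 12] T_ge m_pos by (intro mult_right_mono) auto
  also have "\<dots> = \<kappa> * (1 / \<theta>) ^ (4 + 12) * (T * m)" by (simp only: theta_cancel)
  also have "\<dots> = \<kappa> * (m * (1 / \<theta>) ^ (4 + 12 + 512 * r))" by (simp only: power_add mult_ac)
  also have "\<dots> \<le> \<kappa> * (m * (1 / \<theta>) ^ (768 * r))"
    using r \<theta> m_pos by (intro mult_left_mono inv_theta_power) auto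
  also have "\<dots> \<le> \<kappa> * D ^ 3" using D \<theta> by (intro mult_left_mono) auto
  also have "\<dots> = 4096 * (\<kappa> * (D / 16) ^ 3)" by (simp add: power_divide)
  finally show ?thesis by simp
qed

text \<open>Deleting the heavy pairs in both orders leaves \<open>D * m / 4\<close> pairs. Passing
  to a subgraph only lowers codegrees, while the minimum degree \<open>D / 16\<close> keeps the
  allowance for bad vertices above the threshold in \<open>heavy\<close>.\<close>

lemma embeds_if_few_heavy:
  assumes few: "real (card {(x, y) \<in> E. heavy x y}) \<le> D * m / 8"
  shows "embeds (512 * r\<^sup>2) (2 * (512 * r\<^sup>2) * (512 * r\<^sup>2) + 1) E"
proof -
  define H where "H = {(x, y) \<in> E. heavy x y}"
  define F where "F = E - H - H\<inverse>"
  have finH: "finite H" by (rule finite_subset[OF _ finE]) (auto simp: H_def)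
  have finF: "finite F" and F_sub: "F \<subseteq> E" using finE by (auto simp: F_def)
  have symF: "sym F" using symE by (auto simp: F_def sym_def)
  have "card E \<le> card (F \<union> (H \<union> H\<inverse>))"
    using finF finH by (intro card_mono) (auto simp: F_def)
  also have "\<dots> \<le> card F + (card H + card (H\<inverse>))"
    by (intro order_trans[OF card_Un_le] add_left_mono card_Un_le)
  finally have "real (card E) \<le> real (card F) + 2 * real (card H)" by (simp add: card_inverse)
  then have cF: "real (card F) \<ge> D * m / 4" using few edges by (simp add: H_def)
  have "2 * (\<Sum>v\<in>V. D / 16) \<le> D * m / 8"
    using size D by (simp add: mult.commute[of D] mult_right_mono)
  also have "\<dots> < D * m / 4" using D m_pos by simp
  finally have "2 * (\<Sum>v\<in>V. D / 16) < real (card F)" using cF by linarith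
  moreover have "F \<subseteq> V \<times> V" using F_sub E_VV by blast
  moreover have "0 \<le> D / 16" using D by simp
  ultimately obtain S where S: "S \<subseteq> V" "F \<inter> S \<times> S \<noteq> {}"
    and md: "\<And>v. v \<in> S \<Longrightarrow> D / 16 \<le> deg (F \<inter> S \<times> S) v"
    using min_degree_subgraph[OF finF symF finV, of "\<lambda>_. D / 16"] by blast
  define L where "L = F \<inter> S \<times> S"
  have L_sub: "L \<subseteq> E" using F_sub by (auto simp: L_def)
  have degL: "D / 16 \<le> deg L x" if "x \<in> Domain L" for x
    using md[of x] that by (auto simp: L_def)
  have D3: "T * card (X \<inter> Domain L) \<le> \<kappa> * (D / 16) ^ 3" for X
  proof -
    have "card (X \<inter> Domain L) \<le> card V" using finV L_sub by (intro card_mono) auto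
    then have "T * card (X \<inter> Domain L) \<le> T * m" using size T_ge by (intro mult_left_mono) linarith+
    also have "\<dots> \<le> \<kappa> * (D / 16) ^ 3" by (rule T_m_le)
    finally show ?thesis .
  qed
  show ?thesis
  proof (rule embeds_subgraph[of L P Q T "D / 16" "D / 16"])
    show "sym L" using symF by (auto simp: L_def sym_def)
    show "L \<noteq> {}" using S by (simp add: L_def)
    show "L \<subseteq> P \<times> Q \<union> Q \<times> P" using L_sub bip by blast
    fix x y assume xy: "(x, y) \<in> L"
    have "\<not> heavy x y" using xy L_sub by (auto simp: L_def F_def H_def)
    let ?Z = "{z \<in> E `` {y}. z \<noteq> x \<and> real (codeg E x z) > T}"
    have finZ: "finite ?Z" by (rule finite_subset[OF _ finN[of y]]) auto
    have "{z \<in> L `` {y}. z = x \<or> real (codeg L x z) > T} \<subseteq> insert x ?Z"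
    proof
      fix z assume z: "z \<in> {z \<in> L `` {y}. z = x \<or> real (codeg L x z) > T}"
      have "codeg L x z \<le> codeg E x z" by (rule codeg_mono[OF L_sub])
      then show "z \<in> insert x ?Z" using z L_sub by auto
    qed
    then have "card {z \<in> L `` {y}. z = x \<or> real (codeg L x z) > T} \<le> card (insert x ?Z)"
      using finZ by (intro card_mono) auto
    also have "\<dots> \<le> Suc (card ?Z)" by (rule card_insert_le_m1) auto
    finally have "real (card {z \<in> L `` {y}. z = x \<or> real (codeg L x z) > T}) \<le> 1 + \<kappa> * D / 32"
      using \<open>\<not> heavy x y\<close> unfolding heavy_def by linarith
    also have "\<dots> \<le> \<kappa> * (D / 16)" using D_large by linarith
    also have "\<dots> \<le> \<kappa> * deg L y"
    proof (intro mult_left_mono degL)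
      show "y \<in> Domain L" using xy symF by (auto simp: L_def sym_def)
    qed (use \<theta> in simp)
    finally show "real (card {z \<in> L `` {y}. z = x \<or> real (codeg L x z) > T}) \<le> \<kappa> * deg L y" .
  qed (use L_sub bip D T_ge degL D3 in \<open>auto simp: power2_eq_square power3_eq_cube mult.assoc\<close>)
qed

end

text \<open>Choose \<open>s\<close> maximising \<open>X s * \<rho> ^ s\<close>; every other term is
  then dominated by a geometric one, and the tail from \<open>k\<close> on is a geometric
  series.\<close>

lemma class_selection:
  fixes X :: "nat \<Rightarrow> real"
  assumes X: "\<And>s. X s \<ge> 0" and \<rho>: "\<rho> > 1" and n: "n \<ge> 1"
  obtains s where "s < n" "\<And>k. (\<Sum>j\<in>{k..<n}. X j) * \<rho> ^ k \<le> X s * \<rho> ^ s * (\<rho> / (\<rho> - 1))"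
proof -
  have "finite ((\<lambda>j. X j * \<rho> ^ j) ` {..<n})" "(\<lambda>j. X j * \<rho> ^ j) ` {..<n} \<noteq> {}"
    using n by (auto simp: lessThan_empty_iff)
  then have "Max ((\<lambda>j. X j * \<rho> ^ j) ` {..<n}) \<in> (\<lambda>j. X j * \<rho> ^ j) ` {..<n}" by (rule Max_in)
  then obtain s where s: "s < n" "Max ((\<lambda>j. X j * \<rho> ^ j) ` {..<n}) = X s * \<rho> ^ s" by auto
  have max: "X j * \<rho> ^ j \<le> X s * \<rho> ^ s" if "j < n" for j
    using that unfolding s(2)[symmetric] by (intro Max_ge) auto
  \<comment> \<open>The term subtracted on the right makes the bound exact, so that it can be proved
    by induction.\<close>
  have geo: "(\<Sum>j\<in>{k..<n'}. (1 / \<rho>) ^ j) * \<rho> ^ k \<le> \<rho> / (\<rho> - 1) * (1 - \<rho> ^ k / \<rho> ^ n')" if "k \<le> n'" for k n'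
    using that
  proof (induction n' rule: dec_induct)
    case base
    then show ?case by simp
  next
    case (step n')
    have "(\<Sum>j\<in>{k..<Suc n'}. (1 / \<rho>) ^ j) * \<rho> ^ k = (\<Sum>j\<in>{k..<n'}. (1 / \<rho>) ^ j) * \<rho> ^ k + \<rho> ^ k / \<rho> ^ n'"
      using step by (simp add: algebra_simps power_divide)
    moreover have "\<rho> / (\<rho> - 1) * (1 - \<rho> ^ k / \<rho> ^ Suc n') = \<rho> / (\<rho> - 1) * (1 - \<rho> ^ k / \<rho> ^ n') + \<rho> ^ k / \<rho> ^ n'"
      using \<rho> by (simp add: divide_simps) (simp add: algebra_simps)
    ultimately show ?case using step.IH by linarith
  qed
  show thesis
  proof (rule that[OF s(1)])
    fix k
    show "(\<Sum>j\<in>{k..<n}. X j) * \<rho> ^ k \<le> X s * \<rho> ^ s * (\<rho> / (\<rho> - 1))"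
    proof (cases "k \<le> n")
      case False
      then show ?thesis using X[of s] \<rho> by simp
    next
      case True
      have "(\<Sum>j\<in>{k..<n}. X j) \<le> (\<Sum>j\<in>{k..<n}. X s * \<rho> ^ s * (1 / \<rho>) ^ j)"
      proof (rule sum_mono)
        fix j assume "j \<in> {k..<n}"
        then show "X j \<le> X s * \<rho> ^ s * (1 / \<rho>) ^ j"
          using max[of j] \<rho> by (simp add: power_divide field_simps)
      qed
      also have "\<dots> = X s * \<rho> ^ s * (\<Sum>j\<in>{k..<n}. (1 / \<rho>) ^ j)" by (simp add: sum_distrib_left)
      finally have "(\<Sum>j\<in>{k..<n}. X j) * \<rho> ^ k \<le> X s * \<rho> ^ s * (\<Sum>j\<in>{k..<n}. (1 / \<rho>) ^ j) * \<rho> ^ k"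
        using \<rho> by (intro mult_right_mono) auto
      also have "\<dots> = X s * \<rho> ^ s * ((\<Sum>j\<in>{k..<n}. (1 / \<rho>) ^ j) * \<rho> ^ k)" by (simp only: mult.assoc)
      also have "\<dots> \<le> X s * \<rho> ^ s * (\<rho> / (\<rho> - 1))"
      proof (intro mult_left_mono order_trans[OF geo[OF True]])
        have "\<rho> / (\<rho> - 1) * (1 - \<rho> ^ k / \<rho> ^ n) \<le> \<rho> / (\<rho> - 1) * 1"
          using \<rho> by (intro mult_left_mono) auto
        then show "\<rho> / (\<rho> - 1) * (1 - \<rho> ^ k / \<rho> ^ n) \<le> \<rho> / (\<rho> - 1)" by simp
        show "0 \<le> X s * \<rho> ^ s" using X[of s] \<rho> by simp
      qed
      finally show ?thesis .
    qed
  qed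
qed

lemma one_plus_inverse_power:
  fixes N :: nat
  assumes "N \<ge> 1"
  shows "2 \<le> (1 + 1 / real N) ^ N" "(1 + 1 / real N) ^ N \<le> 4"
proof -
  have "1 + real N * (1 / real N) \<le> (1 + 1 / real N) ^ N"
    using assms by (intro Bernoulli_inequality) (auto intro: order_trans[of _ 0])
  then show "2 \<le> (1 + 1 / real N) ^ N" using assms by simp
  have "(1 + 1 / real N) ^ N \<le> exp (1 / real N) ^ N"
    by (intro power_mono exp_ge_add_one_self) auto
  also have "\<dots> = exp 1" using assms by (simp add: exp_of_nat_mult[symmetric])
  also have "\<dots> \<le> 4" using exp_le by linarith
  finally show "(1 + 1 / real N) ^ N \<le> 4" .
qed

section \<open>Moments of the codegrees and the choice of a dyadic class\<close>

context regular_host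
begin

definition pairs :: "('a \<times> 'a) set" where
  "pairs = {(x, z) \<in> V \<times> V. x \<noteq> z}"

definition codeg_pair :: "'a \<times> 'a \<Rightarrow> nat" where
  "codeg_pair p = codeg E (fst p) (snd p)"

definition dyadic :: "nat \<Rightarrow> ('a \<times> 'a) set" where
  "dyadic k = {p \<in> pairs. 2 ^ k \<le> codeg_pair p \<and> codeg_pair p < 2 ^ Suc k}"

definition large :: "nat \<Rightarrow> ('a \<times> 'a) set" where
  "large k = {p \<in> pairs. 2 ^ k \<le> codeg_pair p}"

abbreviation moment :: "('a \<times> 'a) set \<Rightarrow> real" where
  "moment Z \<equiv> \<Sum>p\<in>Z. (real (codeg_pair p))\<^sup>2"

lemma fin_pairs: "finite pairs"
  by (rule finite_subset[of _ "V \<times> V"]) (auto simp: pairs_def finV)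

lemma fin_large: "finite (large k)" and fin_dyadic: "finite (dyadic k)"
  by (auto intro: finite_subset[OF _ fin_pairs] simp: large_def dyadic_def)

lemma codeg_le_deg: "codeg E x y \<le> deg E x"
  unfolding codeg_def deg_def by (intro card_mono finN) auto

lemma deg_le: "deg E x \<le> card V"
  unfolding deg_def by (intro card_mono finV) (auto dest: E_V)

lemma codeg_pair_le: "codeg_pair p \<le> card V"
  unfolding codeg_pair_def using codeg_le_deg deg_le le_trans by blast

lemma moment_large:
  assumes "card V < 2 ^ n"
  shows "moment (large k) = (\<Sum>j\<in>{k..<n}. moment (dyadic j))"
proof (cases "k \<le> n")
  case False
  have "(2 :: nat) ^ n \<le> 2 ^ k" using False by (intro power_increasing) auto
  then have "\<not> 2 ^ k \<le> codeg_pair p" for p using codeg_pair_le[of p] assms by linarith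
  then have "large k = {}" by (simp add: large_def)
  then show ?thesis using False by simp
next
  case True
  then show ?thesis
  proof (induction k rule: inc_induct)
    case base
    have "large n = {}" using codeg_pair_le assms by (auto simp: large_def not_le dest: less_le_trans le_less_trans)
    then show ?case by simp
  next
    case (step k)
    have "large k = dyadic k \<union> large (Suc k)"
    proof -
      have "2 ^ k \<le> n'" if "2 ^ Suc k \<le> n'" for n' :: nat using that by simp
      then show ?thesis by (auto simp: large_def dyadic_def simp del: power_Suc)
    qed
    moreover have "dyadic k \<inter> large (Suc k) = {}" by (auto simp: large_def dyadic_def)
    ultimately have "moment (large k) = moment (dyadic k) + moment (large (Suc k))"
      by (simp add: sum.union_disjoint fin_large fin_dyadic)
    then show ?case using step by (simp add: sum.atLeast_Suc_lessThan)
  qed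
qed

text \<open>Triples of a heavy edge (x, y) and a witness z are counted twice over. There are at
  least \<open>D * m / 8\<close> times \<open>\<kappa> * D / 32\<close> of them, and the pair (x, z)
  lies in at most codegree many; one more factor \<open>T\<close> is gained because this codegree
  exceeds \<open>T\<close>.\<close>

lemma heavy_moment:
  assumes many: "real (card {(x, y) \<in> E. heavy x y}) \<ge> D * m / 8"
  shows "T * (\<kappa> * D\<^sup>2 * m / 256) \<le> moment (large 0)"
proof -
  define H where "H = {(x, y) \<in> E. heavy x y}"
  define Z where "Z e = {z \<in> E `` {snd e}. z \<noteq> fst e \<and> real (codeg E (fst e) z) > T}" for e
  define B where "B = {p \<in> pairs. real (codeg_pair p) > T}"
  have finH: "finite H" by (rule finite_subset[OF _ finE]) (auto simp: H_def)
  have finZ: "finite (Z e)" for e by (rule finite_subset[OF _ finN]) (auto simp: Z_def)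
  have finB: "finite B" by (rule finite_subset[OF _ fin_pairs]) (auto simp: B_def)
  have "D * m / 8 * (\<kappa> * D / 32) \<le> real (card H) * (\<kappa> * D / 32)"
    using many D \<theta> by (intro mult_right_mono) (auto simp: H_def)
  also have "\<dots> = (\<Sum>e\<in>H. \<kappa> * D / 32)" by simp
  also have "\<dots> \<le> (\<Sum>e\<in>H. real (card (Z e)))"
    by (rule sum_mono) (auto simp: H_def Z_def heavy_def)
  also have "\<dots> = real (card (SIGMA e:H. Z e))" using finH finZ by simp
  also have "\<dots> \<le> real (card (SIGMA p:B. E `` {fst p} \<inter> E `` {snd p}))"
  proof -
    let ?f = "\<lambda>(e, z). ((fst e, z), snd e)"
    have "inj_on ?f (SIGMA e:H. Z e)" by (auto simp: inj_on_def)
    moreover have "?f ` (SIGMA e:H. Z e) \<subseteq> (SIGMA p:B. E `` {fst p} \<inter> E `` {snd p})"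
    proof (intro image_subsetI)
      fix ez assume ez: "ez \<in> (SIGMA e:H. Z e)"
      obtain x y z where [simp]: "ez = ((x, y), z)" by (metis surj_pair)
      have xyz: "(x, y) \<in> E" "(y, z) \<in> E" "z \<noteq> x" "real (codeg E x z) > T"
        using ez by (auto simp: H_def Z_def)
      have "(x, z) \<in> B" using xyz E_V by (auto simp: B_def pairs_def codeg_pair_def)
      moreover have "(z, y) \<in> E" by (rule E_sym[OF xyz(2)])
      ultimately show "?f ez \<in> (SIGMA p:B. E `` {fst p} \<inter> E `` {snd p})" using xyz by simp
    qed
    moreover have "finite (SIGMA p:B. E `` {fst p} \<inter> E `` {snd p})"
      using finB finN by (intro finite_SigmaI) auto
    ultimately show ?thesis by (simp only: of_nat_le_iff card_inj_on_le)
  qed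
  also have "\<dots> = (\<Sum>p\<in>B. real (codeg_pair p))"
    using finB finN by (simp add: codeg_pair_def codeg_def)
  finally have "T * (D * m / 8 * (\<kappa> * D / 32)) \<le> T * (\<Sum>p\<in>B. real (codeg_pair p))"
    using T_ge by (intro mult_left_mono) auto
  also have "\<dots> = (\<Sum>p\<in>B. T * real (codeg_pair p))" by (rule sum_distrib_left)
  also have "\<dots> \<le> moment B"
    unfolding power2_eq_square by (intro sum_mono mult_right_mono) (auto simp: B_def)
  also have "\<dots> \<le> moment (large 0)"
    using T_ge by (intro sum_mono2 fin_large) (auto simp: B_def large_def)
  finally show ?thesis by (simp add: power2_eq_square mult_ac)
qed

lemma inv_theta_large: "8388608 * real r ^ 4 \<le> 1 / \<theta>"
proof -
  have "8388608 * real r ^ 4 * \<theta> \<le> 40 * (real (512 * r\<^sup>2))\<^sup>2 * \<theta>"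
    using \<theta> by (intro mult_right_mono) (auto simp: power_mult_distrib power_mult[symmetric])
  then have "8388608 * real r ^ 4 * \<theta> \<le> 1" using \<theta>1 by linarith
  then show ?thesis using \<theta> by (simp add: field_simps)
qed

text \<open>The ratio \<open>\<rho> = 1 + 1 / (8r)\<close> is so close to \<open>1\<close> that the weight \<open>\<rho>\<^sup>s\<close> costs only a small power of \<open>m\<close>,
  but beyond the gap \<open>g\<close> it still gains a fixed power of \<open>1 / \<theta>\<close>.\<close>

lemma select_class:
  assumes many: "real (card {(x, y) \<in> E. heavy x y}) \<ge> D * m / 8"
  obtains s g where "moment (dyadic s) > 0" "g \<ge> 1" "2 ^ g \<le> (1 / \<theta>) ^ (64 * r)"
    "\<kappa> * D\<^sup>2 * m * (1 / \<theta>) ^ (384 * r) / 256 \<le> (8 * real r + 1) * moment (dyadic s)"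
    "moment (large (s + g)) \<le> 2 * (8 * real r + 1) * \<theta> ^ 8 * moment (dyadic s)"
proof -
  define N where "N = 8 * r"
  define \<rho> where "\<rho> = 1 + 1 / real N"
  have N: "N \<ge> 1" using r by (simp add: N_def)
  have \<rho>: "\<rho> > 1" using N by (simp add: \<rho>_def)
  have \<rho>N: "2 \<le> \<rho> ^ N" "\<rho> ^ N \<le> 4" unfolding \<rho>_def by (rule one_plus_inverse_power[OF N])+
  have C: "\<rho> / (\<rho> - 1) = 8 * real r + 1" using N by (simp add: \<rho>_def N_def field_simps)
  obtain n where n: "card V < 2 ^ n" using less_exp by blast
  have n1: "n \<ge> 1"
  proof (rule ccontr)
    assume "\<not> n \<ge> 1"
    then have "n = 0" by simp
    then have "V = {}" using n finV by simp
    then have "E = {}" by auto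
    then show False using edges mult_pos_pos[OF D(1) m_pos] by simp
  qed
  obtain s where s: "s < n"
    "\<And>k. (\<Sum>j\<in>{k..<n}. moment (dyadic j)) * \<rho> ^ k \<le> moment (dyadic s) * \<rho> ^ s * (\<rho> / (\<rho> - 1))"
    using class_selection[of "\<lambda>j. moment (dyadic j)", OF _ \<rho> n1] by (metis (no_types, lifting) sum_nonneg zero_le_power2)
  have sel: "moment (large k) * \<rho> ^ k \<le> moment (dyadic s) * \<rho> ^ s * (8 * real r + 1)" for k
    using s(2)[of k] moment_large[OF n, of k] C by simp
  have pos0: "0 < T * (\<kappa> * D\<^sup>2 * m / 256)" using T_ge \<theta> D m_pos by (intro mult_pos_pos) auto
  have low: "T * (\<kappa> * D\<^sup>2 * m / 256) \<le> moment (dyadic s) * \<rho> ^ s * (8 * real r + 1)"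
    using sel[of 0] heavy_moment[OF many] by simp
  have pos: "moment (dyadic s) > 0"
  proof (rule ccontr)
    assume "\<not> moment (dyadic s) > 0"
    moreover have "moment (dyadic s) \<ge> 0" by (intro sum_nonneg) simp
    ultimately have "moment (dyadic s) = 0" by linarith
    then show False using low pos0 by simp
  qed
  \<comment> \<open>Codegrees are at most \<open>m\<close>, so \<open>2 ^ s \<le> m\<close>. Since
    \<open>\<rho> ^ N \<le> 4\<close>, the \<open>N\<close>-th power of \<open>\<rho> ^ s\<close> is
    at most \<open>4 ^ s \<le> m\<^sup>2\<close>.\<close>
  have "\<rho> ^ s \<le> (1 / \<theta>) ^ (128 * r)"
  proof (rule power_le_imp_le_base[of _ "N - 1"])
    have "dyadic s \<noteq> {}" using pos by auto
    then obtain p where "p \<in> dyadic s" by blast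
    then have "2 ^ s \<le> card V" using codeg_pair_le[of p] by (auto simp: dyadic_def)
    then have "real (2 ^ s) \<le> real (card V)" by (rule of_nat_mono)
    moreover have "real (2 ^ s) = 2 ^ s" by (simp only: of_nat_power of_nat_numeral)
    ultimately have 2: "2 ^ s \<le> m" using size by linarith
    have "(\<rho> ^ s) ^ N = (\<rho> ^ N) ^ s" by (simp only: power_mult[symmetric] mult.commute)
    also have "\<dots> \<le> 4 ^ s" using \<rho>N by (intro power_mono) auto
    also have "\<dots> = (2 ^ s)\<^sup>2" by (simp add: power_mult[symmetric] power2_eq_square power_mult_distrib[symmetric])
    also have "\<dots> \<le> m\<^sup>2" using 2 by (intro power_mono) auto
    also have "\<dots> = ((1 / \<theta>) ^ (128 * r)) ^ N"
      unfolding m N_def power_mult[symmetric] by (simp add: power2_eq_square ac_simps)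
    finally show "(\<rho> ^ s) ^ Suc (N - 1) \<le> ((1 / \<theta>) ^ (128 * r)) ^ Suc (N - 1)" using N by simp
  qed (use \<theta> in simp)
  then have "moment (dyadic s) * \<rho> ^ s * (8 * real r + 1) \<le> moment (dyadic s) * (1 / \<theta>) ^ (128 * r) * (8 * real r + 1)"
    using pos by (intro mult_right_mono mult_left_mono) auto
  then have "T * (\<kappa> * D\<^sup>2 * m / 256) \<le> (1 / \<theta>) ^ (128 * r) * ((8 * real r + 1) * moment (dyadic s))"
    using low by (simp only: mult_ac)
  moreover have "T = (1 / \<theta>) ^ (128 * r) * (1 / \<theta>) ^ (384 * r)" by (simp only: power_add[symmetric]) simp
  ultimately have "(1 / \<theta>) ^ (128 * r) * ((1 / \<theta>) ^ (384 * r) * (\<kappa> * D\<^sup>2 * m / 256))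
     \<le> (1 / \<theta>) ^ (128 * r) * ((8 * real r + 1) * moment (dyadic s))" by (simp only: mult.assoc)
  then have mom: "(1 / \<theta>) ^ (384 * r) * (\<kappa> * D\<^sup>2 * m / 256) \<le> (8 * real r + 1) * moment (dyadic s)"
    using \<theta> by (subst (asm) mult_le_cancel_left_pos) auto
  \<comment> \<open>This \<open>g\<close> is an auxiliary exponent; the gap of the class is
    \<open>N * g\<close>. Because \<open>\<rho> ^ N\<close> is at least 2, crossing the gap gains at
    least half of \<open>(1 / \<theta>) ^ 8\<close>.\<close>
  obtain g where g: "2 ^ g \<le> (1 / \<theta>) ^ 8" "(1 / \<theta>) ^ 8 < 2 ^ Suc g"
  proof -
    define S where "S = {g. (2::real) ^ g \<le> (1 / \<theta>) ^ 8}"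
    obtain K where K: "(1 / \<theta>) ^ 8 < 2 ^ K" using real_arch_pow[of 2 "(1 / \<theta>) ^ 8"] by auto
    have "S \<subseteq> {..<K}"
    proof
      fix g assume "g \<in> S"
      then have "(2::real) ^ g \<le> (1 / \<theta>) ^ 8" unfolding S_def by blast
      then have "(2::real) ^ g < 2 ^ K" using K by (rule le_less_trans)
      then show "g \<in> {..<K}" by simp
    qed
    then have fS: "finite S" using finite_subset by blast
    have "(1::real) \<le> (1 / \<theta>) ^ 8" using inv_theta by (intro one_le_power) linarith
    then have "0 \<in> S" unfolding S_def by simp
    then have "Max S \<in> S" using fS by (intro Max_in) auto
    moreover have "Suc (Max S) \<notin> S" using Max_ge[OF fS, of "Suc (Max S)"] by auto
    ultimately have "2 ^ Max S \<le> (1 / \<theta>) ^ 8" "\<not> 2 ^ Suc (Max S) \<le> (1 / \<theta>) ^ 8"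
      unfolding S_def by blast+
    then show ?thesis using that[of "Max S"] by (meson not_le)
  qed
  have "g \<ge> 1"
  proof (rule ccontr)
    assume "\<not> g \<ge> 1"
    then have "g = 0" by simp
    then have "(1 / \<theta>) ^ 8 < 2" using g(2) by simp
    moreover have "256 \<le> (1 / \<theta>) ^ 8" using two_power_le[of 8] by simp
    ultimately show False by linarith
  qed
  have \<rho>g: "(1 / \<theta>) ^ 8 \<le> 2 * \<rho> ^ (N * g)"
  proof -
    have "(1 / \<theta>) ^ 8 \<le> 2 * 2 ^ g" using less_imp_le[OF g(2)] unfolding power_Suc .
    also have "\<dots> \<le> 2 * (\<rho> ^ N) ^ g" using \<rho>N by (intro mult_left_mono power_mono) auto
    finally show ?thesis by (simp add: power_mult)
  qed
  show thesis
  proof (rule that[of s "N * g"])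
    show "moment (dyadic s) > 0" by (rule pos)
    show "1 \<le> N * g" using N \<open>g \<ge> 1\<close> by simp
    have "(2 :: real) ^ (N * g) = (2 ^ g) ^ N" by (simp add: power_mult[symmetric] mult.commute)
    also have "\<dots> \<le> ((1 / \<theta>) ^ 8) ^ N" using g by (intro power_mono) auto
    also have "\<dots> = (1 / \<theta>) ^ (64 * r)" unfolding power_mult[symmetric] N_def by simp
    finally show "(2 :: real) ^ (N * g) \<le> (1 / \<theta>) ^ (64 * r)" .
    show "\<kappa> * D\<^sup>2 * m * (1 / \<theta>) ^ (384 * r) / 256 \<le> (8 * real r + 1) * moment (dyadic s)"
      using mom by (simp add: mult_ac)
    have "moment (large (s + N * g)) * \<rho> ^ (N * g) * \<rho> ^ s \<le> moment (dyadic s) * (8 * real r + 1) * \<rho> ^ s"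
      using sel[of "s + N * g"] by (simp add: power_add mult_ac)
    then have 1: "moment (large (s + N * g)) * \<rho> ^ (N * g) \<le> moment (dyadic s) * (8 * real r + 1)"
      using \<rho> by (subst (asm) mult_le_cancel_right_pos) auto
    have "moment (large (s + N * g)) * (1 / \<theta>) ^ 8 \<le> moment (large (s + N * g)) * (2 * \<rho> ^ (N * g))"
      using \<rho>g by (intro mult_left_mono sum_nonneg) auto
    also have "\<dots> \<le> 2 * (moment (dyadic s) * (8 * real r + 1))" using 1 by simp
    finally have "\<theta> ^ 8 * (moment (large (s + N * g)) * (1 / \<theta>) ^ 8) \<le> \<theta> ^ 8 * (2 * (moment (dyadic s) * (8 * real r + 1)))"
      using \<theta> by (intro mult_left_mono) auto
    moreover have "\<theta> ^ 8 * (1 / \<theta>) ^ 8 = 1" using theta_cancel[of 8 0] by simp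
    then have "\<theta> ^ 8 * (moment (large (s + N * g)) * (1 / \<theta>) ^ 8) = moment (large (s + N * g))"
      by (simp only: mult.left_commute[of "\<theta> ^ 8"] mult_1_right)
    ultimately have "moment (large (s + N * g)) \<le> \<theta> ^ 8 * (2 * (moment (dyadic s) * (8 * real r + 1)))"
      by linarith
    also have "\<dots> = 2 * (8 * real r + 1) * \<theta> ^ 8 * moment (dyadic s)" by (simp only: mult_ac)
    finally show "moment (large (s + N * g)) \<le> 2 * (8 * real r + 1) * \<theta> ^ 8 * moment (dyadic s)" .
  qed
qed

section \<open>The link of a suitable vertex as a host\<close>

definition nbhd_moment :: "nat \<Rightarrow> 'a \<Rightarrow> real" where
  "nbhd_moment s u = (\<Sum>z\<in>dyadic s `` {u}. (real (codeg E u z))\<^sup>2)"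

text \<open>Four-cycles u y z w with one diagonal (u, z) in the chosen class and the other diagonal
  (y, w) of much larger codegree.\<close>

definition bad_cycles :: "nat \<Rightarrow> nat \<Rightarrow> 'a \<Rightarrow> (('a \<times> 'a) \<times> 'a) set" where
  "bad_cycles s k u = {((y, w), z). (y, w) \<in> large k \<and> (u, z) \<in> dyadic s \<and>
     u \<in> E `` {y} \<inter> E `` {w} \<and> z \<in> E `` {y} \<inter> E `` {w}}"

lemma dyadic_sub: "dyadic s \<subseteq> V \<times> V"
  by (auto simp: dyadic_def pairs_def)

lemma fin_dyadic_Image: "finite (dyadic s `` {u})"
  by (rule finite_subset[OF _ finV]) (use dyadic_sub[of s] in auto)

lemma fin_bad_cycles: "finite (bad_cycles s k u)"
  by (rule finite_subset[of _ "large k \<times> V"]) (use dyadic_sub[of s] fin_large finV in \<open>auto simp: bad_cycles_def\<close>)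

lemma sum_nbhd_moment: "(\<Sum>u\<in>V. nbhd_moment s u) = moment (dyadic s)"
proof -
  have "(\<Sum>u\<in>V. nbhd_moment s u) = (\<Sum>p\<in>(SIGMA u:V. dyadic s `` {u}). (real (codeg E (fst p) (snd p)))\<^sup>2)"
    unfolding nbhd_moment_def using finV fin_dyadic_Image by (subst sum.Sigma) (auto simp: split_def)
  also have "(SIGMA u:V. dyadic s `` {u}) = dyadic s" using dyadic_sub[of s] by auto
  finally show ?thesis by (simp add: codeg_pair_def)
qed

text \<open>For a given (y, w), both \<open>u\<close> and \<open>z\<close> are common neighbours,
  which gives at most the square of the codegree.\<close>

lemma sum_bad_cycles: "(\<Sum>u\<in>V. real (card (bad_cycles s k u))) \<le> moment (large k)"
proof -
  let ?N = "\<lambda>p. E `` {fst p} \<inter> E `` {snd p}"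
  have "(\<Sum>u\<in>V. real (card (bad_cycles s k u))) = real (card (SIGMA u:V. bad_cycles s k u))"
    using finV fin_bad_cycles by simp
  also have "\<dots> \<le> real (card (SIGMA p:large k. ?N p \<times> ?N p))"
  proof -
    let ?f = "\<lambda>(u, p, z). (p, u, z)"
    have "inj_on ?f (SIGMA u:V. bad_cycles s k u)" by (auto simp: inj_on_def)
    moreover have "?f ` (SIGMA u:V. bad_cycles s k u) \<subseteq> (SIGMA p:large k. ?N p \<times> ?N p)"
      by (auto simp: bad_cycles_def)
    moreover have "finite (SIGMA p:large k. ?N p \<times> ?N p)"
      using fin_large finN by (intro finite_SigmaI finite_cartesian_product) auto
    ultimately show ?thesis by (simp only: of_nat_le_iff card_inj_on_le)
  qed
  also have "\<dots> = moment (large k)"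
    using fin_large finN by (simp add: card_cartesian_product codeg_pair_def codeg_def power2_eq_square)
  finally show ?thesis .
qed

text \<open>Averaging: over all \<open>u\<close>, the two penalties sum to at most one half and one
  quarter of the moment, so at some \<open>u\<close> both are below its share.\<close>

lemma pick_vertex:
  assumes pos: "moment (dyadic s) > 0" and \<beta>: "\<beta> > 0" and large: "moment (large k) \<le> \<beta> * moment (dyadic s)"
  obtains u where "u \<in> V" "moment (dyadic s) \<le> 2 * m * nbhd_moment s u" "nbhd_moment s u > 0"
    "real (card (bad_cycles s k u)) \<le> 4 * \<beta> * nbhd_moment s u"
proof -
  define X where "X = moment (dyadic s)"
  have X: "X > 0" using pos by (simp add: X_def)
  have "\<exists>u\<in>V. X / (2 * m) + real (card (bad_cycles s k u)) / (4 * \<beta>) < nbhd_moment s u"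
  proof (rule ccontr)
    assume "\<not> ?thesis"
    then have "X \<le> (\<Sum>u\<in>V. X / (2 * m) + real (card (bad_cycles s k u)) / (4 * \<beta>))"
      unfolding X_def sum_nbhd_moment[symmetric] by (intro sum_mono) (auto simp: not_less)
    also have "\<dots> = real (card V) * (X / (2 * m)) + (\<Sum>u\<in>V. real (card (bad_cycles s k u))) / (4 * \<beta>)"
      by (simp add: sum.distrib sum_divide_distrib)
    also have "\<dots> \<le> m * (X / (2 * m)) + (\<beta> * X) / (4 * \<beta>)"
      using size X m_pos \<beta> sum_bad_cycles[of s k] large
      by (intro add_mono mult_right_mono divide_right_mono) (auto simp: X_def intro: order_trans)
    also have "\<dots> = 3 / 4 * X" using m_pos \<beta> by (simp add: field_simps)
    finally show False using X by simp
  qed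
  then obtain u where u: "u \<in> V" "X / (2 * m) + real (card (bad_cycles s k u)) / (4 * \<beta>) < nbhd_moment s u"
    by blast
  have 1: "0 < X / (2 * m)" "0 \<le> real (card (bad_cycles s k u)) / (4 * \<beta>)" using X m_pos \<beta> by auto
  then have "X / (2 * m) \<le> nbhd_moment s u" "real (card (bad_cycles s k u)) / (4 * \<beta>) \<le> nbhd_moment s u"
    "nbhd_moment s u > 0" using u(2) by linarith+
  then show thesis using u(1) m_pos \<beta> that[of u] by (simp add: X_def field_simps)
qed

text \<open>Here \<open>p\<close> is the degree of the vertex, \<open>q\<close> the number of its
  partners in the class and \<open>t\<close> their codegree. For
  \<open>a = q * t / (16 * p)\<close>, \<open>b = t / 16\<close> and threshold
  \<open>2 ^ g * t\<close>, both \<open>TP\<close> and \<open>TQ\<close> reduce to the first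
  inequality. The next two say that \<kappa> b is at least 2 and \<kappa> a at least 1; the last one
  absorbs the constant in the count of deleted edges.\<close>

lemma link_parameters:
  fixes p q t :: real
  assumes low: "\<kappa> * D\<^sup>2 * (1 / \<theta>) ^ (384 * r) \<le> 2048 * (8 * real r + 1) * (q * t\<^sup>2)"
    and p: "p \<le> D * (1 / \<theta>) ^ 3" "t \<le> p" and t: "t > 0" and q: "q > 0"
    and qt: "q * t \<le> (D * (1 / \<theta>) ^ 3)\<^sup>2" and g: "2 ^ g \<le> (1 / \<theta>) ^ (64 * r)"
  shows "4096 * 2 ^ g * p\<^sup>2 \<le> \<kappa> * (q * t\<^sup>2)" "\<kappa> * t \<ge> 32" "16 * p \<le> \<kappa> * (q * t)"
    "4096 * (8 * real r + 1) * \<kappa> \<le> 1"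
proof -
  define K where "K = 8 * real r + 1"
  have K: "K > 0" by (simp add: K_def)
  define R where "R = real r ^ 4"
  have R1: "R \<ge> 1" using r by (simp add: R_def)
  have KR: "K \<le> 16 * R"
  proof -
    have "real r ^ 1 \<le> real r ^ 4" using r by (intro power_increasing) auto
    then have "real r \<le> R" by (simp only: power_one_right R_def)
    then show ?thesis using R1 unfolding K_def by linarith
  qed
  have RT: "8388608 * R \<le> 1 / \<theta>" using inv_theta_large by (simp only: R_def)
  then have "(8388608 * R) * 16 \<le> (1 / \<theta>) * (1 / \<theta>)"
    using R1 inv_theta \<theta> by (intro mult_mono) auto
  then have K2: "8388608 * K \<le> (1 / \<theta>)\<^sup>2" unfolding power2_eq_square using KR by linarith
  have p0: "p > 0" using p t by linarith
  have \<kappa>0: "\<kappa> > 0" using \<theta> by simp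
  have \<kappa>2: "\<kappa> * \<kappa> * (1 / \<theta>) ^ (384 * r) = (1 / \<theta>) ^ (384 * r - 8)"
  proof -
    have "\<kappa> * \<kappa> = \<theta> ^ 8" by (simp add: power_add[symmetric])
    moreover have "384 * r = 8 + (384 * r - 8)" using r by simp
    ultimately show ?thesis using theta_cancel[of 8 "384 * r - 8"] by metis
  qed
  have 1: "2048 * K * (4096 * 2 ^ g * p\<^sup>2) \<le> 2048 * K * (\<kappa> * (q * t\<^sup>2))"
  proof -
    have "2048 * K * (4096 * 2 ^ g * p\<^sup>2) = (8388608 * K) * 2 ^ g * p\<^sup>2" by simp
    also have "\<dots> \<le> (1 / \<theta>)\<^sup>2 * (1 / \<theta>) ^ (64 * r) * (D * (1 / \<theta>) ^ 3)\<^sup>2"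
      using K2 g p p0 K \<theta> by (intro mult_mono power_mono) auto
    also have "\<dots> = D\<^sup>2 * (1 / \<theta>) ^ (8 + 64 * r)"
    proof -
      have "x ^ 8 = x\<^sup>2 * (x ^ 3)\<^sup>2" for x :: real by (simp add: power_mult[symmetric] power_add[symmetric])
      then show ?thesis by (simp only: power_add power_mult_distrib mult_ac)
    qed
    also have "\<dots> \<le> D\<^sup>2 * (1 / \<theta>) ^ (384 * r - 8)"
      using r by (intro mult_left_mono inv_theta_power) auto
    also have "\<dots> = \<kappa> * (\<kappa> * D\<^sup>2 * (1 / \<theta>) ^ (384 * r))"
      unfolding \<kappa>2[symmetric] by (simp only: mult_ac)
    also have "\<dots> \<le> \<kappa> * (2048 * K * (q * t\<^sup>2))" using low \<kappa>0 by (intro mult_left_mono) (auto simp: K_def)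
    finally show ?thesis by (simp only: mult_ac)
  qed
  show key: "4096 * 2 ^ g * p\<^sup>2 \<le> \<kappa> * (q * t\<^sup>2)"
    using mult_left_le_imp_le[OF 1] K by simp
  show "16 * p \<le> \<kappa> * (q * t)"
  proof -
    have "4096 * 1 * p\<^sup>2 \<le> 4096 * 2 ^ g * p\<^sup>2" by (intro mult_right_mono mult_left_mono) auto
    also have "\<dots> \<le> \<kappa> * (q * t) * t" using key by (simp only: power2_eq_square mult_ac)
    also have "\<dots> \<le> \<kappa> * (q * t) * p" using p \<kappa>0 q t by (intro mult_left_mono) auto
    finally have "4096 * p * p \<le> \<kappa> * (q * t) * p" by (simp add: power2_eq_square)
    then have "4096 * p \<le> \<kappa> * (q * t)" using p0 by (rule mult_right_le_imp_le)
    then show ?thesis using p0 by linarith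
  qed
  show "\<kappa> * t \<ge> 32"
  proof -
    \<comment> \<open>Bounding \<open>q * t\<close> by the number of walks of two steps from the
      vertex leaves a lower bound for \<open>t\<close> alone.\<close>
    have "D\<^sup>2 * (\<kappa> * (1 / \<theta>) ^ (384 * r)) \<le> 2048 * K * ((q * t) * t)"
      using low by (simp only: K_def power2_eq_square mult_ac)
    also have "\<dots> \<le> 2048 * K * ((D * (1 / \<theta>) ^ 3)\<^sup>2 * t)"
      using qt t K by (intro mult_left_mono mult_right_mono) auto
    also have "\<dots> = D\<^sup>2 * (2048 * K * (1 / \<theta>) ^ 6 * t)"
    proof -
      have "x ^ 6 = (x ^ 3)\<^sup>2" for x :: real by (simp add: power_mult[symmetric])
      then show ?thesis by (simp only: power_mult_distrib mult_ac)
    qed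
    finally have "\<kappa> * (1 / \<theta>) ^ (384 * r) \<le> 2048 * K * (1 / \<theta>) ^ 6 * t"
      using D by (subst (asm) mult_le_cancel_left_pos) auto
    then have "32 * (\<kappa> * (\<kappa> * (1 / \<theta>) ^ (384 * r))) \<le> 32 * (\<kappa> * (2048 * K * (1 / \<theta>) ^ 6 * t))"
      using \<kappa>0 by (intro mult_left_mono) auto
    then have "32 * (1 / \<theta>) ^ (384 * r - 8) \<le> (65536 * K) * (1 / \<theta>) ^ 6 * (\<kappa> * t)"
      unfolding \<kappa>2[symmetric] by (simp add: mult_ac)
    also have "\<dots> \<le> (1 / \<theta>)\<^sup>2 * (1 / \<theta>) ^ 6 * (\<kappa> * t)"
      using K2 K \<kappa>0 t \<theta> by (intro mult_right_mono) auto
    also have "\<dots> = (1 / \<theta>) ^ 8 * (\<kappa> * t)" by (simp only: power_add[symmetric]) simp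
    finally have "32 * (1 / \<theta>) ^ (384 * r - 8) \<le> (1 / \<theta>) ^ 8 * (\<kappa> * t)" .
    moreover have "(1 / \<theta>) ^ 8 * 32 \<le> 32 * (1 / \<theta>) ^ (384 * r - 8)"
      using inv_theta_power[of 8 "384 * r - 8"] r by simp
    ultimately have "(1 / \<theta>) ^ 8 * 32 \<le> (1 / \<theta>) ^ 8 * (\<kappa> * t)" by linarith
    then show ?thesis using \<theta> by (subst (asm) mult_le_cancel_left_pos) auto
  qed
  show "4096 * (8 * real r + 1) * \<kappa> \<le> 1"
  proof -
    have "4096 * K \<le> (1 / \<theta>) ^ 4"
      using K2 K inv_theta_power[of 2 4] by linarith
    then have "4096 * K * \<kappa> \<le> (1 / \<theta>) ^ 4 * \<kappa>" using \<kappa>0 by (intro mult_right_mono) auto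
    also have "\<dots> = 1" using theta_cancel[of 4 0] by (simp add: mult.commute)
    finally show ?thesis by (simp add: K_def)
  qed
qed

text \<open>Two partners of \<open>u\<close> have codegree below \<open>2 ^ Suc s\<close> in the
  link, since their link-neighbours are common neighbours with \<open>u\<close>; this uses the upper
  end of the dyadic class and \<open>g \<ge> 1\<close>. Two neighbours of \<open>u\<close> may have
  large codegree, but each such configuration is a bad cycle, so it suffices to delete the few edges
  lying in many of them.\<close>

lemma link_embeds:
  assumes pos: "nbhd_moment s u > 0"
    and low: "\<kappa> * D\<^sup>2 * (1 / \<theta>) ^ (384 * r) \<le> 512 * (8 * real r + 1) * nbhd_moment s u"
    and g: "g \<ge> 1" "2 ^ g \<le> (1 / \<theta>) ^ (64 * r)"
    and bad: "real (card (bad_cycles s (s + g) u)) \<le> 8 * (8 * real r + 1) * \<theta> ^ 8 * nbhd_moment s u"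
  shows "embeds (512 * r\<^sup>2) (2 * (512 * r\<^sup>2) * (512 * r\<^sup>2) + 1) E"
proof -
  define t :: real where "t = 2 ^ s"
  define Q' where "Q' = dyadic s `` {u}"
  define P' where "P' = E `` {u}"
  define p where "p = real (card P')"
  define q where "q = real (card Q')"
  define K where "K = 8 * real r + 1"
  define L1 where "L1 = {(y, z) \<in> E. y \<in> P' \<and> z \<in> Q'}"
  define B where "B y z = {w \<in> E `` {u} \<inter> E `` {z}. (y, w) \<in> large (s + g)}" for y z
  define Del where "Del = {e \<in> L1. \<kappa> * t / 32 \<le> real (card (B (fst e) (snd e)))}"
  define F where "F = (L1 - Del) \<union> (L1 - Del)\<inverse>"
  have \<kappa>: "\<kappa> > 0" using \<theta> by simp
  have t: "t > 0" by (simp add: t_def)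
  have K: "K > 0" by (simp add: K_def)
  have finP': "finite P'" and finQ': "finite Q'" unfolding P'_def Q'_def by (rule finN fin_dyadic_Image)+
  have finL1: "finite L1" by (rule finite_subset[OF _ finE]) (auto simp: L1_def)
  have codegQ: "2 ^ s \<le> codeg E u z" "codeg E u z < 2 ^ Suc s" if "z \<in> Q'" for z
    using that by (auto simp: Q'_def dyadic_def codeg_pair_def)
  have codegQr: "t \<le> real (codeg E u z)" "real (codeg E u z) \<le> 2 * t" if "z \<in> Q'" for z
  proof -
    have "real (2 ^ s) \<le> real (codeg E u z)" using codegQ(1)[OF that] by (rule of_nat_mono)
    then show "t \<le> real (codeg E u z)" by (simp add: t_def)
    have "real (codeg E u z) \<le> real (2 ^ Suc s)" using codegQ(2)[OF that] by (intro of_nat_mono) simp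
    then show "real (codeg E u z) \<le> 2 * t" by (simp add: t_def)
  qed
  \<comment> \<open>A neighbour of \<open>u\<close> with positive codegree to \<open>u\<close> would
    close a triangle in a bipartite graph.\<close>
  have disj: "P' \<inter> Q' = {}"
  proof (rule ccontr)
    assume "P' \<inter> Q' \<noteq> {}"
    then obtain y where y: "(u, y) \<in> E" "y \<in> Q'" by (auto simp: P'_def)
    have "codeg E u y \<noteq> 0" using codegQ(1)[OF y(2)] by (metis le_zero_eq power_not_zero zero_neq_numeral)
    then have "E `` {u} \<inter> E `` {y} \<noteq> {}" unfolding codeg_def by (metis card.empty)
    then obtain w where "(u, w) \<in> E" "(y, w) \<in> E" by blast
    then show False using y(1) bip by blast
  qed
  have Q'ne: "Q' \<noteq> {}" using pos by (auto simp: nbhd_moment_def Q'_def)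
  then have q: "q > 0" using finQ' by (simp add: q_def card_gt_0_iff)
  have "nbhd_moment s u \<le> (\<Sum>z\<in>Q'. (2 * t)\<^sup>2)"
    unfolding nbhd_moment_def Q'_def[symmetric] by (intro sum_mono power_mono codegQr) auto
  then have nm: "nbhd_moment s u \<le> 4 * (q * t\<^sup>2)" by (simp add: q_def power_mult_distrib)
  have low': "\<kappa> * D\<^sup>2 * (1 / \<theta>) ^ (384 * r) \<le> 2048 * (8 * real r + 1) * (q * t\<^sup>2)"
  proof -
    have "512 * (8 * real r + 1) * nbhd_moment s u \<le> 512 * (8 * real r + 1) * (4 * (q * t\<^sup>2))"
      using nm by (intro mult_left_mono) auto
    then show ?thesis using low by (simp add: algebra_simps)
  qed
  have p: "p \<le> D * (1 / \<theta>) ^ 3" using maxdeg[of u] by (simp only: p_def P'_def deg_def)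
  have tp: "t \<le> p"
  proof -
    obtain z where z: "z \<in> Q'" using Q'ne by blast
    have "real (codeg E u z) \<le> p" unfolding p_def P'_def of_nat_le_iff deg_def[symmetric] by (rule codeg_le_deg)
    then show ?thesis using codegQr(1)[OF z] by linarith
  qed
  have p0: "p > 0" using tp t by linarith
  have qt: "q * t \<le> real (card L1)"
  proof -
    have "q * t = (\<Sum>z\<in>Q'. t)" by (simp add: q_def)
    also have "\<dots> \<le> (\<Sum>z\<in>Q'. real (codeg E u z))" by (intro sum_mono codegQr)
    also have "\<dots> = real (card (SIGMA z:Q'. E `` {u} \<inter> E `` {z}))"
      using finQ' finN by (simp add: codeg_def)
    also have "\<dots> \<le> real (card L1)"
    proof -
      have "prod.swap ` (SIGMA z:Q'. E `` {u} \<inter> E `` {z}) \<subseteq> L1"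
        by (auto simp: L1_def P'_def intro: E_sym)
      then show ?thesis unfolding of_nat_le_iff by (rule card_inj_on_le[OF inj_swap _ finL1])
    qed
    finally show ?thesis .
  qed
  have qt2: "q * t \<le> (D * (1 / \<theta>) ^ 3)\<^sup>2"
  proof -
    have "real (card L1) \<le> real (card (SIGMA y:P'. E `` {y}))"
      unfolding of_nat_le_iff using finP' finN by (intro card_mono finite_SigmaI) (auto simp: L1_def)
    also have "\<dots> = (\<Sum>y\<in>P'. real (deg E y))" using finP' finN by (simp add: deg_def)
    also have "\<dots> \<le> (\<Sum>y\<in>P'. D * (1 / \<theta>) ^ 3)" by (intro sum_mono maxdeg)
    also have "\<dots> = p * (D * (1 / \<theta>) ^ 3)" by (simp add: p_def)
    also have "\<dots> \<le> (D * (1 / \<theta>) ^ 3) * (D * (1 / \<theta>) ^ 3)"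
      using p D \<theta> by (intro mult_right_mono) auto
    finally show ?thesis using qt by (simp only: power2_eq_square)
  qed
  note par = link_parameters[OF low' p tp t q qt2 g(2)]
  have finB: "finite (B y z)" for y z by (rule finite_subset[OF _ finN[of u]]) (auto simp: B_def)
  have finDel: "finite Del" by (rule finite_subset[OF _ finL1]) (auto simp: Del_def)
  \<comment> \<open>Every deleted edge lies in at least \<open>\<kappa> * t / 32\<close> bad
    cycles.\<close>
  have cDel: "real (card Del) \<le> q * t / 4"
  proof -
    have "real (card Del) * (\<kappa> * t / 32) = (\<Sum>e\<in>Del. \<kappa> * t / 32)" by simp
    also have "\<dots> \<le> (\<Sum>e\<in>Del. real (card (B (fst e) (snd e))))" by (rule sum_mono) (simp add: Del_def)
    also have "\<dots> = real (card (SIGMA e:Del. B (fst e) (snd e)))" using finDel finB by simp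
    also have "\<dots> \<le> real (card (bad_cycles s (s + g) u))"
    proof -
      let ?f = "\<lambda>(e, w). ((fst e, w), snd e)"
      have "inj_on ?f (SIGMA e:Del. B (fst e) (snd e))" by (auto simp: inj_on_def)
      moreover have "?f ` (SIGMA e:Del. B (fst e) (snd e)) \<subseteq> bad_cycles s (s + g) u"
        by (auto simp: Del_def L1_def B_def bad_cycles_def P'_def Q'_def intro: E_sym)
      ultimately show ?thesis unfolding of_nat_le_iff by (rule card_inj_on_le[OF _ _ fin_bad_cycles])
    qed
    also have "\<dots> \<le> 8 * K * \<theta> ^ 8 * nbhd_moment s u" using bad by (simp only: K_def)
    also have "\<dots> \<le> 8 * K * \<theta> ^ 8 * (4 * (q * t\<^sup>2))" using nm K \<theta> by (intro mult_left_mono) auto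
    also have "\<dots> = (4096 * K * \<kappa>) * (\<kappa> * (q * t\<^sup>2) / 128)"
    proof -
      have "\<theta> ^ 8 = \<kappa> * \<kappa>" by (simp add: power_add[symmetric])
      then show ?thesis by simp
    qed
    also have "\<dots> \<le> 1 * (\<kappa> * (q * t\<^sup>2) / 128)"
      using par(4) \<kappa> q by (intro mult_right_mono) (auto simp: K_def)
    also have "\<dots> = q * t / 4 * (\<kappa> * t / 32)" by (simp add: power2_eq_square)
    finally show ?thesis by (rule mult_right_le_imp_le) (use \<kappa> t in simp)
  qed
  have finF: "finite F" using finL1 by (auto simp: F_def)
  have symF: "sym F" by (auto simp: F_def sym_def)
  have L1E: "L1 \<subseteq> E" by (auto simp: L1_def)
  have F_sub: "F \<subseteq> E" using L1E by (auto simp: F_def intro: E_sym)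
  have F_PQ: "F \<subseteq> P' \<times> Q' \<union> Q' \<times> P'" by (auto simp: F_def L1_def)
  \<comment> \<open>Proportional to the average degrees of the two sides: either side contributes
    \<open>q * t / 16\<close> to the sum, while at least three quarters of \<open>q * t\<close>
    edges survive the deletion.\<close>
  define av where "av v = (if v \<in> P' then q * t / (16 * p) else t / 16)" for v
  have sum_av: "2 * (\<Sum>v\<in>P' \<union> Q'. av v) < real (card F)"
  proof -
    have "(\<Sum>v\<in>P' \<union> Q'. av v) = (\<Sum>v\<in>P'. av v) + (\<Sum>v\<in>Q'. av v)"
      by (rule sum.union_disjoint[OF finP' finQ' disj])
    also have "(\<Sum>v\<in>P'. av v) = (\<Sum>v\<in>P'. q * t / (16 * p))" by (rule sum.cong) (auto simp: av_def)
    also have "\<dots> = q * t / 16" using p0 by (simp add: p_def[symmetric])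
    also have "(\<Sum>v\<in>Q'. av v) = (\<Sum>v\<in>Q'. t / 16)" using disj by (intro sum.cong) (auto simp: av_def)
    also have "\<dots> = q * t / 16" by (simp add: q_def)
    finally have "2 * (\<Sum>v\<in>P' \<union> Q'. av v) = q * t / 4" by simp
    moreover have "card (L1 - Del) \<le> card F" by (rule card_mono[OF finF]) (auto simp: F_def)
    moreover have "real (card (L1 - Del)) = real (card L1) - real (card Del)"
    proof -
      have "Del \<subseteq> L1" by (auto simp: Del_def)
      then show ?thesis using finL1 by (simp add: card_Diff_subset finDel of_nat_diff card_mono)
    qed
    moreover have "q * t > 0" using q t by simp
    ultimately show ?thesis using qt cDel by linarith
  qed
  have av0: "av v \<ge> 0" for v using q t p0 by (simp add: av_def)
  have "F \<subseteq> (P' \<union> Q') \<times> (P' \<union> Q')" using F_PQ by blast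
  then obtain S where S: "S \<subseteq> P' \<union> Q'" "F \<inter> S \<times> S \<noteq> {}"
    and md: "\<And>v. v \<in> S \<Longrightarrow> av v \<le> real (deg (F \<inter> S \<times> S) v)"
    using min_degree_subgraph[OF finF symF _ _ av0 sum_av] finP' finQ' by (metis finite_Un)
  define L where "L = F \<inter> S \<times> S"
  have symL: "sym L" using symF by (auto simp: L_def sym_def)
  have L_sub: "L \<subseteq> E" using F_sub by (auto simp: L_def)
  have L_PQ: "L \<subseteq> P' \<times> Q' \<union> Q' \<times> P'" using F_PQ by (auto simp: L_def)
  have degP: "q * t / (16 * p) \<le> deg L x" if "x \<in> P' \<inter> Domain L" for x
    using md[of x] that by (auto simp: L_def av_def)
  have degQ: "t / 16 \<le> deg L x" if "x \<in> Q' \<inter> Domain L" for x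
  proof -
    have "x \<notin> P'" using that disj by blast
    then show ?thesis using md[of x] that by (auto simp: L_def av_def)
  qed
  have DomL: "x \<in> Domain L \<and> y \<in> Domain L" if "(x, y) \<in> L" for x y
    using that symL by (auto dest: symD)
  show ?thesis
  proof (rule embeds_subgraph[of L P' Q' "2 ^ (s + g)" "q * t / (16 * p)" "t / 16"])
    show "L \<noteq> {}" using S by (simp add: L_def)
    show "0 < q * t / (16 * p)" using q t p0 by simp
    show "0 < t / 16" using t by simp
    have c: "real (card (Q' \<inter> Domain L)) \<le> q" "real (card (P' \<inter> Domain L)) \<le> p"
      unfolding q_def p_def of_nat_le_iff using finP' finQ' by (auto intro!: card_mono)
    have "2 ^ (s + g) * real (card (Q' \<inter> Domain L)) \<le> 2 ^ (s + g) * q"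
      using c by (intro mult_left_mono) auto
    also have "\<dots> = (4096 * 2 ^ g * p\<^sup>2) * (q * t / (4096 * p\<^sup>2))" using p0 by (simp add: t_def power_add)
    also have "\<dots> \<le> (\<kappa> * (q * t\<^sup>2)) * (q * t / (4096 * p\<^sup>2))"
      using par(1) q t by (intro mult_right_mono) auto
    also have "\<dots> = \<kappa> * (q * t / (16 * p))\<^sup>2 * (t / 16)"
      by (simp add: power_divide power_mult_distrib power2_eq_square)
    finally show "2 ^ (s + g) * real (card (Q' \<inter> Domain L)) \<le> \<kappa> * (q * t / (16 * p))\<^sup>2 * (t / 16)" .
    have "2 ^ (s + g) * real (card (P' \<inter> Domain L)) \<le> 2 ^ (s + g) * p"
      using c by (intro mult_left_mono) auto
    also have "\<dots> = (4096 * 2 ^ g * p\<^sup>2) * (t / (4096 * p))"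
      using p0 by (simp add: t_def power_add power2_eq_square)
    also have "\<dots> \<le> (\<kappa> * (q * t\<^sup>2)) * (t / (4096 * p))"
      using par(1) t p0 by (intro mult_right_mono) auto
    also have "\<dots> = \<kappa> * (q * t / (16 * p)) * (t / 16)\<^sup>2"
      by (simp add: power_divide power2_eq_square)
    finally show "2 ^ (s + g) * real (card (P' \<inter> Domain L)) \<le> \<kappa> * (q * t / (16 * p)) * (t / 16)\<^sup>2" .
  next
    fix x y assume xy: "(x, y) \<in> L"
    let ?Z = "{z \<in> L `` {y}. z = x \<or> real (codeg L x z) > 2 ^ (s + g)}"
    from xy have "(x, y) \<in> L1 - Del \<or> (y, x) \<in> L1 - Del" by (auto simp: L_def F_def)
    then show "real (card ?Z) \<le> \<kappa> * deg L y"
    proof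
      assume e: "(x, y) \<in> L1 - Del"
      then have PQ: "x \<in> P'" "y \<in> Q'" by (auto simp: L1_def)
      have "?Z \<subseteq> insert x (B x y)"
      proof
        fix z assume z: "z \<in> ?Z"
        then have yz: "(y, z) \<in> L" by simp
        have zP: "z \<in> P'" using yz L_PQ PQ(2) disj by blast
        show "z \<in> insert x (B x y)"
        proof (cases "z = x")
          case False
          then have "2 ^ (s + g) < real (codeg L x z)" using z by simp
          also have "\<dots> \<le> real (codeg E x z)" using codeg_mono[OF L_sub] by simp
          finally have "real (2 ^ (s + g)) \<le> real (codeg E x z)" by simp
          then have "2 ^ (s + g) \<le> codeg E x z" unfolding of_nat_le_iff .
          moreover have "x \<in> V" "z \<in> V" using xy yz L_sub E_V by blast+
          ultimately have "(x, z) \<in> large (s + g)" using False by (simp add: large_def pairs_def codeg_pair_def)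
          then show ?thesis using zP yz L_sub by (auto simp: B_def P'_def)
        qed simp
      qed
      then have "card ?Z \<le> card (insert x (B x y))" using finB by (intro card_mono) auto
      also have "\<dots> \<le> Suc (card (B x y))" by (rule card_insert_le_m1) auto
      finally have "real (card ?Z) \<le> 1 + real (card (B x y))" by linarith
      moreover have "real (card (B x y)) < \<kappa> * t / 32" using e by (auto simp: Del_def)
      ultimately have "real (card ?Z) \<le> 1 + \<kappa> * t / 32" by linarith
      also have "\<dots> \<le> \<kappa> * (t / 16)" using par(2) by linarith
      also have "\<dots> \<le> \<kappa> * deg L y"
        using degQ[of y] PQ DomL[OF xy] \<kappa> by (intro mult_left_mono) auto
      finally show ?thesis .
    next
      assume e: "(y, x) \<in> L1 - Del"
      then have PQ: "y \<in> P'" "x \<in> Q'" by (auto simp: L1_def)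
      \<comment> \<open>Starting from a partner of \<open>u\<close>, no step reaches too large a
        codegree; only the return to \<open>x\<close> is bad.\<close>
      have "?Z \<subseteq> {x}"
      proof
        fix z assume z: "z \<in> ?Z"
        have "L `` {x} \<subseteq> E `` {u} \<inter> E `` {x}" using L_PQ L_sub PQ(2) disj by (auto simp: P'_def)
        then have "codeg L x z \<le> codeg E u x"
          unfolding codeg_def using finN[of u] by (intro card_mono) auto
        also have "\<dots> \<le> 2 ^ Suc s" using codegQ(2)[OF PQ(2)] by simp
        also have "\<dots> \<le> 2 ^ (s + g)" using g(1) by (intro power_increasing) auto
        finally have "real (codeg L x z) \<le> real (2 ^ (s + g))" unfolding of_nat_le_iff .
        then show "z \<in> {x}" using z by simp
      qed
      then have "card ?Z \<le> card {x}" by (intro card_mono) auto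
      then have "real (card ?Z) \<le> 1" by simp
      also have "1 \<le> \<kappa> * (q * t / (16 * p))" using par(3) p0 by (simp add: field_simps)
      also have "\<dots> \<le> \<kappa> * deg L y"
        using degP[of y] PQ DomL[OF xy] \<kappa> by (intro mult_left_mono) auto
      finally show ?thesis .
    qed
  qed (use L_sub symL L_PQ disj degP degQ in auto)
qed

lemma regular_embeds: "embeds (512 * r\<^sup>2) (2 * (512 * r\<^sup>2) * (512 * r\<^sup>2) + 1) E"
proof (cases "real (card {(x, y) \<in> E. heavy x y}) \<le> D * m / 8")
  case True
  then show ?thesis by (rule embeds_if_few_heavy)
next
  case False
  then have many: "real (card {(x, y) \<in> E. heavy x y}) \<ge> D * m / 8" by simp
  obtain s g where sg: "moment (dyadic s) > 0" "g \<ge> 1" "2 ^ g \<le> (1 / \<theta>) ^ (64 * r)"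
    "\<kappa> * D\<^sup>2 * m * (1 / \<theta>) ^ (384 * r) / 256 \<le> (8 * real r + 1) * moment (dyadic s)"
    "moment (large (s + g)) \<le> 2 * (8 * real r + 1) * \<theta> ^ 8 * moment (dyadic s)"
    using select_class[OF many] by blast
  have "2 * (8 * real r + 1) * \<theta> ^ 8 > 0" using \<theta> by (intro mult_pos_pos) auto
  from pick_vertex[OF sg(1) this sg(5)] obtain u where u: "moment (dyadic s) \<le> 2 * m * nbhd_moment s u"
    "nbhd_moment s u > 0"
    "real (card (bad_cycles s (s + g) u)) \<le> 4 * (2 * (8 * real r + 1) * \<theta> ^ 8) * nbhd_moment s u"
    by blast
  show ?thesis
  proof (rule link_embeds[OF u(2) _ sg(2,3)])
    have "\<kappa> * D\<^sup>2 * m * (1 / \<theta>) ^ (384 * r) / 256 \<le> (8 * real r + 1) * (2 * m * nbhd_moment s u)"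
      using u(1) by (intro order_trans[OF sg(4)] mult_left_mono) auto
    then have "m * (\<kappa> * D\<^sup>2 * (1 / \<theta>) ^ (384 * r)) \<le> m * (512 * (8 * real r + 1) * nbhd_moment s u)"
      by (simp add: algebra_simps)
    then show "\<kappa> * D\<^sup>2 * (1 / \<theta>) ^ (384 * r) \<le> 512 * (8 * real r + 1) * nbhd_moment s u"
      using m_pos by (subst (asm) mult_le_cancel_left_pos)
    show "real (card (bad_cycles s (s + g) u)) \<le> 8 * (8 * real r + 1) * \<theta> ^ 8 * nbhd_moment s u"
      using u(3) by (simp add: algebra_simps)
  qed
qed

end

section \<open>The brick torus is cubic and bipartite\<close>

definition up :: "nat \<Rightarrow> nat \<Rightarrow> nat" where "up n x = Suc x mod n"
definition down :: "nat \<Rightarrow> nat \<Rightarrow> nat" where "down n x = (x + n - 1) mod n"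

lemma up_eq: "x < n \<Longrightarrow> up n x = (if Suc x = n then 0 else Suc x)"
  by (auto simp: up_def)

lemma down_eq:
  assumes "x < n"
  shows "down n x = (if x = 0 then n - 1 else x - 1)"
proof (cases x)
  case 0
  then show ?thesis using assms by (simp add: down_def)
next
  case (Suc y)
  then have "x + n - 1 = y + n" by simp
  then show ?thesis using Suc assms by (simp add: down_def)
qed

lemma up_down_less: "x < n \<Longrightarrow> up n x < n" "x < n \<Longrightarrow> down n x < n"
  by (auto simp: up_eq down_eq)

lemma up_down_inverse: "x < n \<Longrightarrow> up n (down n x) = x" "x < n \<Longrightarrow> down n (up n x) = x"
  by (auto simp: up_down_less up_eq down_eq split: if_splits)

lemma up_down_parity:
  "even n \<Longrightarrow> x < n \<Longrightarrow> even (up n x) \<longleftrightarrow> odd x" "even n \<Longrightarrow> x < n \<Longrightarrow> even (down n x) \<longleftrightarrow> odd x"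
proof -
  assume "even n" "x < n"
  then show "even (up n x) \<longleftrightarrow> odd x" by (auto simp: up_eq)
  from \<open>even n\<close> \<open>x < n\<close> show "even (down n x) \<longleftrightarrow> odd x" by (cases x) (auto simp: down_eq)
qed

lemma up_neq_down: "n \<ge> 3 \<Longrightarrow> x < n \<Longrightarrow> up n x \<noteq> down n x"
  by (cases x) (auto simp: up_eq down_eq)

lemma up_down_neq: "n \<ge> 2 \<Longrightarrow> x < n \<Longrightarrow> up n x \<noteq> x" "n \<ge> 2 \<Longrightarrow> x < n \<Longrightarrow> down n x \<noteq> x"
  by (cases x; auto simp: up_eq down_eq)+

lemma regular_bipartite_graphI:
  fixes N :: "'a \<Rightarrow> 'a set" and c :: "'a \<Rightarrow> bool"
  assumes "finite V"
    and N: "\<And>v w. v \<in> V \<Longrightarrow> w \<in> N v \<Longrightarrow> w \<in> V \<and> v \<in> N w \<and> c w \<noteq> c v"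
    and d: "\<And>v. v \<in> V \<Longrightarrow> card (N v) = d"
    and E: "E = {{v, w} | v w. v \<in> V \<and> w \<in> N v}"
  shows "regular_graph d V E" "bipartite_graph V E"
proof -
  have simple: "simple_graph V E"
    unfolding simple_graph_def
  proof (intro conjI ballI assms(1))
    fix e assume "e \<in> E"
    then obtain v w where "e = {v, w}" "v \<in> V" "w \<in> N v" by (auto simp: E)
    moreover from this have "w \<in> V" "v \<noteq> w" using N[of v w] by auto
    ultimately show "e \<subseteq> V" "card e = 2" by auto
  qed
  have "degree E v = d" if v: "v \<in> V" for v
  proof -
    have "{e \<in> E. v \<in> e} = (\<lambda>w. {v, w}) ` N v"
    proof (intro equalityI subsetI)
      fix e assume "e \<in> {e \<in> E. v \<in> e}"
      then obtain x y where e: "e = {x, y}" "x \<in> V" "y \<in> N x" "v = x \<or> v = y" by (auto simp: E)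
      show "e \<in> (\<lambda>w. {v, w}) ` N v"
      proof (cases "v = x")
        case True
        then show ?thesis using e by auto
      next
        case False
        then have "v = y" "e = {v, x}" using e by auto
        moreover have "x \<in> N v" using N[OF e(2,3)] \<open>v = y\<close> by blast
        ultimately show ?thesis by blast
      qed
    qed (use v in \<open>auto simp: E\<close>)
    moreover have "inj_on (\<lambda>w. {v, w}) (N v)" by (auto simp: inj_on_def doubleton_eq_iff)
    ultimately show ?thesis using d[OF v] by (simp add: degree_def card_image)
  qed
  with simple show "regular_graph d V E" by (simp add: regular_graph_def)
  have "card (e \<inter> {v \<in> V. c v}) = 1 \<and> card (e \<inter> {v \<in> V. \<not> c v}) = 1" if "e \<in> E" for e
  proof -
    obtain v w where e: "e = {v, w}" "v \<in> V" "w \<in> N v" using \<open>e \<in> E\<close> by (auto simp: E)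
    have w: "w \<in> V" "c w \<noteq> c v" using N[OF e(2,3)] by auto
    show ?thesis
    proof (cases "c v")
      case True
      then have "e \<inter> {v \<in> V. c v} = {v}" "e \<inter> {v \<in> V. \<not> c v} = {w}" using e w by auto
      then show ?thesis by simp
    next
      case False
      then have "e \<inter> {v \<in> V. c v} = {w}" "e \<inter> {v \<in> V. \<not> c v} = {v}" using e w by auto
      then show ?thesis by simp
    qed
  qed
  moreover have "{v \<in> V. c v} \<union> {v \<in> V. \<not> c v} = V" "{v \<in> V. c v} \<inter> {v \<in> V. \<not> c v} = {}" by auto
  ultimately show "bipartite_graph V E" using simple unfolding bipartite_graph_def by blast
qed

definition brick_nbrs :: "nat \<Rightarrow> nat \<Rightarrow> nat \<times> nat \<Rightarrow> (nat \<times> nat) set" where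
  "brick_nbrs l k = (\<lambda>(t, j). let j' = (if even t then down (2 * l) j else up (2 * l) j) in
     {(t, if even j then Suc j else j - 1), (up (2 * k) t, j'), (down (2 * k) t, j')})"

text \<open>The parity of the index is a proper colouring: every edge shifts the index by one modulo
  the even number \<open>2 * l\<close>. Symmetry holds because \<open>up\<close> and
  \<open>down\<close> are inverse and adjacent layers have opposite parity.\<close>

lemma brick_nbrs_sym:
  assumes v: "v \<in> brick_V l k" and w: "w \<in> brick_nbrs l k v"
  shows "w \<in> brick_V l k \<and> v \<in> brick_nbrs l k w \<and> even (snd w) \<noteq> even (snd v)"
proof -
  obtain t j where [simp]: "v = (t, j)" by (cases v)
  have t: "t < 2 * k" "j < 2 * l" using v by (auto simp: brick_V_def)
  note [simp] = up_down_less up_down_inverse up_down_parity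
  consider "w = (t, if even j then Suc j else j - 1)"
    | "w = (up (2 * k) t, if even t then down (2 * l) j else up (2 * l) j)"
    | "w = (down (2 * k) t, if even t then down (2 * l) j else up (2 * l) j)"
    using w by (auto simp: brick_nbrs_def Let_def)
  then show ?thesis
  proof cases
    case 1
    show ?thesis
    proof (cases "even j")
      case True
      then have "Suc j < 2 * l" using t(2) by (metis Suc_lessI dvd_triv_left even_Suc)
      then show ?thesis using 1 True t by (simp add: brick_V_def brick_nbrs_def Let_def)
    next
      case False
      then have "j \<noteq> 0" by (metis even_zero)
      then show ?thesis using 1 False t by (auto simp: brick_V_def brick_nbrs_def Let_def)
    qed
  next
    case 2
    then show ?thesis using t by (cases "even t") (simp_all add: brick_V_def brick_nbrs_def Let_def)
  next
    case 3
    then show ?thesis using t by (cases "even t") (simp_all add: brick_V_def brick_nbrs_def Let_def)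
  qed
qed

lemma brick_E_eq: "brick_E l k = {{v, w} | v w. v \<in> brick_V l k \<and> w \<in> brick_nbrs l k v}"
proof (intro equalityI subsetI)
  fix e assume "e \<in> brick_E l k"
  then consider t i where "e = {(t, 2 * i), (t, Suc (2 * i))}" "t < 2 * k" "i < l"
    | t t' j where "e = {(t, j), (t', down (2 * l) j)}" "even t" "t < 2 * k" "j < 2 * l"
      "t' = up (2 * k) t \<or> t' = down (2 * k) t"
    unfolding brick_E_def up_def down_def by blast
  then show "e \<in> {{v, w} | v w. v \<in> brick_V l k \<and> w \<in> brick_nbrs l k v}"
  proof cases
    case (1 t i)
    then have "(t, 2 * i) \<in> brick_V l k" "(t, Suc (2 * i)) \<in> brick_nbrs l k (t, 2 * i)"
      by (auto simp: brick_V_def brick_nbrs_def Let_def)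
    then show ?thesis using 1 by blast
  next
    case (2 t t' j)
    then have "(t, j) \<in> brick_V l k" "(t', down (2 * l) j) \<in> brick_nbrs l k (t, j)"
      by (auto simp: brick_V_def brick_nbrs_def Let_def)
    then show ?thesis using 2 by blast
  qed
next
  have cross: "{(t, j), (t', down (2 * l) j)} \<in> brick_E l k"
    if "even t" "t < 2 * k" "j < 2 * l" "t' = up (2 * k) t \<or> t' = down (2 * k) t" for t t' j
    using that unfolding brick_E_def up_def down_def by blast
  have inner: "{(t, 2 * i), (t, Suc (2 * i))} \<in> brick_E l k" if "t < 2 * k" "i < l" for t i
    using that unfolding brick_E_def by blast
  fix e assume "e \<in> {{v, w} | v w. v \<in> brick_V l k \<and> w \<in> brick_nbrs l k v}"
  then obtain t j w where e: "e = {(t, j), w}" "(t, j) \<in> brick_V l k" "w \<in> brick_nbrs l k (t, j)" by auto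
  have t: "t < 2 * k" "j < 2 * l" using e by (auto simp: brick_V_def)
  show "e \<in> brick_E l k"
  proof (cases "w = (t, if even j then Suc j else j - 1)")
    case True
    have "j div 2 < l" using t by auto
    note i = inner[OF t(1) this]
    show ?thesis
    proof (cases "even j")
      case even: True
      then have "2 * (j div 2) = j" by simp
      then show ?thesis using i True even e by simp
    next
      case odd: False
      then have "Suc (2 * (j div 2)) = j" "2 * (j div 2) = j - 1" by (auto elim!: oddE)
      then have "{(t, j - 1), (t, j)} \<in> brick_E l k" using i by simp
      then show ?thesis using True odd e by (simp add: insert_commute)
    qed
  next
    case False
    then obtain t' where w: "w = (t', if even t then down (2 * l) j else up (2 * l) j)"
      "t' = up (2 * k) t \<or> t' = down (2 * k) t"
      using e(3) by (auto simp: brick_nbrs_def Let_def)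
    show ?thesis
    proof (cases "even t")
      case True
      then show ?thesis using cross[OF True t w(2)] w e by simp
    next
      case odd: False
      have "even t'" "t' < 2 * k" "up (2 * l) j < 2 * l" "t = up (2 * k) t' \<or> t = down (2 * k) t'"
        using w(2) t odd by (auto simp: up_down_less up_down_inverse up_down_parity)
      from cross[OF this] have "{(t', up (2 * l) j), (t, j)} \<in> brick_E l k"
        using t by (simp add: up_down_inverse)
      then show ?thesis using w odd e by (simp add: insert_commute)
    qed
  qed
qed

text \<open>The three neighbours lie in three different layers, since the layers form a cycle of
  length at least 4.\<close>

lemma card_brick_nbrs:
  assumes "k \<ge> 2" "v \<in> brick_V l k"
  shows "card (brick_nbrs l k v) = 3"
proof -
  obtain t j where [simp]: "v = (t, j)" by (cases v)
  have t: "t < 2 * k" using assms by (auto simp: brick_V_def)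
  have "up (2 * k) t \<noteq> t" "down (2 * k) t \<noteq> t" "up (2 * k) t \<noteq> down (2 * k) t"
    using t assms(1) by (intro up_down_neq up_neq_down; simp)+
  then have "t \<noteq> up (2 * k) t" "t \<noteq> down (2 * k) t" "up (2 * k) t \<noteq> down (2 * k) t" by metis+
  then show ?thesis by (simp add: brick_nbrs_def Let_def)
qed

lemma regular_bipartite_brick:
  assumes "k \<ge> 2"
  shows "regular_graph 3 (brick_V l k) (brick_E l k)" "bipartite_graph (brick_V l k) (brick_E l k)"
proof -
  have "finite (brick_V l k)" by (simp add: brick_V_def)
  from regular_bipartite_graphI[where c = "\<lambda>v. even (snd v)", OF this brick_nbrs_sym card_brick_nbrs[OF assms] brick_E_eq]
  show "regular_graph 3 (brick_V l k) (brick_E l k)" "bipartite_graph (brick_V l k) (brick_E l k)" by blast+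
qed

lemma graph_image:
  fixes \<phi> :: "'a \<Rightarrow> 'b"
  assumes \<phi>: "inj \<phi>"
  shows "regular_graph d V E \<Longrightarrow> regular_graph d (\<phi> ` V) ((`) \<phi> ` E)"
    and "bipartite_graph V E \<Longrightarrow> bipartite_graph (\<phi> ` V) ((`) \<phi> ` E)"
proof -
  have c: "card (\<phi> ` X) = card X" for X using \<phi> by (simp add: card_image inj_on_subset)
  have simple: "simple_graph (\<phi> ` V) ((`) \<phi> ` E)" if "simple_graph V E"
    using that by (auto simp: simple_graph_def c)
  have deg: "degree ((`) \<phi> ` E) (\<phi> v) = degree E v" for v
  proof -
    have "{e \<in> (`) \<phi> ` E. \<phi> v \<in> e} = (`) \<phi> ` {e \<in> E. v \<in> e}"
      using \<phi> by (auto simp: inj_eq)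
    moreover have "inj_on ((`) \<phi>) {e \<in> E. v \<in> e}"
      using \<phi> by (auto simp: inj_on_def inj_image_eq_iff)
    ultimately show ?thesis by (simp add: degree_def card_image)
  qed
  show "regular_graph d V E \<Longrightarrow> regular_graph d (\<phi> ` V) ((`) \<phi> ` E)"
    using simple deg by (auto simp: regular_graph_def)
  assume "bipartite_graph V E"
  then obtain A B where AB: "simple_graph V E" "A \<union> B = V" "A \<inter> B = {}"
    "\<forall>e\<in>E. card (e \<inter> A) = 1 \<and> card (e \<inter> B) = 1" by (auto simp: bipartite_graph_def)
  have "\<phi> ` A \<union> \<phi> ` B = \<phi> ` V" "\<phi> ` A \<inter> \<phi> ` B = {}"
    using AB \<phi> by (auto simp: inj_eq)
  moreover have "\<forall>e\<in>(`) \<phi> ` E. card (e \<inter> \<phi> ` A) = 1 \<and> card (e \<inter> \<phi> ` B) = 1"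
    using AB(4) by (simp add: image_Int[OF \<phi>, symmetric] c)
  ultimately show "bipartite_graph (\<phi> ` V) ((`) \<phi> ` E)"
    using simple[OF AB(1)] unfolding bipartite_graph_def by blast
qed

section \<open>Dense graphs\<close>

text \<open>Deleting an element of at most average value does not lower the average.\<close>

lemma averaging_subset:
  fixes f :: "'a \<Rightarrow> real"
  assumes "finite S" "k \<le> card S"
  obtains X where "X \<subseteq> S" "card X = k" "real k * sum f S \<le> real (card S) * sum f X"
proof -
  have "\<exists>X\<subseteq>S. card X = k \<and> real k * sum f S \<le> real (card S) * sum f X"
    using assms(2)
  proof (induction k rule: inc_induct)
    case base
    then show ?case by blast
  next
    case (step k)
    then obtain X where X: "X \<subseteq> S" "card X = Suc k" "real (Suc k) * sum f S \<le> real (card S) * sum f X"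
      by blast
    have finX: "finite X" "X \<noteq> {}" using X assms(1) finite_subset by auto
    obtain x where x: "x \<in> X" "f x * real (Suc k) \<le> sum f X"
    proof -
      have "\<exists>x\<in>X. f x \<le> sum f X / Suc k"
      proof (rule ccontr)
        assume "\<not> ?thesis"
        then have "(\<Sum>x\<in>X. sum f X / Suc k) < sum f X" using finX by (intro sum_strict_mono) auto
        then show False using X(2) by simp
      qed
      then show ?thesis using that by (auto simp: field_simps)
    qed
    have "real k * A \<le> real (Suc k) * (A - f x)" if "f x * real (Suc k) \<le> A" for A
      using that by (simp add: algebra_simps)
    moreover have "sum f (X - {x}) = sum f X - f x" using x finX by (simp add: sum_diff1)
    ultimately have "real (Suc k) * sum f (X - {x}) \<ge> real k * sum f X" using x(2) by metis
    then have "real (card S) * (real (Suc k) * sum f (X - {x})) \<ge> real (card S) * (real k * sum f X)"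
      by (intro mult_left_mono) auto
    moreover have "real k * (real (Suc k) * sum f S) \<le> real k * (real (card S) * sum f X)"
      using X(3) by (intro mult_left_mono) auto
    ultimately have "real (Suc k) * (real k * sum f S) \<le> real (Suc k) * (real (card S) * sum f (X - {x}))"
      by (simp only: mult_ac)
    then have "real k * sum f S \<le> real (card S) * sum f (X - {x})"
      by (rule mult_left_le_imp_le) simp
    moreover have "X - {x} \<subseteq> S" "card (X - {x}) = k" using X x by auto
    ultimately show ?case by blast
  qed
  then show thesis using that by blast
qed

text \<open>Each new vertex is put on the side opposite to at least half of its earlier
  neighbours.\<close>

lemma bipartite_half:
  fixes R :: "('a \<times> 'a) set"
  assumes "finite V" "R \<subseteq> V \<times> V" "sym R" "irrefl R"
  obtains P Q where "P \<inter> Q = {}" "card R \<le> 2 * card (R \<inter> (P \<times> Q \<union> Q \<times> P))"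
proof -
  have "\<exists>P Q. P \<inter> Q = {} \<and> P \<union> Q = V \<and> card R \<le> 2 * card (R \<inter> (P \<times> Q \<union> Q \<times> P))"
    using assms
  proof (induction V arbitrary: R rule: finite_induct)
    case empty
    then show ?case by auto
  next
    case (insert v V)
    define R' where "R' = R \<inter> V \<times> V"
    define N where "N = R `` {v}"
    have NV: "N \<subseteq> V" using insert.prems by (auto simp: N_def irrefl_def)
    have finN: "finite N" using NV insert.hyps finite_subset by blast
    have finR: "finite R" using insert.prems(1) insert.hyps by (meson finite.insertI finite_SigmaI finite_subset)
    have "R' \<subseteq> V \<times> V" "sym R'" "irrefl R'" using insert.prems by (auto simp: R'_def sym_def irrefl_def)
    from insert.IH[OF this] obtain P Q where PQ: "P \<inter> Q = {}" "P \<union> Q = V"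
      "card R' \<le> 2 * card (R' \<inter> (P \<times> Q \<union> Q \<times> P))" by blast
    have R: "R = R' \<union> (Pair v ` N \<union> (\<lambda>x. (x, v)) ` N)"
      using insert.prems by (auto simp: R'_def N_def sym_def irrefl_def)
    have "card R \<le> card R' + (card (Pair v ` N) + card ((\<lambda>x. (x, v)) ` N))"
      by (subst R) (intro order_trans[OF card_Un_le] add_left_mono card_Un_le)
    also have "\<dots> \<le> card R' + (card N + card N)"
      using finN by (intro add_mono card_image_le order_refl)
    finally have cR: "card R \<le> card R' + 2 * card N" by simp
    have step: "card (R' \<inter> (A \<times> B \<union> B \<times> A)) + 2 * card (N \<inter> B)
        \<le> card (R \<inter> (insert v A \<times> B \<union> B \<times> insert v A))" if "A \<subseteq> V" "B \<subseteq> V" for A B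
    proof -
      have v: "v \<notin> V" by (rule insert.hyps)
      have "card (R' \<inter> (A \<times> B \<union> B \<times> A) \<union> (Pair v ` (N \<inter> B) \<union> (\<lambda>x. (x, v)) ` (N \<inter> B)))
        = card (R' \<inter> (A \<times> B \<union> B \<times> A)) + (card (Pair v ` (N \<inter> B)) + card ((\<lambda>x. (x, v)) ` (N \<inter> B)))"
        using v that NV finN finR
        by (subst card_Un_disjoint; auto simp: R'_def intro!: card_Un_disjoint)
      also have "\<dots> = card (R' \<inter> (A \<times> B \<union> B \<times> A)) + 2 * card (N \<inter> B)"
        by (simp add: card_image inj_on_def)
      also have "R' \<inter> (A \<times> B \<union> B \<times> A) \<union> (Pair v ` (N \<inter> B) \<union> (\<lambda>x. (x, v)) ` (N \<inter> B))
          \<subseteq> R \<inter> (insert v A \<times> B \<union> B \<times> insert v A)"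
        by (subst R) auto
      then have "card (R' \<inter> (A \<times> B \<union> B \<times> A) \<union> (Pair v ` (N \<inter> B) \<union> (\<lambda>x. (x, v)) ` (N \<inter> B)))
          \<le> card (R \<inter> (insert v A \<times> B \<union> B \<times> insert v A))"
        using finR by (intro card_mono) auto
      ultimately show ?thesis by linarith
    qed
    have "card N \<le> card (N \<inter> P) + card (N \<inter> Q)"
    proof -
      have "N = N \<inter> P \<union> N \<inter> Q" using NV PQ by blast
      then show ?thesis using card_Un_le[of "N \<inter> P" "N \<inter> Q"] by simp
    qed
    moreover have sub: "P \<subseteq> V" "Q \<subseteq> V" using PQ by auto
    ultimately consider "card N \<le> 2 * card (N \<inter> P)" | "card N \<le> 2 * card (N \<inter> Q)" by linarith
    then show ?case
    proof cases
      case 1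
      have "card R \<le> 2 * card (R \<inter> (insert v Q \<times> P \<union> P \<times> insert v Q))"
        using step[OF sub(2,1)] PQ(3) cR 1 unfolding Un_commute[of "Q \<times> P"] by linarith
      moreover have "insert v Q \<inter> P = {}" "insert v Q \<union> P = insert v V" using PQ insert.hyps by auto
      ultimately show ?thesis by blast
    next
      case 2
      have "card R \<le> 2 * card (R \<inter> (insert v P \<times> Q \<union> Q \<times> insert v P))"
        using step[OF sub] PQ(3) cR 2 by linarith
      moreover have "insert v P \<inter> Q = {}" "insert v P \<union> Q = insert v V" using PQ insert.hyps by auto
      ultimately show ?thesis by blast
    qed
  qed
  then show thesis using that by blast
qed

lemma densest_subset:
  fixes R :: "('a \<times> 'a) set" and \<alpha> :: real
  assumes V: "finite V" "V \<noteq> {}"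
  obtains S where "S \<subseteq> V" "S \<noteq> {}"
    "\<And>S'. S' \<subseteq> V \<Longrightarrow> card (R \<inter> S' \<times> S') * real (card S) powr \<alpha> \<le> card (R \<inter> S \<times> S) * real (card S') powr \<alpha>"
proof -
  define f where "f S = real (card (R \<inter> S \<times> S)) / real (card S) powr \<alpha>" for S
  have fin: "finite (f ` (Pow V - {{}}))" using V by auto
  have "V \<in> Pow V - {{}}" using V by simp
  then have "Max (f ` (Pow V - {{}})) \<in> f ` (Pow V - {{}})" using fin by (intro Max_in) auto
  then obtain S where S: "S \<subseteq> V" "S \<noteq> {}" "Max (f ` (Pow V - {{}})) = f S" by auto
  have pos: "real (card S') powr \<alpha> > 0" if "S' \<subseteq> V" "S' \<noteq> {}" for S'
  proof -
    have "finite S'" using that(1) V(1) by (rule finite_subset)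
    then show ?thesis using that by (simp add: card_gt_0_iff)
  qed
  show thesis
  proof (rule that[OF S(1,2)])
    fix S' assume S': "S' \<subseteq> V"
    show "card (R \<inter> S' \<times> S') * real (card S) powr \<alpha> \<le> card (R \<inter> S \<times> S) * real (card S') powr \<alpha>"
    proof (cases "S' = {}")
      case False
      then have "f S' \<le> Max (f ` (Pow V - {{}}))" using S' fin by (intro Max_ge) auto
      then have "f S' \<le> f S" by (simp only: S(3))
      then show ?thesis using pos[OF S(1,2)] pos[OF S' False] by (simp add: f_def field_simps)
    qed simp
  qed
qed

lemma sum_card_fibres:
  assumes "finite Z" "\<And>x. finite (R `` {x})"
  shows "(\<Sum>x\<in>Z. real (card (R `` {x} \<inter> B))) = real (card (R \<inter> Z \<times> B))"
proof -
  have "R \<inter> Z \<times> B = (SIGMA x:Z. R `` {x} \<inter> B)" by auto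
  then show ?thesis using assms by (simp add: card_SigmaI)
qed

text \<open>The vertices of too large degree form a set \<open>B\<close> of at most \<theta>^3 m
  vertices. Together with equally many vertices that receive an average share of the edges at
  \<open>B\<close>, they would form a small set that is too dense for the maximality of
  \<open>S\<close>, unless few edges meet \<open>B\<close>.\<close>

lemma regular_subgraph:
  fixes R :: "('a \<times> 'a) set" and \<alpha> \<theta> :: real
  assumes S: "finite S" "S \<noteq> {}" and R: "R \<subseteq> S \<times> S" "sym R"
    and max: "\<And>S'. S' \<subseteq> S \<Longrightarrow> card (R \<inter> S' \<times> S') * real (card S) powr \<alpha> \<le> card R * real (card S') powr \<alpha>"
    and \<alpha>: "4 / 3 \<le> \<alpha>" "\<alpha> \<le> 2" and \<theta>: "0 < \<theta>" "\<theta> \<le> 1 / 16"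
  shows "\<exists>E\<subseteq>R. sym E \<and> real (card E) \<ge> card R / 2 \<and>
    (\<forall>x. real (deg E x) \<le> (card R / card S) * (1 / \<theta>) ^ 3)"
proof -
  define e where "e = real (card R)"
  define m where "m = real (card S)"
  have m: "m > 0" using S by (simp add: m_def card_gt_0_iff)
  have finR: "finite R" using R(1) S(1) by (meson finite_SigmaI finite_subset)
  define B where "B = {v \<in> S. real (deg R v) > (e / m) * (1 / \<theta>) ^ 3}"
  have finB: "finite B" "B \<subseteq> S" using S by (auto simp: B_def)
  have finN: "finite (R `` {x})" for x by (rule finite_subset[OF _ S(1)]) (use R(1) in auto)
  have sum_deg: "(\<Sum>v\<in>Z. real (deg R v)) = real (card (R \<inter> Z \<times> UNIV))" if "finite Z" for Z
    using sum_card_fibres[OF that finN, of UNIV] unfolding deg_def by simp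
  have cB: "real (card B) \<le> m * \<theta> ^ 3"
  proof (cases "e = 0")
    case True
    then have "R = {}" using finR by (simp add: e_def)
    then have "B = {}" using True by (auto simp: B_def deg_def)
    then show ?thesis using m \<theta> by simp
  next
    case False
    then have e: "e > 0" by (simp add: e_def)
    have "real (card B) * ((e / m) * (1 / \<theta>) ^ 3) = (\<Sum>v\<in>B. (e / m) * (1 / \<theta>) ^ 3)" by simp
    also have "\<dots> \<le> (\<Sum>v\<in>B. real (deg R v))" by (rule sum_mono) (simp add: B_def)
    also have "\<dots> \<le> e" unfolding sum_deg[OF finB(1)] e_def of_nat_le_iff using finR by (intro card_mono) auto
    finally show ?thesis using e m \<theta> by (simp add: field_simps)
  qed
  define b where "b = real (card (R \<inter> B \<times> UNIV))"
  have b: "b \<le> e / 4"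
  proof (cases "B = {}")
    case True
    then show ?thesis by (simp add: b_def e_def)
  next
    case False
    then have cB0: "card B > 0" using finB by (simp add: card_gt_0_iff)
    have BS: "card B \<le> card S" using finB S by (intro card_mono)
    obtain X where X: "X \<subseteq> S" "card X = card B"
      "real (card B) * (\<Sum>x\<in>S. real (card (R `` {x} \<inter> B))) \<le> m * (\<Sum>x\<in>X. real (card (R `` {x} \<inter> B)))"
      using averaging_subset[OF S(1) BS, of "\<lambda>x. real (card (R `` {x} \<inter> B))"] unfolding m_def by blast
    have finX: "finite X" using X(1) S(1) by (rule finite_subset)
    have sum_B: "(\<Sum>x\<in>Z. real (card (R `` {x} \<inter> B))) = real (card (R \<inter> Z \<times> B))" if "finite Z" for Z
      by (rule sum_card_fibres[OF that finN])
    have "R \<inter> S \<times> B = (R \<inter> B \<times> UNIV)\<inverse>" using R by (auto simp: sym_def)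
    then have "(\<Sum>x\<in>S. real (card (R `` {x} \<inter> B))) = b" using sum_B[OF S(1)] by (simp add: b_def card_inverse)
    then have 1: "real (card B) * b \<le> m * real (card (R \<inter> X \<times> B))" using X(3) sum_B[OF finX] by simp
    let ?Y = "X \<union> B"
    have "card (R \<inter> X \<times> B) \<le> card (R \<inter> ?Y \<times> ?Y)" using finR by (intro card_mono) auto
    then have 2: "real (card B) * b \<le> m * real (card (R \<inter> ?Y \<times> ?Y))"
      using m by (intro order_trans[OF 1] mult_left_mono) auto
    have "real (card ?Y) \<le> 2 * real (card B)" using card_Un_le[of X B] X(2) by linarith
    then have "real (card ?Y) powr \<alpha> \<le> (2 * real (card B)) powr \<alpha>" using \<alpha> by (intro powr_mono2) auto
    also have "\<dots> = 2 powr \<alpha> * real (card B) powr \<alpha>" by (simp add: powr_mult)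
    also have "\<dots> \<le> 2 powr 2 * real (card B) powr \<alpha>" using \<alpha> by (intro mult_right_mono powr_mono) auto
    finally have Y: "real (card ?Y) powr \<alpha> \<le> 4 * real (card B) powr \<alpha>" by simp
    have "real (card (R \<inter> ?Y \<times> ?Y)) * m powr \<alpha> \<le> e * real (card ?Y) powr \<alpha>"
      using max[of ?Y] X(1) finB(2) by (simp add: e_def m_def)
    also have "\<dots> \<le> e * (4 * real (card B) powr \<alpha>)" using Y by (intro mult_left_mono) (auto simp: e_def)
    finally have 3: "real (card (R \<inter> ?Y \<times> ?Y)) * m powr \<alpha> \<le> e * (4 * real (card B) powr \<alpha>)" .
    have "b * (real (card B) * m powr \<alpha>) \<le> m * (real (card (R \<inter> ?Y \<times> ?Y)) * m powr \<alpha>)"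
      using mult_right_mono[OF 2, of "m powr \<alpha>"] by (simp add: mult_ac)
    also have "\<dots> \<le> m * (e * (4 * real (card B) powr \<alpha>))" using 3 m by (intro mult_left_mono) auto
    finally have 4: "b * (real (card B) * m powr \<alpha>) \<le> m * (e * (4 * real (card B) powr \<alpha>))" .
    have c0: "real (card B) > 0" using cB0 by simp
    have split: "x powr \<alpha> = x * x powr (\<alpha> - 1)" if "x > 0" for x :: real
      using that by (simp add: powr_diff)
    have "(real (card B) * m) * (b * m powr (\<alpha> - 1)) \<le> (real (card B) * m) * (4 * e * real (card B) powr (\<alpha> - 1))"
      using 4 unfolding split[OF m] split[OF c0] by (simp only: mult_ac)
    then have "b * m powr (\<alpha> - 1) \<le> 4 * e * real (card B) powr (\<alpha> - 1)"
      by (rule mult_left_le_imp_le) (use c0 m in simp)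
    also have "\<dots> \<le> 4 * e * (m * \<theta> ^ 3) powr (\<alpha> - 1)"
      using cB \<alpha> by (intro mult_left_mono powr_mono2) (auto simp: e_def)
    also have "\<dots> = (4 * e * (\<theta> ^ 3) powr (\<alpha> - 1)) * m powr (\<alpha> - 1)"
      using m \<theta> by (simp add: powr_mult)
    finally have "b \<le> 4 * e * (\<theta> ^ 3) powr (\<alpha> - 1)"
      by (rule mult_right_le_imp_le) (use m in simp)
    \<comment> \<open>As \<open>\<alpha> - 1\<close> is at least 1/3, the cube in the degree bound
      yields a full factor \<theta>, enough to beat the constant 4.\<close>
    also have "(\<theta> ^ 3) powr (\<alpha> - 1) \<le> (\<theta> ^ 3) powr (1 / 3)"
      using \<theta> \<alpha> by (intro powr_mono') (auto intro: power_le_one)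
    also have "(\<theta> ^ 3) powr (1 / 3) = (\<theta> powr 3) powr (1 / 3)" using \<theta> by simp
    also have "\<dots> = \<theta>" unfolding powr_powr using \<theta> by simp
    also have "4 * e * \<theta> \<le> 4 * e * (1 / 16)" using \<theta> by (intro mult_left_mono) (auto simp: e_def)
    finally show ?thesis by (simp add: mult_left_mono e_def)
  qed
  define E where "E = R \<inter> (S - B) \<times> (S - B)"
  show ?thesis
  proof (intro exI[of _ E] conjI allI)
    show ER: "E \<subseteq> R" by (auto simp: E_def)
    show "sym E" using R(2) by (auto simp: E_def sym_def)
    have "R \<subseteq> E \<union> (R \<inter> B \<times> UNIV \<union> (R \<inter> B \<times> UNIV)\<inverse>)" using R by (auto simp: E_def sym_def)
    then have "card R \<le> card (E \<union> (R \<inter> B \<times> UNIV \<union> (R \<inter> B \<times> UNIV)\<inverse>))"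
      using finR ER finite_subset by (intro card_mono) auto
    also have "\<dots> \<le> card E + (card (R \<inter> B \<times> UNIV) + card ((R \<inter> B \<times> UNIV)\<inverse>))"
      by (intro order_trans[OF card_Un_le] add_left_mono card_Un_le)
    finally have "e \<le> real (card E) + 2 * b" by (simp add: e_def b_def card_inverse)
    then show "real (card E) \<ge> card R / 2" using b by (simp add: e_def)
    fix x
    show "real (deg E x) \<le> (card R / card S) * (1 / \<theta>) ^ 3"
    proof (cases "x \<in> S - B")
      case True
      have "deg E x \<le> deg R x" unfolding deg_def by (intro card_mono finN) (use ER in auto)
      then show ?thesis using True by (auto simp: B_def e_def m_def not_less)
    next
      case False
      then have "E `` {x} = {}" by (auto simp: E_def)
      then show ?thesis using \<theta> by (simp add: deg_def)
    qed
  qed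
qed

text \<open>The surplus \<open>1 / r\<close> in the exponent is halved. One half stays in \<alpha>
  and provides the surplus of the degree over the cube root of \<open>m\<close>; the other half
  becomes the factor \<open>c\<close>, which forces the densest subset to be large.\<close>

lemma dense_bipartite_embeds:
  fixes r :: nat
  assumes r: "r \<ge> 1"
  obtains N where "\<And>V P Q (R :: ('a \<times> 'a) set). finite V \<Longrightarrow> N \<le> card V \<Longrightarrow> R \<subseteq> V \<times> V \<Longrightarrow> sym R \<Longrightarrow>
      R \<subseteq> P \<times> Q \<union> Q \<times> P \<Longrightarrow> P \<inter> Q = {} \<Longrightarrow> real (card V) powr (4 / 3 + 1 / r) \<le> card R \<Longrightarrow>
      embeds (512 * r\<^sup>2) (2 * (512 * r\<^sup>2) * (512 * r\<^sup>2) + 1) R"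
proof -
  define l where "l = 512 * r\<^sup>2"
  have "1 \<le> r\<^sup>2" using r by simp
  then have l: "l \<ge> 2" by (simp add: l_def)
  obtain \<theta>1 where \<theta>1: "\<theta>1 > 0" "\<And>\<theta>. 0 < \<theta> \<Longrightarrow> \<theta> \<le> \<theta>1 \<Longrightarrow>
    40 * (real l)\<^sup>2 * \<theta> \<le> 1 \<and> (2 * (2 * real l * real l + 1))\<^sup>2 * sqrt (2 * real l * \<theta>) < 1"
    using theta_threshold[OF l] by blast
  define \<theta>0 where "\<theta>0 = min \<theta>1 (1 / 16)"
  have \<theta>0: "\<theta>0 > 0" "\<theta>0 \<le> 1 / 16" "\<theta>0 \<le> \<theta>1" using \<theta>1(1) by (auto simp: \<theta>0_def)
  define M0 where "M0 = (1 / \<theta>0) ^ l"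
  have M0: "M0 \<ge> 1" unfolding M0_def using \<theta>0 by (intro one_le_power) simp
  define \<alpha> where "\<alpha> = 4 / 3 + 1 / (2 * real r)"
  have rr: "1 / (2 * real r) \<le> 1 / 2" "0 < 1 / (2 * real r)" using r by (auto simp: field_simps)
  then have \<alpha>: "4 / 3 \<le> \<alpha>" "\<alpha> \<le> 2" unfolding \<alpha>_def by linarith+
  obtain N :: nat where N: "M0 ^ (2 * r) \<le> real N" using real_arch_simple by blast
  show thesis
  proof (rule that[of "max N 1"])
    fix V P Q and R :: "('a \<times> 'a) set"
    assume V: "finite V" "max N 1 \<le> card V" and R: "R \<subseteq> V \<times> V" "sym R"
      and bip: "R \<subseteq> P \<times> Q \<union> Q \<times> P" "P \<inter> Q = {}"
      and dense: "real (card V) powr (4 / 3 + 1 / r) \<le> card R"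
    define n where "n = real (card V)"
    have n: "n \<ge> 1" "n \<ge> real N" using V by (auto simp: n_def)
    define c where "c = n powr (1 / (2 * real r))"
    have c: "c \<ge> M0"
    proof -
      have "M0 = (M0 ^ (2 * r)) powr (1 / (2 * real r))"
        using M0 r by (simp add: powr_realpow[symmetric] powr_powr)
      also have "\<dots> \<le> c" unfolding c_def using N n M0 by (intro powr_mono2) auto
      finally show ?thesis .
    qed
    have "V \<noteq> {}" using V by auto
    from densest_subset[OF V(1) this, of R \<alpha>] obtain S where S: "S \<subseteq> V" "S \<noteq> {}"
      and max: "\<And>S'. S' \<subseteq> V \<Longrightarrow> card (R \<inter> S' \<times> S') * real (card S) powr \<alpha> \<le> card (R \<inter> S \<times> S) * real (card S') powr \<alpha>"
      by blast
    have finS: "finite S" using S(1) V(1) by (rule finite_subset)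
    define R' where "R' = R \<inter> S \<times> S"
    define m where "m = real (card S)"
    define e where "e = real (card R')"
    have m1: "m \<ge> 1" using finS S(2) by (simp add: m_def Suc_le_eq card_gt_0_iff)
    have e1: "c * m powr \<alpha> \<le> e"
    proof -
      have "R \<inter> V \<times> V = R" using R by blast
      then have "real (card R) * m powr \<alpha> \<le> e * n powr \<alpha>" using max[of V] by (simp add: m_def e_def n_def R'_def)
      moreover have "\<alpha> + 1 / (2 * real r) = 4 / 3 + 1 / real r" using r by (simp add: \<alpha>_def field_simps)
      then have "n powr \<alpha> * c = n powr (4 / 3 + 1 / r)"
        by (simp only: c_def powr_add[symmetric])
      then have "n powr \<alpha> * c \<le> real (card R)" using dense by (simp add: n_def)
      then have "n powr \<alpha> * c * m powr \<alpha> \<le> real (card R) * m powr \<alpha>" by (rule mult_right_mono) simp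
      ultimately have "n powr \<alpha> * (c * m powr \<alpha>) \<le> n powr \<alpha> * e" by (simp add: mult_ac)
      then show ?thesis by (rule mult_left_le_imp_le) (use n in simp)
    qed
    have e2: "e \<le> m * m"
    proof -
      have "card R' \<le> card (S \<times> S)" using finS by (intro card_mono) (auto simp: R'_def)
      then have "real (card R') \<le> real (card S * card S)" unfolding card_cartesian_product of_nat_le_iff .
      then show ?thesis by (simp add: e_def m_def)
    qed
    \<comment> \<open>The subset spans at least \<open>c * m\<close> ordered pairs and at most
      \<open>m * m\<close>, so \<open>m \<ge> c\<close>.\<close>
    have mM0: "m \<ge> M0"
    proof -
      have "m powr 1 \<le> m powr \<alpha>" using m1 \<alpha> by (intro powr_mono) auto
      then have "c * m \<le> c * m powr \<alpha>" using c M0 m1 by (intro mult_left_mono) auto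
      then have "c * m \<le> m * m" using e1 e2 by linarith
      then have "c \<le> m" by (rule mult_right_le_imp_le) (use m1 in simp)
      then show ?thesis using c by linarith
    qed
    define \<theta> where "\<theta> = 1 / m powr (1 / l)"
    have l0: "real l > 0" using l by simp
    have \<theta>: "0 < \<theta>" using m1 by (simp add: \<theta>_def)
    have inv_pow: "(1 / \<theta>) ^ i = m powr (i / l)" for i
      using m1 by (simp add: \<theta>_def powr_realpow[symmetric] powr_powr)
    have ml: "m = (1 / \<theta>) ^ l" using inv_pow[of l] l0 m1 by simp
    have \<theta>\<theta>0: "\<theta> \<le> \<theta>0"
    proof -
      obtain l' where l': "l = Suc l'" using l by (cases l) auto
      have "(1 / \<theta>0) ^ l \<le> (1 / \<theta>) ^ l" using mM0 ml by (simp add: M0_def)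
      then have "1 / \<theta>0 \<le> 1 / \<theta>" unfolding l' by (rule power_le_imp_le_base) (use \<theta> in simp)
      then show ?thesis using \<theta> \<theta>0(1) by (simp add: field_simps)
    qed
    have R'S: "R' \<subseteq> S \<times> S" by (auto simp: R'_def)
    have symR': "sym R'" using R(2) by (auto simp: R'_def sym_def)
    have max': "card (R' \<inter> S' \<times> S') * real (card S) powr \<alpha> \<le> card R' * real (card S') powr \<alpha>" if "S' \<subseteq> S" for S'
    proof -
      have "R' \<inter> S' \<times> S' = R \<inter> S' \<times> S'" using that by (auto simp: R'_def)
      then show ?thesis using max[of S'] that S(1) unfolding R'_def by simp
    qed
    obtain E where E: "E \<subseteq> R'" "sym E" "real (card E) \<ge> card R' / 2"
      "\<And>x. real (deg E x) \<le> (card R' / card S) * (1 / \<theta>) ^ 3"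
      using regular_subgraph[OF finS S(2) R'S symR' max' \<alpha> \<theta> order_trans[OF \<theta>\<theta>0 \<theta>0(2)]] by blast
    have finR': "finite R'" using R'S finS by (meson finite_SigmaI finite_subset)
    have D3: "(e / m) ^ 3 \<ge> m * (1 / \<theta>) ^ (768 * r)"
    proof -
      have "1 * m powr \<alpha> \<le> c * m powr \<alpha>" using c M0 by (intro mult_right_mono) auto
      then have "m powr \<alpha> \<le> e" using e1 by linarith
      then have "m powr \<alpha> / m \<le> e / m" using m1 by (intro divide_right_mono) auto
      moreover have "m powr \<alpha> / m = m powr (\<alpha> - 1)" using m1 by (simp add: powr_diff)
      ultimately have "(m powr (\<alpha> - 1)) ^ 3 \<le> (e / m) ^ 3" by (intro power_mono) auto
      moreover have "(m powr (\<alpha> - 1)) ^ 3 = m powr ((\<alpha> - 1) * 3)"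
        using m1 by (simp add: powr_realpow[symmetric] powr_powr)
      \<comment> \<open>Both equal 1 + 3/(2r), as 768 r / (512 r^2) = 3/(2r); this ties the exponent
        768 to 512.\<close>
      moreover have "(\<alpha> - 1) * 3 = 1 + real (768 * r) / real l"
        using r by (simp add: \<alpha>_def l_def field_simps power2_eq_square)
      moreover have "m powr (1 + real (768 * r) / real l) = m * (1 / \<theta>) ^ (768 * r)"
        using m1 unfolding inv_pow powr_add by simp
      ultimately show ?thesis by simp
    qed
    have "regular_host E P Q \<theta> (e / m) m r"
    proof
      show "finite E" by (rule finite_subset[OF E(1) finR'])
      show "E \<subseteq> P \<times> Q \<union> Q \<times> P" using E(1) bip by (auto simp: R'_def)
      show "\<theta> \<le> 1 / 2" using \<theta>\<theta>0 \<theta>0 by linarith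
      have "\<theta> \<le> \<theta>1" using \<theta>\<theta>0 \<theta>0 by linarith
      from \<theta>1(2)[OF \<theta> this] show "40 * (real (512 * r\<^sup>2))\<^sup>2 * \<theta> \<le> 1"
        "(2 * (2 * real (512 * r\<^sup>2) * real (512 * r\<^sup>2) + 1))\<^sup>2 * sqrt (2 * real (512 * r\<^sup>2) * \<theta>) < 1"
        unfolding l_def by blast+
      show "m = (1 / \<theta>) ^ (512 * r\<^sup>2)" using ml unfolding l_def .
      have "Domain E \<subseteq> S" using E(1) by (auto simp: R'_def)
      then show "real (card (Domain E)) \<le> m" unfolding m_def of_nat_le_iff using finS by (intro card_mono)
      have "c * m powr \<alpha> > 0" using c M0 m1 by (intro mult_pos_pos) auto
      then have "e > 0" using e1 by linarith
      then show "e / m > 0" using m1 by simp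
      show "real (card E) \<ge> e / m * m / 2" using E(3) m1 by (simp add: e_def)
      show "real (deg E x) \<le> e / m * (1 / \<theta>) ^ 3" for x using E(4) by (simp add: e_def m_def)
    qed (use r \<theta> E(2) bip D3 in auto)
    from regular_host.regular_embeds[OF this] have "embeds (512 * r\<^sup>2) (2 * (512 * r\<^sup>2) * (512 * r\<^sup>2) + 1) E" .
    then show "embeds (512 * r\<^sup>2) (2 * (512 * r\<^sup>2) * (512 * r\<^sup>2) + 1) R"
      by (rule embeds_mono) (use E(1) in \<open>auto simp: R'_def\<close>)
  qed
qed

text \<open>Passing to ordered pairs doubles the count and passing to a bipartite half at most
  halves it, so the density threshold is kept. \<open>prod_encode\<close> only renames the vertices
  of the torus.\<close>

lemma dense_graph_contains_brick:
  fixes r :: nat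
  assumes r: "r \<ge> 1"
  defines "l \<equiv> 512 * r\<^sup>2"
  obtains N where "\<And>n (E :: nat set set). N \<le> n \<Longrightarrow> simple_graph {..<n} E \<Longrightarrow> real n powr (4 / 3 + 1 / r) \<le> card E \<Longrightarrow>
      contains_copy (prod_encode ` brick_V l (2 * l * l + 1)) ((`) prod_encode ` brick_E l (2 * l * l + 1)) {..<n} E"
proof -
  show thesis
  proof (rule dense_bipartite_embeds[OF r, where 'a = nat, folded l_def])
    fix N
    assume N: "\<And>V P Q (R :: (nat \<times> nat) set). finite V \<Longrightarrow> N \<le> card V \<Longrightarrow> R \<subseteq> V \<times> V \<Longrightarrow> sym R \<Longrightarrow>
      R \<subseteq> P \<times> Q \<union> Q \<times> P \<Longrightarrow> P \<inter> Q = {} \<Longrightarrow> real (card V) powr (4 / 3 + 1 / r) \<le> card R \<Longrightarrow>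
      embeds l (2 * l * l + 1) R"
    show thesis
    proof (rule that[of N])
      fix n and E :: "nat set set"
      assume n: "N \<le> n" and E: "simple_graph {..<n} E" and dense: "real n powr (4 / 3 + 1 / r) \<le> card E"
      define R where "R = {(x, y). {x, y} \<in> E}"
      have edge: "e \<subseteq> {..<n}" "card e = 2" if "e \<in> E" for e using E that by (auto simp: simple_graph_def)
      have "E \<subseteq> Pow {..<n}" using edge(1) by blast
      then have finE: "finite E" by (rule finite_subset) simp
      have R: "R \<subseteq> {..<n} \<times> {..<n}" unfolding R_def using edge(1) by blast
      have symR: "sym R" unfolding R_def by (rule symI) (simp add: insert_commute)
      have irr: "irrefl R" unfolding irrefl_def
      proof
        fix x
        show "(x, x) \<notin> R" using edge(2)[of "{x}"] by (auto simp: R_def)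
      qed
      have cR: "card R = 2 * card E"
      proof -
        have "R = (\<Union>e\<in>E. {(x, y). {x, y} = e})" by (auto simp: R_def)
        moreover have pair: "{(x, y). {x, y} = {a, b}} = {(a, b), (b, a)}" for a b :: nat
          by (auto simp: doubleton_eq_iff)
        have c2: "finite {(x, y). {x, y} = e} \<and> card {(x, y). {x, y} = e} = 2" if e: "e \<in> E" for e
        proof -
          obtain a b where "e = {a, b}" "a \<noteq> b" using edge(2)[OF e] by (auto simp: card_2_iff)
          then show ?thesis by (simp add: pair)
        qed
        ultimately have "card R = (\<Sum>e\<in>E. card {(x, y). {x, y} = e})"
          using finE c2 by (simp only:) (intro card_UN_disjoint, auto)
        also have "\<dots> = (\<Sum>e\<in>E. 2)" using c2 by (intro sum.cong) auto
        finally show ?thesis by simp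
      qed
      obtain P Q where PQ: "P \<inter> Q = {}" "card R \<le> 2 * card (R \<inter> (P \<times> Q \<union> Q \<times> P))"
        using bipartite_half[OF _ R symR irr] by blast
      let ?R = "R \<inter> (P \<times> Q \<union> Q \<times> P)"
      have "embeds l (2 * l * l + 1) ?R"
      proof (rule N[of "{..<n}" _ P Q])
        show "sym ?R" using symR by (auto simp: sym_def)
        have "card E \<le> card ?R" using PQ(2) cR by linarith
        then show "real (card {..<n}) powr (4 / 3 + 1 / r) \<le> card ?R" using dense by simp
      qed (use n R PQ in auto)
      then obtain f where f: "inj_on f (brick_V l (2 * l * l + 1))" "f ` brick_V l (2 * l * l + 1) \<subseteq> Domain ?R"
        "\<forall>e\<in>brick_E l (2 * l * l + 1). \<exists>x y. f ` e = {x, y} \<and> (x, y) \<in> ?R"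
        unfolding embeds_def by (elim exE conjE)
      have DR: "Domain ?R \<subseteq> {..<n}" using R by auto
      have comp: "(f \<circ> prod_decode) ` prod_encode ` X = f ` X" for X by (simp add: image_image)
      show "contains_copy (prod_encode ` brick_V l (2 * l * l + 1)) ((`) prod_encode ` brick_E l (2 * l * l + 1)) {..<n} E"
        unfolding contains_copy_def
      proof (intro exI[of _ "f \<circ> prod_decode"] conjI ballI)
        show "inj_on (f \<circ> prod_decode) (prod_encode ` brick_V l (2 * l * l + 1))"
          by (rule comp_inj_on[OF inj_prod_decode]) (use f(1) in \<open>simp only: image_image prod_encode_inverse image_ident\<close>)
        show "(f \<circ> prod_decode) ` prod_encode ` brick_V l (2 * l * l + 1) \<subseteq> {..<n}"
          unfolding comp using f(2) DR by (rule order_trans)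
        fix e' assume "e' \<in> (`) prod_encode ` brick_E l (2 * l * l + 1)"
        then obtain e where e: "e' = prod_encode ` e" "e \<in> brick_E l (2 * l * l + 1)" by (rule imageE)
        obtain x y where "f ` e = {x, y}" "(x, y) \<in> ?R" using bspec[OF f(3) e(2)] by (elim exE conjE)
        then show "(f \<circ> prod_decode) ` e' \<in> E" unfolding e(1) comp by (simp add: R_def)
      qed
    qed
  qed
qed

text \<open>With \<open>EH\<close> nonempty the edgeless graph is admissible, so the
  \<open>Max\<close> is taken over a nonempty set.\<close>

lemma ex_num_le:
  assumes "\<And>E. simple_graph {..<n} E \<Longrightarrow> \<not> contains_copy VH EH {..<n} E \<Longrightarrow> card E \<le> b" and "EH \<noteq> {}"
  shows "ex_num n VH EH \<le> b"
proof -
  let ?X = "{card E | E. simple_graph {..<n} E \<and> \<not> contains_copy VH EH {..<n} E}"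
  have "simple_graph {..<n} ({} :: nat set set)" "\<not> contains_copy VH EH {..<n} {}"
    using assms(2) by (auto simp: simple_graph_def contains_copy_def)
  then have "?X \<noteq> {}" by blast
  moreover have "?X \<subseteq> {..b}" using assms(1) by auto
  then have "finite ?X" by (rule finite_subset) simp
  ultimately have "Max ?X \<in> ?X" by (intro Max_in)
  with \<open>?X \<subseteq> {..b}\<close> show ?thesis unfolding ex_num_def by blast
qed

theorem theorem1p4:
  fixes \<epsilon> :: real
  assumes "\<epsilon> > 0"
  shows "\<exists>(VH :: nat set) (EH :: nat set set).
           VH \<noteq> {} \<and> regular_graph 3 VH EH \<and> bipartite_graph VH EH \<and>
           (\<lambda>n. real (ex_num n VH EH)) \<in> O[at_top](\<lambda>n. real n powr (4/3 + \<epsilon>))"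
proof -
  obtain r :: nat where r: "1 / \<epsilon> \<le> real r" "r \<ge> 1"
  proof -
    obtain r where "1 / \<epsilon> \<le> real r" using real_arch_simple by blast
    then show ?thesis using that[of "max r 1"] by (simp add: le_max_iff_disj)
  qed
  have r\<epsilon>: "1 / real r \<le> \<epsilon>" using r assms by (simp add: field_simps)
  define l where "l = 512 * r\<^sup>2"
  define k where "k = 2 * l * l + 1"
  have l: "l \<ge> 2" using r one_le_power[of r 2] unfolding l_def by linarith
  have "1 * 1 \<le> l * l" using l by (intro mult_mono) auto
  then have k: "k \<ge> 2" by (simp add: k_def)
  define VH where "VH = prod_encode ` brick_V l k"
  define EH where "EH = (`) prod_encode ` brick_E l k"
  have 0: "(0, 0) \<in> brick_V l k" using l k by (simp add: brick_V_def)
  have "{(0, 0), (0, 1)} \<in> brick_E l k"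
    using l k unfolding brick_E_def by (intro UnI1 CollectI exI[of _ 0]) auto
  then have EH: "EH \<noteq> {}" by (auto simp: EH_def)
  obtain N where N: "\<And>n (E :: nat set set). N \<le> n \<Longrightarrow> simple_graph {..<n} E \<Longrightarrow>
      real n powr (4 / 3 + 1 / r) \<le> card E \<Longrightarrow> contains_copy VH EH {..<n} E"
    using dense_graph_contains_brick[OF r(2)] unfolding VH_def EH_def k_def l_def by blast
  have bound: "real (ex_num n VH EH) \<le> real n powr (4 / 3 + \<epsilon>)" if n: "max N 1 \<le> n" for n
  proof -
    have "ex_num n VH EH \<le> nat \<lfloor>real n powr (4 / 3 + 1 / r)\<rfloor>"
    proof (rule ex_num_le[OF _ EH])
      fix E :: "nat set set" assume "simple_graph {..<n} E" "\<not> contains_copy VH EH {..<n} E"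
      then have "card E < real n powr (4 / 3 + 1 / r)" using N[of n E] n by force
      then show "card E \<le> nat \<lfloor>real n powr (4 / 3 + 1 / r)\<rfloor>" by (simp add: le_nat_floor)
    qed
    then have "real (ex_num n VH EH) \<le> real (nat \<lfloor>real n powr (4 / 3 + 1 / r)\<rfloor>)" by (rule of_nat_mono)
    also have "\<dots> \<le> real n powr (4 / 3 + 1 / r)" by (rule of_nat_floor) simp
    also have "\<dots> \<le> real n powr (4 / 3 + \<epsilon>)" using n r\<epsilon> by (intro powr_mono) auto
    finally show ?thesis .
  qed
  show ?thesis
  proof (intro exI[of _ VH] exI[of _ EH] conjI)
    show "VH \<noteq> {}" using 0 by (auto simp: VH_def)
    show "regular_graph 3 VH EH" "bipartite_graph VH EH"
      unfolding VH_def EH_def using graph_image[OF inj_prod_encode] regular_bipartite_brick[OF k] by blast+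
    show "(\<lambda>n. real (ex_num n VH EH)) \<in> O[at_top](\<lambda>n. real n powr (4/3 + \<epsilon>))"
    proof (rule bigoI[of _ 1])
      show "\<forall>\<^sub>F n in at_top. norm (real (ex_num n VH EH)) \<le> 1 * norm (real n powr (4 / 3 + \<epsilon>))"
        using eventually_ge_at_top[of "max N 1"] by eventually_elim (use bound in simp)
    qed
  qed
qed

end
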